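(* Let $n$ be an integer, and let $\mathrm{CW}_{\mathrm{depth},\dim}(n)$ be the set of all pairs $(\mathrm{depth}(G),\dim(G))$ where $G$ ranges over the Cameron--Walker graphs on $n$ vertices. If $n<5$ then $|\mathrm{CW}_{\mathrm{depth},\dim}(n)|=0$, and if $n=5$ then $|\mathrm{CW}_{\mathrm{depth},\dim}(n)|=2$. If $n>5$, write $n=6k+i$ with integers $k\ge 1$ and $0\le i\le 5$; then $$|\mathrm{CW}_{\mathrm{depth},\dim}(n)|=\begin{cases}6k^2-6k+2 & i=0\\ 6k^2-4k+3 & i=1\\ 6k^2-2k+1 & i=2\\ 6k^2+2 & i=3\\ 6k^2+2k+1 & i=4\\ 6k^2+4k+3 & i=5.\end{cases}$$
   Context: All graphs are finite and simple. For a graph $G$ with vertices $x_1,\dots,x_n$, let $R=K[x_1,\dots,x_n]$ be the polynomial ring over a field $K$, and let the edge ideal $I(G)\subset R$ be the ideal generated by the monomials $x_ix_j$ with $\{x_i,x_j\}$ an edge of $G$. Put $\mathrm{depth}(G)=\mathrm{depth}(R/I(G))$ and $\dim(G)=\dim(R/I(G))$ (Krull dimension). A matching is a set of pairwise disjoint edges; an induced matching is a matching such that no two of its edges are joined by an edge of $G$. Let $\mathrm{m}(G)$ and $\mathrm{im}(G)$ be the maximum sizes of a matching and of an induced matching of $G$. A star is a complete bipartite graph $K_{1,r}$ with $r\ge 0$ (so the one-vertex graph is a star). A star triangle is a graph consisting of a set of triangles whose pairwise intersections are one single common vertex (a single triangle is a star triangle). A Cameron--Walker graph is a finite connected (nonempty)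 simple graph $G$ with $\mathrm{m}(G)=\mathrm{im}(G)$ that is neither a star nor a star triangle. Equivalently (Cameron--Walker), $G$ consists of a connected bipartite graph with nonempty vertex parts $\{u_1,\dots,u_m\}$ and $\{v_1,\dots,v_p\}$, with at least one leaf edge attached to each $u_i$ and possibly some pendant triangles attached to the $v_j$, where $G$ is not a star or a star triangle. *)

theory Defs
  imports
    "HOL-Library.Poly_Mapping"
    "HOL-Library.Extended_Nat"
    "HOL-Algebra.QuotRing"
    "HOL-Algebra.Module"
begin

section \<open>Finite simple graphs\<close>

definition simple_graph :: "'v set \<Rightarrow> 'v set set \<Rightarrow> bool" where
  "simple_graph V E \<longleftrightarrow> finite V \<and> (\<forall>e\<in>E. e \<subseteq> V \<and> card e = 2)"

definition connected_graph :: "'v set \<Rightarrow> 'v set set \<Rightarrow> bool" where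
  "connected_graph V E \<longleftrightarrow> V \<noteq> {} \<and> (\<forall>u\<in>V. \<forall>v\<in>V. (u, v) \<in> {(a, b). {a, b} \<in> E}\<^sup>*)"

definition matching :: "'v set set \<Rightarrow> 'v set set \<Rightarrow> bool" where
  "matching E M \<longleftrightarrow> M \<subseteq> E \<and> (\<forall>e\<in>M. \<forall>f\<in>M. e \<noteq> f \<longrightarrow> e \<inter> f = {})"

definition induced_matching :: "'v set set \<Rightarrow> 'v set set \<Rightarrow> bool" where
  "induced_matching E M \<longleftrightarrow> matching E M \<and>
     (\<forall>e\<in>M. \<forall>f\<in>M. e \<noteq> f \<longrightarrow> \<not> (\<exists>g\<in>E. g \<inter> e \<noteq> {} \<and> g \<inter> f \<noteq> {}))"

definition matching_number :: "'v set set \<Rightarrow> nat" where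
  "matching_number E = Max {card M | M. matching E M}"

definition induced_matching_number :: "'v set set \<Rightarrow> nat" where
  "induced_matching_number E = Max {card M | M. induced_matching E M}"

definition is_star :: "'v set \<Rightarrow> 'v set set \<Rightarrow> bool" where
  "is_star V E \<longleftrightarrow> (\<exists>c\<in>V. E = {{c, v} | v. v \<in> V - {c}})"

text \<open>\<open>T\<close> is the set of (vertex sets of the) triangles and \<open>c\<close> their common vertex.\<close>

definition is_star_triangle :: "'v set \<Rightarrow> 'v set set \<Rightarrow> bool" where
  "is_star_triangle V E \<longleftrightarrow> (\<exists>c T. T \<noteq> {} \<and> (\<forall>t\<in>T. card t = 3 \<and> c \<in> t) \<and>
     (\<forall>s\<in>T. \<forall>t\<in>T. s \<noteq> t \<longrightarrow> s \<inter> t = {c}) \<and>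
     V = \<Union>T \<and> E = {e. card e = 2 \<and> (\<exists>t\<in>T. e \<subseteq> t)})"

definition cameron_walker :: "'v set \<Rightarrow> 'v set set \<Rightarrow> bool" where
  "cameron_walker V E \<longleftrightarrow> simple_graph V E \<and> connected_graph V E \<and>
     matching_number E = induced_matching_number E \<and>
     \<not> is_star V E \<and> \<not> is_star_triangle V E"


section \<open>Krull dimension and depth\<close>

text \<open>A ring without prime ideals, i.e. the zero ring, gets dimension 0 here.\<close>

definition krull_dim :: "('a, 'm) ring_scheme \<Rightarrow> enat" where
  "krull_dim A = Sup {enat r | r. \<exists>P. (\<forall>i\<le>r. primeideal (P i) A) \<and> (\<forall>i<r. P i \<subset> P (Suc i))}"

text \<open>The submodule \<open>S M\<close> of \<open>M\<close>, generated by the products \<open>a m\<close> with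
  \<open>a \<in> S\<close> and \<open>m \<in> M\<close>.\<close>

definition multiples :: "('a, 'm) ring_scheme \<Rightarrow> ('a, 'b, 'n) module_scheme \<Rightarrow> 'a set \<Rightarrow> 'b set" where
  "multiples R M S =
     \<Inter>{N. submodule N R M \<and> (\<forall>a\<in>S. \<forall>m\<in>carrier M. a \<odot>\<^bsub>M\<^esub> m \<in> N)}"

text \<open>Each element is a nonzerodivisor on the quotient of \<open>M\<close> by the multiples of the
  preceding elements, and the quotient by the multiples of all of them is nonzero.\<close>

definition regular_sequence :: "('a, 'm) ring_scheme \<Rightarrow> ('a, 'b, 'n) module_scheme \<Rightarrow> 'a list \<Rightarrow> bool" where
  "regular_sequence R M xs \<longleftrightarrow> set xs \<subseteq> carrier R \<and>
     (\<forall>i<length xs. \<forall>m\<in>carrier M.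
        xs ! i \<odot>\<^bsub>M\<^esub> m \<in> multiples R M (set (take i xs)) \<longrightarrow>
        m \<in> multiples R M (set (take i xs))) \<and>
     multiples R M (set xs) \<noteq> carrier M"

definition depth :: "('a, 'm) ring_scheme \<Rightarrow> 'a set \<Rightarrow> ('a, 'b, 'n) module_scheme \<Rightarrow> enat" where
  "depth R I M = Sup {enat (length xs) | xs. set xs \<subseteq> I \<and> regular_sequence R M xs}"

definition quotient_module :: "('a, 'm) ring_scheme \<Rightarrow> 'a set \<Rightarrow> ('a, 'a set) module" where
  "quotient_module R I =
     \<lparr>carrier = carrier (R Quot I), mult = mult (R Quot I), one = one (R Quot I),
      zero = zero (R Quot I), add = add (R Quot I),
      smult = (\<lambda>a X. (I +>\<^bsub>R\<^esub> a) \<otimes>\<^bsub>R Quot I\<^esub> X)\<rparr>"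


section \<open>Edge ideals\<close>

text \<open>Finitely supported maps \<open>'v \<Rightarrow>\<^sub>0 nat\<close> are exponent vectors of monomials, so that
  \<open>('v \<Rightarrow>\<^sub>0 nat) \<Rightarrow>\<^sub>0 'k\<close> is the polynomial ring over \<open>'k\<close> with variables indexed by the whole
  type \<open>'v\<close>; the carrier restricts to polynomials in the variables from \<open>V\<close>.\<close>

definition poly_ring :: "'v set \<Rightarrow> (('v \<Rightarrow>\<^sub>0 nat) \<Rightarrow>\<^sub>0 'k::field) ring" where
  "poly_ring V =
     \<lparr>carrier = {p. \<forall>m\<in>Poly_Mapping.keys p. Poly_Mapping.keys m \<subseteq> V},
      mult = (*), one = 1, zero = 0, add = (+)\<rparr>"

definition var :: "'v \<Rightarrow> ('v \<Rightarrow>\<^sub>0 nat) \<Rightarrow>\<^sub>0 'k::field" where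
  "var x = Poly_Mapping.single (Poly_Mapping.single x 1) 1"

definition edge_ideal :: "'v set \<Rightarrow> 'v set set \<Rightarrow> (('v \<Rightarrow>\<^sub>0 nat) \<Rightarrow>\<^sub>0 'k::field) set" where
  "edge_ideal V E = Idl\<^bsub>poly_ring V\<^esub> {var x * var y | x y. {x, y} \<in> E}"

text \<open>The depth of a finitely generated graded module is taken with respect to the
  homogeneous maximal ideal.\<close>

definition irrelevant_ideal :: "'v set \<Rightarrow> (('v \<Rightarrow>\<^sub>0 nat) \<Rightarrow>\<^sub>0 'k::field) set" where
  "irrelevant_ideal V = Idl\<^bsub>poly_ring V\<^esub> (var ` V)"

definition graph_depth :: "'k::field itself \<Rightarrow> 'v set \<Rightarrow> 'v set set \<Rightarrow> enat" where
  "graph_depth K V E =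
     (let R = (poly_ring V :: (('v \<Rightarrow>\<^sub>0 nat) \<Rightarrow>\<^sub>0 'k) ring)
      in depth R (irrelevant_ideal V) (quotient_module R (edge_ideal V E)))"

definition graph_dim :: "'k::field itself \<Rightarrow> 'v set \<Rightarrow> 'v set set \<Rightarrow> enat" where
  "graph_dim K V E =
     krull_dim ((poly_ring V :: (('v \<Rightarrow>\<^sub>0 nat) \<Rightarrow>\<^sub>0 'k) ring) Quot edge_ideal V E)"

text \<open>Every finite graph is isomorphic to one whose vertices are natural numbers.\<close>

definition CW_depth_dim :: "'k::field itself \<Rightarrow> int \<Rightarrow> (enat \<times> enat) set" where
  "CW_depth_dim K n =
     {(graph_depth K V E, graph_dim K V E) | (V :: nat set) E.
        cameron_walker V E \<and> int (card V) = n}"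

end

theory Submission
  imports Defs
begin

text \<open>
  Let \<open>i(G)\<close> and \<open>\<alpha>(G)\<close> be the smallest and largest size of a maximal independent set. A
  Cameron--Walker graph has dimension \<open>\<alpha>(G)\<close> and depth \<open>i(G)\<close>.

  For the upper bounds, more than \<open>|F|\<close> polynomials are algebraically dependent modulo the prime
  generated by the variables outside \<open>F\<close>. Along a strict chain of primes the lowest term of such a
  relation gives \<open>1\<close> in the last prime. For a regular sequence \<open>f\<^sub>1, \<dots>, f\<^sub>l\<close> and a maximal independent
  set \<open>F\<close> with \<open>l > |F|\<close> it gives that the monomial \<open>x\<^sub>F\<close> lies in \<open>I(G) + (f\<^sub>1\<^sup>N, \<dots>, f\<^sub>l\<^sup>N)\<close> for
  every \<open>N\<close>, which is impossible for degree reasons.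

  For the lower bound on the depth, the elementary symmetric polynomials \<open>e\<^sub>1, \<dots>, e\<^sub>d\<close> in all the
  variables are regular on \<open>K[x\<^sub>v : v \<in> F]\<close> whenever \<open>|F| \<ge> d\<close>, over any field, and regularity is
  glued along \<open>0 \<rightarrow> R/(I : x) \<rightarrow> R/I \<rightarrow> R/(I + (x)) \<rightarrow> 0\<close>, where \<open>x\<close> runs through shedding vertices.

  In a Cameron--Walker graph with \<open>s\<close> leaf edges and \<open>t\<close> triangles in a maximum induced matching, \<open>p\<close>
  unmatched vertices and \<open>q\<close> apexes of triangles, one has \<open>n = 2s + 2t + p\<close>,
  \<open>\<alpha>(G) = s + t + p - q\<close> and \<open>s + q \<le> i(G) \<le> s + t\<close>; this confines the pair to an explicit
  region, and every point of it is realized by a graph with \<open>i(G) = s + q\<close>.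
\<close>

section \<open>Weakly regular sequences on quotients of a commutative ring\<close>

text \<open>Gluing along the exact sequence needs one and the same sequence to be regular on both
  ends, and the ends are again quotients attached to induced subgraphs. So the sequence must be
  fixed in advance for all of them. General linear forms would serve over an infinite field, but a
  small finite field may contain too few, whereas \<open>e\<^sub>1, \<dots>, e\<^sub>d\<close> do
  not depend on the field. Regularity is handled in the weak form that allows zero quotients, so
  that neither the exact sequence nor the passage to powers carries a properness condition;
  properness returns at the end from the absence of constant terms.

  What makes the count irregular is depth 2: there s + q = 2 leaves only three families of graphs
  and hence two or three pairs, while every other depth has a full interval of dimensions. The lower
  end of that interval is a rounded half for depths up to (n + 2)/3 and the depth itself afterwards;
  these divisions by 2 and 3 produce the period 6.\<close>

locale comm_subring =
  fixes C :: "'a::comm_ring_1 set"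
  assumes one_mem [simp]: "1 \<in> C"
    and diff_mem [simp]: "\<lbrakk>a \<in> C; b \<in> C\<rbrakk> \<Longrightarrow> a - b \<in> C"
    and mult_mem [simp]: "\<lbrakk>a \<in> C; b \<in> C\<rbrakk> \<Longrightarrow> a * b \<in> C"
begin

lemma zero_mem [simp]: "0 \<in> C"
  using diff_mem[of 1 1] by simp

lemma uminus_mem [simp]: "a \<in> C \<Longrightarrow> - a \<in> C"
  using diff_mem[of 0 a] by simp

lemma add_mem [simp]: "\<lbrakk>a \<in> C; b \<in> C\<rbrakk> \<Longrightarrow> a + b \<in> C"
  using diff_mem[of a "- b"] by simp

lemma power_mem [simp]: "a \<in> C \<Longrightarrow> a ^ n \<in> C"
  by (induction n) auto

lemma sum_mem: "(\<And>i. i \<in> S \<Longrightarrow> f i \<in> C) \<Longrightarrow> sum f S \<in> C"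
  by (induction S rule: infinite_finite_induct) auto

lemma prod_mem: "(\<And>i. i \<in> S \<Longrightarrow> f i \<in> C) \<Longrightarrow> prod f S \<in> C"
  by (induction S rule: infinite_finite_induct) auto

definition idl :: "'a set \<Rightarrow> bool" where
  "idl J \<longleftrightarrow> J \<subseteq> C \<and> 0 \<in> J \<and> (\<forall>a\<in>J. \<forall>b\<in>J. a + b \<in> J) \<and> (\<forall>r\<in>C. \<forall>a\<in>J. r * a \<in> J)"

lemma idlI:
  assumes "J \<subseteq> C" "0 \<in> J" "\<And>a b. \<lbrakk>a \<in> J; b \<in> J\<rbrakk> \<Longrightarrow> a + b \<in> J" "\<And>r a. \<lbrakk>r \<in> C; a \<in> J\<rbrakk> \<Longrightarrow> r * a \<in> J"
  shows "idl J"
  using assms unfolding idl_def by blast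

lemma idl_subset: "idl J \<Longrightarrow> J \<subseteq> C"
  and idl_mem: "\<lbrakk>idl J; a \<in> J\<rbrakk> \<Longrightarrow> a \<in> C"
  and idl_zero: "idl J \<Longrightarrow> 0 \<in> J"
  and idl_add: "\<lbrakk>idl J; a \<in> J; b \<in> J\<rbrakk> \<Longrightarrow> a + b \<in> J"
  and idl_mult: "\<lbrakk>idl J; r \<in> C; a \<in> J\<rbrakk> \<Longrightarrow> r * a \<in> J"
  unfolding idl_def by auto

lemma idl_mult_right: "\<lbrakk>idl J; r \<in> C; a \<in> J\<rbrakk> \<Longrightarrow> a * r \<in> J"
  using idl_mult[of J r a] by (simp add: mult.commute)

lemma idl_uminus: "\<lbrakk>idl J; a \<in> J\<rbrakk> \<Longrightarrow> - a \<in> J"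
  using idl_mult[of J "-1" a] by simp

lemma idl_diff: "\<lbrakk>idl J; a \<in> J; b \<in> J\<rbrakk> \<Longrightarrow> a - b \<in> J"
  using idl_add[of J a "- b"] idl_uminus[of J b] by simp

lemma idl_sum: "\<lbrakk>idl J; \<And>i. i \<in> S \<Longrightarrow> f i \<in> J\<rbrakk> \<Longrightarrow> sum f S \<in> J"
  by (induction S rule: infinite_finite_induct) (auto intro: idl_add idl_zero)

definition nzd :: "'a set \<Rightarrow> 'a \<Rightarrow> bool" where
  "nzd J f \<longleftrightarrow> (\<forall>m\<in>C. f * m \<in> J \<longrightarrow> m \<in> J)"

lemma nzdD: "\<lbrakk>nzd J f; m \<in> C; f * m \<in> J\<rbrakk> \<Longrightarrow> m \<in> J"
  unfolding nzd_def by blast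

lemma nzd_power: "\<lbrakk>nzd J f; f \<in> C; m \<in> C; f ^ n * m \<in> J\<rbrakk> \<Longrightarrow> m \<in> J"
proof (induction n)
  case (Suc n)
  then have "f * (f ^ n * m) \<in> J" by (simp add: mult.assoc)
  then show ?case using Suc nzdD[of J f "f ^ n * m"] by simp
qed simp

lemma nzd_prod:
  assumes "\<And>i. i \<in> S \<Longrightarrow> nzd J (f i) \<and> f i \<in> C"
  shows "nzd J (prod f S)"
  using assms
proof (induction S rule: infinite_finite_induct)
  case (insert i S)
  show ?case unfolding nzd_def
  proof (intro ballI impI)
    fix m assume m: "m \<in> C" "prod f (insert i S) * m \<in> J"
    have "f i * (prod f S * m) \<in> J" using m insert by (simp add: mult.assoc)
    moreover have "prod f S \<in> C" using insert by (intro prod_mem) auto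
    ultimately have "prod f S * m \<in> J" using insert m nzdD[of J "f i"] by simp
    then show "m \<in> J" using insert m nzdD by blast
  qed
qed (auto simp: nzd_def)

lemma nzd_cong:
  assumes "idl J" "f - g \<in> J" "nzd J f"
  shows "nzd J g"
  unfolding nzd_def
proof (intro ballI impI)
  fix m assume m: "m \<in> C" "g * m \<in> J"
  have "f * m = g * m + (f - g) * m" by (simp add: algebra_simps)
  then have "f * m \<in> J" using assms m idl_add idl_mult_right by metis
  then show "m \<in> J" using assms m nzdD by blast
qed

definition adj :: "'a set \<Rightarrow> 'a \<Rightarrow> 'a set" where
  "adj J x = {j + x * r | j r. j \<in> J \<and> r \<in> C}"

definition colon :: "'a set \<Rightarrow> 'a \<Rightarrow> 'a set" where
  "colon J x = {r \<in> C. x * r \<in> J}"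

lemma adjI: "\<lbrakk>j \<in> J; r \<in> C\<rbrakk> \<Longrightarrow> j + x * r \<in> adj J x"
  unfolding adj_def by blast

lemma adjE:
  assumes "a \<in> adj J x" obtains j r where "j \<in> J" "r \<in> C" "a = j + x * r"
  using assms unfolding adj_def by blast

lemma adj_superset: "J \<subseteq> adj J x"
  using adjI[of _ J 0 x] by auto

lemma adj_gen: "idl J \<Longrightarrow> x \<in> adj J x"
  using adjI[of 0 J 1 x] by (auto simp: idl_zero)

lemma idl_adj:
  assumes "idl J" "x \<in> C" shows "idl (adj J x)"
proof (rule idlI)
  show "adj J x \<subseteq> C" using assms by (auto simp: adj_def dest: idl_mem)
  show "0 \<in> adj J x" using adj_superset assms idl_zero by blast
next
  fix a b assume "a \<in> adj J x" "b \<in> adj J x"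
  then obtain j r j' r' where *: "j \<in> J" "r \<in> C" "a = j + x * r" "j' \<in> J" "r' \<in> C" "b = j' + x * r'"
    by (meson adjE)
  have "a + b = (j + j') + x * (r + r')" using * by (simp add: algebra_simps)
  moreover have "j + j' \<in> J" "r + r' \<in> C" using * assms by (auto intro: idl_add)
  ultimately show "a + b \<in> adj J x" using adjI by metis
next
  fix s a assume "s \<in> C" "a \<in> adj J x"
  then obtain j r where *: "j \<in> J" "r \<in> C" "a = j + x * r" by (meson adjE)
  have "s * a = s * j + x * (s * r)" using * by (simp add: algebra_simps)
  then show "s * a \<in> adj J x" using * \<open>s \<in> C\<close> assms adjI[of "s * j" J "s * r" x] by (simp add: idl_mult)
qed

lemma adj_least:
  assumes "idl K" "J \<subseteq> K" "x \<in> K" shows "adj J x \<subseteq> K"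
  using assms by (auto simp: adj_def intro!: idl_add idl_mult_right)

lemma adj_commute: "adj (adj J x) y = adj (adj J y) x"
proof -
  have "adj (adj J x) y \<subseteq> adj (adj J y) x" for x y
  proof
    fix a assume "a \<in> adj (adj J x) y"
    then obtain b s where b: "b \<in> adj J x" "s \<in> C" "a = b + y * s" by (meson adjE)
    then obtain j r where "j \<in> J" "r \<in> C" "b = j + x * r" by (meson adjE)
    with b have "a = (j + y * s) + x * r" "j + y * s \<in> adj J y" "r \<in> C" by (auto intro: adjI)
    then show "a \<in> adj (adj J y) x" using adjI by blast
  qed
  then show ?thesis by blast
qed

text \<open>Weak regularity: the quotients may vanish, as they do for \<open>adj J (f ^ 0)\<close>
  in \<open>wreg_adj_power\<close>.\<close>

fun wreg :: "'a set \<Rightarrow> 'a list \<Rightarrow> bool" where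
  "wreg J [] \<longleftrightarrow> True"
| "wreg J (f # fs) \<longleftrightarrow> nzd J f \<and> wreg (adj J f) fs"

lemma wreg_append: "wreg J (xs @ ys) \<longleftrightarrow> wreg J xs \<and> wreg (foldl adj J xs) ys"
  by (induction xs arbitrary: J) auto

lemma idl_foldl: "\<lbrakk>idl J; set fs \<subseteq> C\<rbrakk> \<Longrightarrow> idl (foldl adj J fs)"
  by (induction fs arbitrary: J) (auto intro: idl_adj)

lemma foldl_adj_superset: "J \<subseteq> foldl adj J fs"
  by (induction fs arbitrary: J) (use adj_superset in force)+

lemma foldl_adj_gen: "\<lbrakk>idl J; set fs \<subseteq> C\<rbrakk> \<Longrightarrow> set fs \<subseteq> foldl adj J fs"
proof (induction fs arbitrary: J)
  case (Cons f fs)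
  have "f \<in> foldl adj (adj J f) fs"
    using Cons.prems adj_gen foldl_adj_superset by blast
  then show ?case using Cons idl_adj by auto
qed simp

lemma foldl_adj_least: "\<lbrakk>idl K; J \<subseteq> K; set fs \<subseteq> K\<rbrakk> \<Longrightarrow> foldl adj J fs \<subseteq> K"
proof (induction fs arbitrary: J)
  case (Cons f fs) then show ?case using adj_least by simp
qed simp

lemma wreg_iff_nth:
  "wreg J fs \<longleftrightarrow> (\<forall>i<length fs. nzd (foldl adj J (take i fs)) (fs ! i))"
proof (induction fs arbitrary: J)
  case (Cons f fs)
  show ?case
    using All_less_Suc2[of "length fs" "\<lambda>i. nzd (foldl adj J (take i (f # fs))) ((f # fs) ! i)"]
    by (simp add: Cons.IH)
qed simp

text \<open>A diagram chase on the exact sequence. The second conclusion says that the sequence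
  stays exact modulo \<open>f\<close>, so that \<open>wreg_exact\<close> can repeat the argument for
  the next element.\<close>

lemma nzd_exact:
  assumes J: "idl J" and x: "x \<in> C" and f: "f \<in> C"
    and 1: "nzd (colon J x) f" and 2: "nzd (adj J x) f"
  shows "nzd J f" and "colon (adj J f) x = adj (colon J x) f"
proof -
  show "nzd J f" unfolding nzd_def
  proof (intro ballI impI)
    fix m assume m: "m \<in> C" "f * m \<in> J"
    then have "m \<in> adj J x" using 2 adj_superset nzdD by blast
    then obtain j r where jr: "j \<in> J" "r \<in> C" "m = j + x * r" by (meson adjE)
    have "x * (f * r) = f * m - f * j" by (simp add: jr algebra_simps)
    then have "f * r \<in> colon J x" using jr m f J by (simp add: colon_def idl_diff idl_mult)
    then have "r \<in> colon J x" using 1 jr nzdD by blast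
    then show "m \<in> J" using jr J by (simp add: colon_def idl_add)
  qed
  show "colon (adj J f) x = adj (colon J x) f"
  proof
    show "adj (colon J x) f \<subseteq> colon (adj J f) x"
    proof
      fix a assume "a \<in> adj (colon J x) f"
      then obtain j r where jr: "j \<in> colon J x" "r \<in> C" "a = j + f * r" by (meson adjE)
      have "x * a = x * j + f * (x * r)" by (simp add: jr algebra_simps)
      then have "x * a \<in> adj J f" using jr x adjI[of "x * j" J "x * r" f] by (simp add: colon_def)
      then show "a \<in> colon (adj J f) x" using jr f by (simp add: colon_def)
    qed
    show "colon (adj J f) x \<subseteq> adj (colon J x) f"
    proof
      fix r assume "r \<in> colon (adj J f) x"
      then have r: "r \<in> C" "x * r \<in> adj J f" by (auto simp: colon_def)
      then obtain j s where js: "j \<in> J" "s \<in> C" "x * r = j + f * s" by (meson adjE)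
      have "f * s = - j + x * r" by (simp add: js)
      then have "f * s \<in> adj J x" using js r J adjI[of "- j" J r x] by (simp add: idl_uminus)
      then have "s \<in> adj J x" using 2 js nzdD by blast
      then obtain j' s' where js': "j' \<in> J" "s' \<in> C" "s = j' + x * s'" by (meson adjE)
      have "x * (r - f * s') = j + f * j'" using js(3) js'(3) by (simp add: algebra_simps)
      then have "r - f * s' \<in> colon J x" using js js' r f J by (simp add: colon_def idl_add idl_mult)
      then show "r \<in> adj (colon J x) f" using adjI[of "r - f * s'" _ s' f] js' by simp
    qed
  qed
qed

text \<open>A sequence regular on both ends of
  \<open>0 \<rightarrow> C/(J : x) \<rightarrow> C/J \<rightarrow> C/(J + xC) \<rightarrow> 0\<close> is regular on the middle term.\<close>

lemma wreg_exact:
  assumes "idl J" "x \<in> C" "set fs \<subseteq> C" "wreg (colon J x) fs" "wreg (adj J x) fs"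
  shows "wreg J fs"
  using assms
proof (induction fs arbitrary: J)
  case (Cons f fs)
  then have f: "f \<in> C" "nzd (colon J x) f" "nzd (adj J x) f" by auto
  note * = nzd_exact[OF Cons.prems(1,2) f]
  have "wreg (adj J f) fs"
  proof (rule Cons.IH)
    show "idl (adj J f)" "x \<in> C" "set fs \<subseteq> C" using Cons.prems f(1) idl_adj by auto
    show "wreg (colon (adj J f) x) fs" using Cons.prems(4) unfolding *(2) by simp
    show "wreg (adj (adj J f) x) fs" using Cons.prems(5) unfolding adj_commute[of J f x] by simp
  qed
  then show ?case using *(1) by simp
qed simp

lemma adj_one: "idl J \<Longrightarrow> adj J 1 = C"
  using adjI[of 0 J _ 1] idl_zero by (auto simp: adj_def dest: idl_mem)

lemma wreg_top: "idl J \<Longrightarrow> set fs \<subseteq> C \<Longrightarrow> J = C \<Longrightarrow> wreg J fs"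
proof (induction fs arbitrary: J)
  case (Cons f fs)
  have "adj J f = C" using Cons.prems adj_superset idl_subset[OF idl_adj[of J f]] by auto
  then show ?case using Cons by (auto simp: nzd_def)
qed simp

text \<open>For the ideal \<open>adj J (f ^ Suc s)\<close> the colon by \<open>f\<close> is
  \<open>adj J (f ^ s)\<close>, and adjoining \<open>f\<close> gives \<open>adj J f\<close>. So
  \<open>wreg_exact\<close> with \<open>x = f\<close> climbs from \<open>s\<close> to
  \<open>Suc s\<close>, starting from the zero quotient at \<open>s = 0\<close>.\<close>

lemma wreg_adj_power:
  assumes "idl J" "f \<in> C" "set fs \<subseteq> C" "nzd J f" "wreg (adj J f) fs"
  shows "wreg (adj J (f ^ s)) fs"
proof (induction s)
  case 0
  show ?case using wreg_top[OF idl_adj[of J 1]] assms by (simp add: adj_one)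
next
  case (Suc s)
  have "colon (adj J (f ^ Suc s)) f = adj J (f ^ s)"
  proof
    show "adj J (f ^ s) \<subseteq> colon (adj J (f ^ Suc s)) f"
    proof
      fix a assume "a \<in> adj J (f ^ s)"
      then obtain j r where "j \<in> J" "r \<in> C" "a = j + f ^ s * r" by (meson adjE)
      then show "a \<in> colon (adj J (f ^ Suc s)) f"
        using adjI[of "f * j" J r "f ^ Suc s"] assms idl_mem[of J j] idl_mult[of J f j]
        by (simp add: colon_def distrib_left mult.assoc[symmetric])
    qed
    show "colon (adj J (f ^ Suc s)) f \<subseteq> adj J (f ^ s)"
    proof
      fix a assume "a \<in> colon (adj J (f ^ Suc s)) f"
      then obtain j r where *: "a \<in> C" "j \<in> J" "r \<in> C" "f * a = j + f ^ Suc s * r"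
        by (auto simp: colon_def elim: adjE)
      have "f * (a - f ^ s * r) = j" using * by (simp add: algebra_simps)
      then have "a - f ^ s * r \<in> J" using * assms nzdD[of J f "a - f ^ s * r"] by simp
      then show "a \<in> adj J (f ^ s)" using * adjI[of "a - f ^ s * r" J r "f ^ s"] by simp
    qed
  qed
  moreover have "adj (adj J (f ^ Suc s)) f = adj J f"
  proof
    have "f * f ^ s \<in> adj J f"
      using assms idl_adj adj_gen idl_mult_right by simp
    then show "adj (adj J (f ^ Suc s)) f \<subseteq> adj J f"
      using assms idl_adj adj_gen adj_superset by (intro adj_least) auto
    show "adj J f \<subseteq> adj (adj J (f ^ Suc s)) f"
      using adj_superset[of J "f ^ Suc s"] unfolding adj_def[of _ f] by blast
  qed
  ultimately show ?case
    using wreg_exact[of "adj J (f ^ Suc s)" f fs] assms Suc idl_adj power_mem by metis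
qed

text \<open>Powers push a sequence without constant terms into high degree, which is how
  \<open>regular_sequence_length\<close> reaches its contradiction.\<close>

lemma wreg_map_power:
  assumes "idl J" "set fs \<subseteq> C" "wreg J fs"
  shows "wreg J (map (\<lambda>f. f ^ s) fs)"
  using assms
proof (induction fs arbitrary: J)
  case (Cons f fs)
  have "nzd J (f ^ s)" using Cons.prems nzd_power unfolding nzd_def[of J "f ^ s"] by auto
  moreover have "wreg (adj J (f ^ s)) fs" using Cons.prems by (intro wreg_adj_power) auto
  then have "wreg (adj J (f ^ s)) (map (\<lambda>f. f ^ s) fs)"
    using Cons.prems by (intro Cons.IH) (auto intro: idl_adj)
  ultimately show ?case by simp
qed simp

section \<open>Chains of ideals and algebraic dependence\<close>

text \<open>Common form of the two chains whose length is bounded: for a strict chain of primes,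
  \<open>f\<close> is an element that is new in the next prime; for a weakly regular sequence, the
  next ideal is \<open>adj J f\<close>.\<close>

inductive nzd_chain :: "'a set \<Rightarrow> 'a list \<Rightarrow> 'a set \<Rightarrow> bool" where
  nzd_chain_Nil: "nzd_chain J [] J"
| nzd_chain_Cons: "\<lbrakk>idl J; f \<in> C; nzd J f; J \<subseteq> J'; f \<in> J'; nzd_chain J' fs L\<rbrakk> \<Longrightarrow> nzd_chain J (f # fs) L"

definition mon :: "'a list \<Rightarrow> nat list \<Rightarrow> 'a" where
  "mon fs e = prod_list (map2 (^) fs e)"

lemma mon_simps [simp]: "mon [] e = 1" "mon (f # fs) (n # e) = f ^ n * mon fs e"
  by (auto simp: mon_def)

lemma mon_mem: "set fs \<subseteq> C \<Longrightarrow> mon fs e \<in> C"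
proof (induction fs arbitrary: e)
  case (Cons f fs) then show ?case by (cases e) (auto simp: mon_def)
qed (simp add: mon_def)

lemma nzd_chain_mem: "nzd_chain J fs L \<Longrightarrow> set fs \<subseteq> C"
  by (induction rule: nzd_chain.induct) auto

text \<open>The lexicographically lowest term of a polynomial relation among \<open>fs\<close> is stripped of its
  powers of \<open>f\<close>, after which the multiples of \<open>f\<close> are absorbed into the next ideal.\<close>

lemma nzd_chain_relation:
  assumes "nzd_chain J fs L" "idl J" "z \<in> C" "finite E" "E \<noteq> {}"
    and "\<And>e. e \<in> E \<Longrightarrow> length e = length fs"
    and "\<And>e. e \<in> E \<Longrightarrow> c e \<in> C \<and> (\<exists>d\<in>C. d * c e = 1)"
    and "z * (\<Sum>e\<in>E. c e * mon fs e) \<in> J"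
    and "idl L"
  shows "z \<in> L"
  using assms
proof (induction arbitrary: E c rule: nzd_chain.induct)
  case (nzd_chain_Nil J)
  then have "E = {[]}" by fastforce
  with nzd_chain_Nil obtain d where d: "d \<in> C" "d * c [] = 1" by auto
  have "z * c [] \<in> J" using nzd_chain_Nil \<open>E = {[]}\<close> by simp
  then have "d * (z * c []) \<in> J" using d nzd_chain_Nil idl_mult by blast
  moreover have "d * (z * c []) = z" using d(2) by (metis mult.left_commute mult.right_neutral)
  ultimately show ?case by simp
next
  case (nzd_chain_Cons J f J' fs L)
  note fsC = nzd_chain_mem[OF nzd_chain_Cons.hyps(6)]
  have ne: "hd e # tl e = e" if "e \<in> E" for e
    using nzd_chain_Cons.prems(5)[OF that] by (cases e) auto
  \<comment> \<open>The lexicographically lowest exponent starts with \<open>m\<close>;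
    \<open>A\<close> collects the terms with exactly this power of \<open>f\<close>,
    \<open>B\<close> those with a higher one.\<close>
  define m where "m = Min (hd ` E)"
  have m: "\<And>e. e \<in> E \<Longrightarrow> m \<le> hd e" "m \<in> hd ` E"
    using nzd_chain_Cons.prems unfolding m_def by auto
  define A where "A = {e \<in> E. hd e = m}"
  define B where "B = {e \<in> E. hd e \<noteq> m}"
  have E: "E = A \<union> B" "A \<inter> B = {}" "finite A" "finite B" "A \<noteq> {}"
    using nzd_chain_Cons.prems m unfolding A_def B_def by auto
  have Atl: "m # e \<in> E" if "e \<in> tl ` A" for e
    using that ne unfolding A_def by auto
  define c' where "c' e = c (m # e)" for e
  define E' where "E' = tl ` A"
  have injtl: "inj_on tl A"
    using ne unfolding inj_on_def A_def by (metis (mono_tags, lifting) mem_Collect_eq)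
  define P where "P = (\<Sum>e\<in>E'. c' e * mon fs e)"
  define Q where "Q = (\<Sum>e\<in>B. c e * (f ^ (hd e - Suc m) * mon fs (tl e)))"
  have PC: "P \<in> C" unfolding P_def E'_def c'_def
  proof (intro sum_mem mult_mem mon_mem fsC)
    fix e assume "e \<in> tl ` A"
    then show "c (m # e) \<in> C" using Atl nzd_chain_Cons.prems by blast
  qed
  have QC: "Q \<in> C" unfolding Q_def
    using nzd_chain_Cons.prems(6) \<open>f \<in> C\<close> B_def fsC by (intro sum_mem mult_mem mon_mem power_mem) auto
  have sA: "(\<Sum>e\<in>A. c e * mon (f # fs) e) = f ^ m * P"
  proof -
    have "(\<Sum>e\<in>A. c e * mon (f # fs) e) = (\<Sum>e\<in>A. f ^ m * (c' (tl e) * mon fs (tl e)))"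
    proof (rule sum.cong)
      fix e assume "e \<in> A"
      then have "e = m # tl e" using ne unfolding A_def by auto
      then show "c e * mon (f # fs) e = f ^ m * (c' (tl e) * mon fs (tl e))"
        unfolding c'_def by (metis mon_simps(2) mult.left_commute)
    qed simp
    also have "\<dots> = f ^ m * P"
      unfolding P_def E'_def sum_distrib_left sum.reindex[OF injtl] by simp
    finally show ?thesis .
  qed
  have sB: "(\<Sum>e\<in>B. c e * mon (f # fs) e) = f ^ m * (f * Q)"
    unfolding Q_def sum_distrib_left
  proof (rule sum.cong)
    fix e assume "e \<in> B"
    then have "hd e # tl e = e" "m < hd e" using ne[of e] m(1)[of e] unfolding B_def by auto
    moreover from this(2) have "f ^ hd e = f ^ (m + Suc (hd e - Suc m))" by simp
    then have "f ^ hd e = f ^ m * (f * f ^ (hd e - Suc m))"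
      by (simp only: power_add power_Suc)
    moreover have "mon (f # fs) e = f ^ hd e * mon fs (tl e)"
      using mon_simps(2)[of f fs "hd e" "tl e"] calculation(1) by simp
    ultimately show "c e * mon (f # fs) e = f ^ m * (f * (c e * (f ^ (hd e - Suc m) * mon fs (tl e))))"
      by (simp only: ac_simps)
  qed simp
  \<comment> \<open>The factor \<open>f ^ m\<close> is cancelled modulo \<open>J\<close>. As
    \<open>f * Q\<close> lies in \<open>J'\<close>, what remains is the shorter relation
    \<open>P\<close> among the later elements.\<close>
  have "f ^ m * (z * (P + f * Q)) = z * (\<Sum>e\<in>E. c e * mon (f # fs) e)"
    unfolding E(1) sum.union_disjoint[OF E(3,4,2)] sA sB by (simp add: algebra_simps)
  then have "f ^ m * (z * (P + f * Q)) \<in> J" using nzd_chain_Cons.prems(7) by simp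
  then have "z * (P + f * Q) \<in> J"
    using nzd_power[OF \<open>nzd J f\<close> \<open>f \<in> C\<close>] PC QC \<open>z \<in> C\<close> \<open>f \<in> C\<close> by simp
  then have zPQ: "z * (P + f * Q) \<in> J'" using \<open>J \<subseteq> J'\<close> by blast
  have idlJ': "idl J'" using \<open>nzd_chain J' fs L\<close> \<open>idl L\<close> by cases auto
  have "z * P = z * (P + f * Q) - (z * Q) * f" by (simp add: algebra_simps)
  then have zP: "z * P \<in> J'"
    using zPQ idlJ' \<open>f \<in> J'\<close> \<open>z \<in> C\<close> QC by (simp add: idl_diff idl_mult)
  show ?case
  proof (rule nzd_chain_Cons.IH[of E' c'])
    show "idl J'" "z \<in> C" "idl L" by fact+
    show "finite E'" "E' \<noteq> {}" using E unfolding E'_def by auto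
    show "z * (\<Sum>e\<in>E'. c' e * mon fs e) \<in> J'" using zP unfolding P_def .
  next
    fix e assume "e \<in> E'"
    then have "m # e \<in> E" using Atl unfolding E'_def by simp
    then show "length e = length fs" "c' e \<in> C \<and> (\<exists>d\<in>C. d * c' e = 1)"
      using nzd_chain_Cons.prems unfolding c'_def by force+
  qed
qed

lemma wreg_nzd_chain:
  "\<lbrakk>wreg J fs; idl J; set fs \<subseteq> C\<rbrakk> \<Longrightarrow> nzd_chain J fs (foldl adj J fs)"
proof (induction fs arbitrary: J)
  case (Cons f fs)
  then show ?case
    using adj_superset adj_gen idl_adj by (auto intro!: nzd_chain_Cons[of J f "adj J f"])
qed (simp add: nzd_chain_Nil)

end

section \<open>Monomials\<close>

abbreviation (input) keys :: "('a \<Rightarrow>\<^sub>0 'b::zero) \<Rightarrow> 'a set" where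
  "keys \<equiv> Poly_Mapping.keys"

abbreviation (input) lookup :: "('a \<Rightarrow>\<^sub>0 'b::zero) \<Rightarrow> 'a \<Rightarrow> 'b" where
  "lookup \<equiv> Poly_Mapping.lookup"

abbreviation (input) single :: "'a \<Rightarrow> 'b \<Rightarrow> 'a \<Rightarrow>\<^sub>0 'b::zero" where
  "single \<equiv> Poly_Mapping.single"

lemma poly_mapping_sum_monomials:
  fixes p :: "'m \<Rightarrow>\<^sub>0 'k::comm_monoid_add"
  shows "(\<Sum>m\<in>keys p. single m (lookup p m)) = p"
proof (rule poly_mapping_eqI)
  fix k
  show "lookup (\<Sum>m\<in>keys p. single m (lookup p m)) k
      = lookup p k"
    by (auto simp: lookup_sum lookup_single when_def not_in_keys_iff_lookup_eq_zero)
qed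

lemma keys_add_nat: "keys (a + b :: 'v \<Rightarrow>\<^sub>0 nat) = keys a \<union> keys b"
  by (auto simp: in_keys_iff lookup_add)

lemma keys_minus: "keys (a - b :: 'm \<Rightarrow>\<^sub>0 'k::ab_group_add) \<subseteq> keys a \<union> keys b"
  by (auto simp: in_keys_iff lookup_minus)

lemma lookup_single_mult:
  fixes p :: "('m::cancel_comm_monoid_add) \<Rightarrow>\<^sub>0 'k::comm_semiring_1"
  shows "lookup (single k c * p) (k + m) = c * lookup p m"
proof -
  have "single k c * p
      = (\<Sum>n\<in>keys p. single (k + n) (c * lookup p n))"
    by (subst (1) poly_mapping_sum_monomials[of p, symmetric]) (simp add: sum_distrib_left mult_single)
  then show ?thesis
    by (auto simp: lookup_sum lookup_single when_def not_in_keys_iff_lookup_eq_zero)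
qed

lemma keys_single_mult:
  fixes p :: "('m::cancel_comm_monoid_add) \<Rightarrow>\<^sub>0 'k::comm_semiring_1"
  shows "keys (single k 1 * p) = (+) k ` keys p"
proof
  show "keys (single k 1 * p) \<subseteq> (+) k ` keys p"
    using keys_mult[of "single k (1::'k)" p] by auto
  show "(+) k ` keys p \<subseteq> keys (single k 1 * p)"
    using lookup_single_mult[of k "1::'k" p] by (auto simp: in_keys_iff)
qed

definition pick :: "('m \<Rightarrow> bool) \<Rightarrow> ('m \<Rightarrow>\<^sub>0 'k::zero) \<Rightarrow> 'm \<Rightarrow>\<^sub>0 'k" where
  "pick P p = Abs_poly_mapping (\<lambda>m. if P m then lookup p m else 0)"

lemma lookup_pick: "lookup (pick P p) m = (if P m then lookup p m else 0)"
proof -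
  have "finite {m. (if P m then lookup p m else 0) \<noteq> 0}"
    by (rule finite_subset[of _ "keys p"]) (auto simp: in_keys_iff)
  then show ?thesis by (simp add: pick_def)
qed

lemma keys_pick: "keys (pick P p) = {m \<in> keys p. P m}"
  by (auto simp: in_keys_iff lookup_pick split: if_splits)

lemma pick_add: "pick P (p + q) = pick P p + pick P (q :: 'm \<Rightarrow>\<^sub>0 'k::monoid_add)"
  by (rule poly_mapping_eqI) (simp add: lookup_pick lookup_add)

lemma pick_split: "pick P p + pick (\<lambda>m. \<not> P m) p = (p :: 'm \<Rightarrow>\<^sub>0 'k::monoid_add)"
  by (rule poly_mapping_eqI) (simp add: lookup_pick lookup_add)

lemma pick_all: "(\<And>m. m \<in> keys p \<Longrightarrow> P m) \<Longrightarrow> pick P p = p"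
  by (rule poly_mapping_eqI) (auto simp: lookup_pick in_keys_iff)

lemma pick_none: "(\<And>m. m \<in> keys p \<Longrightarrow> \<not> P m) \<Longrightarrow> pick P p = 0"
  by (rule poly_mapping_eqI) (auto simp: lookup_pick in_keys_iff)

definition ind :: "'v set \<Rightarrow> 'v \<Rightarrow>\<^sub>0 nat" where
  "ind S = (\<Sum>v\<in>S. single v 1)"

lemma lookup_ind: "finite S \<Longrightarrow> lookup (ind S) v = (if v \<in> S then 1 else 0)"
  by (simp add: ind_def lookup_sum lookup_single when_def)

lemma keys_ind: "finite S \<Longrightarrow> keys (ind S) = S"
  by (auto simp: in_keys_iff lookup_ind split: if_splits)

lemma single_ind: "finite S \<Longrightarrow> single (ind S) (1::'k::field) = (\<Prod>v\<in>S. var v)"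
proof (induction S rule: finite_induct)
  case (insert v S)
  then have "ind (insert v S) = single v 1 + ind S" by (simp add: ind_def)
  then have "single (ind (insert v S)) (1::'k) = var v * single (ind S) 1"
    by (simp add: var_def mult_single)
  with insert show ?case by simp
qed (simp add: ind_def)

section \<open>Squarefree monomial ideals\<close>

locale mpolys =
  fixes V :: "'v::linorder set" and K :: "'k::field itself"
  assumes finite_V: "finite V"
begin

abbreviation C :: "(('v \<Rightarrow>\<^sub>0 nat) \<Rightarrow>\<^sub>0 'k) set" where
  "C \<equiv> carrier (poly_ring V)"

lemma C_iff: "p \<in> C \<longleftrightarrow> (\<forall>m\<in>keys p. keys m \<subseteq> V)"
  by (simp add: poly_ring_def)

sublocale comm_subring C
proof
  show "1 \<in> C" by (simp add: C_iff)
next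
  fix a b assume "a \<in> C" "b \<in> C"
  then show "a - b \<in> C"
    unfolding C_iff using keys_minus[of a b] by blast
  show "a * b \<in> C"
    using \<open>a \<in> C\<close> \<open>b \<in> C\<close> keys_mult[of a b] by (fastforce simp: C_iff keys_add_nat)
qed

lemma single_mem: "keys m \<subseteq> V \<Longrightarrow> single m c \<in> C"
  by (simp add: C_iff)

lemma var_mem: "v \<in> V \<Longrightarrow> var v \<in> C"
  by (simp add: C_iff var_def)

lemma pick_mem: "p \<in> C \<Longrightarrow> pick P p \<in> C"
  by (simp add: C_iff keys_pick)

lemma idl_monomials:
  assumes "idl J" "\<And>m. m \<in> keys p \<Longrightarrow> single m (lookup p m) \<in> J"
  shows "p \<in> J"
  using idl_sum[of J "keys p" "\<lambda>m. single m (lookup p m)"] assms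
  by (simp add: poly_mapping_sum_monomials)

definition down_closed :: "'v set set \<Rightarrow> bool" where
  "down_closed \<Delta> \<longleftrightarrow> (\<forall>S\<in>\<Delta>. \<forall>T. T \<subseteq> S \<longrightarrow> T \<in> \<Delta>)"

text \<open>The Stanley--Reisner ideal of a simplicial complex \<open>\<Delta>\<close>.\<close>

definition sr :: "'v set set \<Rightarrow> (('v \<Rightarrow>\<^sub>0 nat) \<Rightarrow>\<^sub>0 'k) set" where
  "sr \<Delta> = {p \<in> C. \<forall>m\<in>keys p. keys m \<notin> \<Delta>}"

lemma idl_sr: "down_closed \<Delta> \<Longrightarrow> idl (sr \<Delta>)"
proof (rule idlI)
  fix a b assume "a \<in> sr \<Delta>" "b \<in> sr \<Delta>"
  then show "a + b \<in> sr \<Delta>" using keys_add[of a b] by (auto simp: sr_def)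
next
  fix r a assume d: "down_closed \<Delta>" and r: "r \<in> C" and a: "a \<in> sr \<Delta>"
  show "r * a \<in> sr \<Delta>"
    unfolding sr_def
  proof (intro CollectI conjI ballI)
    show "r * a \<in> C" using a r by (simp add: sr_def)
    fix m assume "m \<in> keys (r * a)"
    then obtain m1 m2 where "m = m1 + m2" "m2 \<in> keys a" using keys_mult[of r a] by blast
    then show "keys m \<notin> \<Delta>"
      using a d unfolding sr_def down_closed_def by (metis (no_types, lifting) Un_upper2 keys_add_nat mem_Collect_eq)
  qed
qed (auto simp: sr_def)

text \<open>Membership in \<open>sr\<close> depends on supports only, and multiplication by
  \<open>var v\<close> inserts \<open>v\<close> into each support. The complex on the right is the
  closed star of \<open>v\<close>.\<close>

lemma var_mult_mem_sr:
  assumes "v \<in> V"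
  shows "colon (sr \<Delta>) (var v) = sr {S. S \<subseteq> V \<and> insert v S \<in> \<Delta>}"
proof -
  have "var v * r \<in> sr \<Delta> \<longleftrightarrow> (\<forall>m\<in>keys r. insert v (keys m) \<notin> \<Delta>)"
    if "r \<in> C" for r
    using that assms var_mem[of v] mult_mem[of "var v" r]
    by (simp add: sr_def var_def keys_single_mult keys_add_nat)
  moreover have "r \<in> sr {S. S \<subseteq> V \<and> insert v S \<in> \<Delta>} \<longleftrightarrow>
      (\<forall>m\<in>keys r. insert v (keys m) \<notin> \<Delta>)" if "r \<in> C" for r
    using that by (auto simp: sr_def C_iff)
  ultimately show ?thesis unfolding colon_def by (auto simp: sr_def)
qed

lemma split_var:
  assumes "v \<in> keys m"
  shows "single m c = var v * single (m - single v 1) c"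
proof -
  have "m = single v 1 + (m - single v 1)"
    using assms by (intro poly_mapping_eqI) (auto simp: lookup_add lookup_minus lookup_single when_def in_keys_iff)
  then show ?thesis by (simp add: var_def mult_single)
qed

lemma keys_minus_nat: "keys (a - b :: 'v \<Rightarrow>\<^sub>0 nat) \<subseteq> keys a"
  by (auto simp: in_keys_iff lookup_minus)

text \<open>The complex on the right is the deletion of \<open>v\<close>. Monomials containing
  \<open>v\<close> are multiples of \<open>var v\<close>; on the others both complexes impose the
  same condition.\<close>

lemma adj_sr:
  assumes "down_closed \<Delta>" "v \<in> V"
  shows "adj (sr \<Delta>) (var v) = sr {S \<in> \<Delta>. v \<notin> S}"
proof
  have d: "down_closed {S \<in> \<Delta>. v \<notin> S}" using assms by (auto simp: down_closed_def)
  show "adj (sr \<Delta>) (var v) \<subseteq> sr {S \<in> \<Delta>. v \<notin> S}"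
    using assms by (intro adj_least idl_sr d) (auto simp: sr_def C_iff var_def)
  show "sr {S \<in> \<Delta>. v \<notin> S} \<subseteq> adj (sr \<Delta>) (var v)"
  proof
    fix p assume p: "p \<in> sr {S \<in> \<Delta>. v \<notin> S}"
    have idl: "idl (adj (sr \<Delta>) (var v))" using assms by (intro idl_adj idl_sr var_mem)
    show "p \<in> adj (sr \<Delta>) (var v)"
    proof (rule idl_monomials[OF idl])
      fix m assume m: "m \<in> keys p"
      then have mV: "keys m \<subseteq> V" using p by (auto simp: sr_def C_iff)
      show "single m (lookup p m) \<in> adj (sr \<Delta>) (var v)"
      proof (cases "v \<in> keys m")
        case True
        have "single (m - single v 1) (lookup p m) \<in> C"
          using mV keys_minus_nat by (intro single_mem) blast
        then show ?thesis
          unfolding split_var[OF True] using assms by (intro idl_mult_right[OF idl] adj_gen idl_sr)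
      next
        case False
        then have "single m (lookup p m) \<in> sr \<Delta>"
          using p m mV by (auto simp: sr_def single_mem)
        then show ?thesis using adj_superset by blast
      qed
    qed
  qed
qed

lemma down_closed_Pow [simp]: "down_closed (Pow F)"
  by (auto simp: down_closed_def)

lemma adj_sr_Pow: "v \<in> V \<Longrightarrow> adj (sr (Pow F)) (var v) = sr (Pow (F - {v}))"
proof -
  assume "v \<in> V"
  moreover have "{S \<in> Pow F. v \<notin> S} = Pow (F - {v})" by auto
  ultimately show ?thesis using adj_sr[of "Pow F" v] by simp
qed

lemma nzd_var_sr_Pow:
  assumes "v \<in> F" "F \<subseteq> V"
  shows "nzd (sr (Pow F)) (var v)"
proof -
  have "colon (sr (Pow F)) (var v) = sr (Pow F)"
  proof -
    have "{S. S \<subseteq> V \<and> insert v S \<in> Pow F} = Pow F" using assms by auto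
    then show ?thesis using assms var_mult_mem_sr[of v "Pow F"] by auto
  qed
  then show ?thesis by (auto simp: nzd_def colon_def)
qed

text \<open>\<open>sr (Pow F)\<close> is the ideal of the variables outside \<open>F\<close>.
  Discarding its terms from \<open>f\<close> and \<open>g\<close> leaves polynomials in the
  variables of \<open>F\<close>, whose product lies in \<open>sr (Pow F)\<close> only if it is
  zero.\<close>

lemma sr_Pow_prime:
  assumes "f \<in> C" "g \<in> C" "f * g \<in> sr (Pow F)"
  shows "f \<in> sr (Pow F) \<or> g \<in> sr (Pow F)"
proof -
  let ?in = "\<lambda>m. keys m \<subseteq> F"
  define f1 f2 g1 g2 where "f1 = pick ?in f" "f2 = pick (\<lambda>m. \<not> ?in m) f"
    "g1 = pick ?in g" "g2 = pick (\<lambda>m. \<not> ?in m) g"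
  note defs = this
  have split: "f = f1 + f2" "g = g1 + g2" unfolding defs by (simp_all add: pick_split)
  have C: "f1 \<in> C" "f2 \<in> C" "g1 \<in> C" "g2 \<in> C" using assms unfolding defs by (simp_all add: pick_mem)
  have sr: "f2 \<in> sr (Pow F)" "g2 \<in> sr (Pow F)" using C unfolding defs by (auto simp: sr_def keys_pick)
  have idl: "idl (sr (Pow F))" by (simp add: idl_sr)
  have "f1 * g1 = f * g - (f2 * g + f1 * g2)" by (simp add: split algebra_simps)
  also have "\<dots> \<in> sr (Pow F)"
    using assms C sr idl by (intro idl_diff idl_add idl_mult_right[of _ g f2] idl_mult[of _ f1 g2])
  finally have "f1 * g1 \<in> sr (Pow F)" .
  moreover have "\<forall>m\<in>keys (f1 * g1). ?in m"
    using keys_mult[of f1 g1] unfolding defs by (fastforce simp: keys_pick keys_add_nat)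
  ultimately have "keys (f1 * g1) = {}" by (auto simp: sr_def)
  then have "f1 * g1 = 0" by (metis poly_mapping_sum_monomials sum.empty)
  \<comment> \<open>The linear order on the variables orders the exponent vectors, and this excludes
    zero divisors among the polynomials.\<close>
  then have "f1 = 0 \<or> g1 = 0" by simp
  then show ?thesis using split sr by auto
qed

section \<open>Elementary symmetric polynomials form regular sequences\<close>

definition deg :: "('v \<Rightarrow>\<^sub>0 nat) \<Rightarrow> nat" where
  "deg m = (\<Sum>v\<in>V. lookup m v)"

lemma deg_add: "deg (a + b) = deg a + deg b"
  by (simp add: deg_def lookup_add sum.distrib)

definition hpart :: "nat \<Rightarrow> (('v \<Rightarrow>\<^sub>0 nat) \<Rightarrow>\<^sub>0 'k) \<Rightarrow> ('v \<Rightarrow>\<^sub>0 nat) \<Rightarrow>\<^sub>0 'k" where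
  "hpart k p = pick (\<lambda>m. deg m = k) p"

definition homog :: "nat \<Rightarrow> (('v \<Rightarrow>\<^sub>0 nat) \<Rightarrow>\<^sub>0 'k) \<Rightarrow> bool" where
  "homog d f \<longleftrightarrow> (\<forall>m\<in>keys f. deg m = d)"

definition graded :: "(('v \<Rightarrow>\<^sub>0 nat) \<Rightarrow>\<^sub>0 'k) set \<Rightarrow> bool" where
  "graded J \<longleftrightarrow> (\<forall>p\<in>J. \<forall>k. hpart k p \<in> J)"

lemma hpart_add: "hpart k (p + q) = hpart k p + hpart k q"
  by (simp add: hpart_def pick_add)

lemma hpart_mem: "p \<in> C \<Longrightarrow> hpart k p \<in> C"
  by (simp add: hpart_def pick_mem)

lemma homog_mult: "\<lbrakk>homog d f; homog e g\<rbrakk> \<Longrightarrow> homog (d + e) (f * g)"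
  using keys_mult[of f g] by (fastforce simp: homog_def deg_add)

lemma homog_power: "homog d f \<Longrightarrow> homog (n * d) (f ^ n)"
proof (induction n)
  case 0 then show ?case by (simp add: homog_def deg_def)
next
  case (Suc n) then show ?case using homog_mult[of d f "n * d" "f ^ n"] by simp
qed

lemma homog_var: "v \<in> V \<Longrightarrow> homog 1 (var v)"
  using finite_V by (simp add: homog_def var_def deg_def lookup_single when_def)

lemma hpart_mult:
  assumes "homog d f"
  shows "hpart k (f * r) = (if d \<le> k then f * hpart (k - d) r else 0)"
proof (cases "d \<le> k")
  case True
  define s where "s = pick (\<lambda>m. deg m \<noteq> k - d) r"
  have r: "r = hpart (k - d) r + s" unfolding hpart_def s_def by (simp add: pick_split)
  have "hpart k (f * hpart (k - d) r) = f * hpart (k - d) r"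
    unfolding hpart_def
  proof (rule pick_all)
    fix m assume "m \<in> keys (f * pick (\<lambda>m. deg m = k - d) r)"
    then show "deg m = k"
      using keys_mult[of f "pick (\<lambda>m. deg m = k - d) r"] assms True
      by (fastforce simp: homog_def deg_add keys_pick)
  qed
  moreover have "hpart k (f * s) = 0"
    unfolding hpart_def
  proof (rule pick_none)
    fix m assume "m \<in> keys (f * s)"
    then show "deg m \<noteq> k"
      using keys_mult[of f s] assms True unfolding s_def
      by (fastforce simp: homog_def deg_add keys_pick)
  qed
  ultimately have "hpart k (f * r) = f * hpart (k - d) r"
    by (subst r) (simp add: distrib_left hpart_add)
  then show ?thesis using True by simp
next
  case False
  have "hpart k (f * r) = 0"
    unfolding hpart_def
  proof (rule pick_none)
    fix m assume "m \<in> keys (f * r)"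
    then show "deg m \<noteq> k"
      using keys_mult[of f r] assms False by (fastforce simp: homog_def deg_add)
  qed
  then show ?thesis using False by simp
qed

lemma sum_hpart: "(\<Sum>k\<in>deg ` keys p. hpart k p) = p"
proof (rule poly_mapping_eqI)
  fix m
  show "lookup (\<Sum>k\<in>deg ` keys p. hpart k p) m = lookup p m"
    by (cases "m \<in> keys p")
      (auto simp: lookup_sum hpart_def lookup_pick not_in_keys_iff_lookup_eq_zero)
qed

lemma graded_adj:
  assumes "graded J" "idl J" "homog d f" "f \<in> C"
  shows "graded (adj J f)"
  unfolding graded_def
proof (intro ballI allI)
  fix p k assume "p \<in> adj J f"
  then obtain j r where *: "j \<in> J" "r \<in> C" "p = j + f * r" by (rule adjE)
  then have "hpart k p = hpart k j + f * (if d \<le> k then hpart (k - d) r else 0)"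
    using assms by (simp add: hpart_add hpart_mult)
  then show "hpart k p \<in> adj J f"
    using * assms adjI[of "hpart k j" J "if d \<le> k then hpart (k - d) r else 0" f]
    by (auto simp: graded_def hpart_mem)
qed

lemma graded_sr: "graded (sr \<Delta>)"
  by (auto simp: graded_def sr_def hpart_mem) (simp add: hpart_def keys_pick)

text \<open>Homogeneity forces an element divisible by all powers of \<open>var v\<close> modulo \<open>J\<close> into \<open>J\<close>;
  this lets a variable be moved past a regular sequence.\<close>

lemma nzd_permute:
  assumes J: "idl J" "graded J" and v: "v \<in> V" "nzd J (var v)" and f: "f \<in> C" "nzd (adj J (var v)) f"
  shows "nzd J f" "nzd (adj J f) (var v)"
proof -
  let ?x = "var v :: ('v \<Rightarrow>\<^sub>0 nat) \<Rightarrow>\<^sub>0 'k"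
  have x: "?x \<in> C" using v var_mem by blast
  show "nzd J f" unfolding nzd_def
  proof (intro ballI impI)
    fix m assume m: "m \<in> C" "f * m \<in> J"
    have div: "\<exists>j\<in>J. \<exists>r\<in>C. m = j + ?x ^ k * r" for k
    proof (induction k)
      case 0
      show ?case using m J by (intro bexI[of _ 0] bexI[of _ m]) (auto simp: idl_zero)
    next
      case (Suc k)
      then obtain j r where jr: "j \<in> J" "r \<in> C" "m = j + ?x ^ k * r" by blast
      have "?x ^ k * (f * r) = f * m - f * j" by (simp add: jr algebra_simps)
      also have "\<dots> \<in> J" using jr(1) m(2) f(1) J(1) by (intro idl_diff idl_mult[of J f j])
      finally have "f * r \<in> J" by (rule nzd_power[OF v(2) x mult_mem[OF f(1) jr(2)]])
      then have "r \<in> adj J ?x" using f(2) jr(2) adj_superset[of J ?x] nzdD by blast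
      then obtain j' r' where *: "j' \<in> J" "r' \<in> C" "r = j' + ?x * r'" by (rule adjE)
      have "m = (j + ?x ^ k * j') + ?x ^ Suc k * r'" by (simp add: jr(3) * algebra_simps)
      moreover have "j + ?x ^ k * j' \<in> J" using idl_add[OF J(1) jr(1) idl_mult[OF J(1) power_mem[OF x] *(1)]] .
      ultimately show ?case using *(2) by blast
    qed
    \<comment> \<open>Divisibility is used with exponent \<open>Suc k\<close>: the multiple of
      \<open>var v ^ Suc k\<close> has no part of degree \<open>k\<close>, so only the part of
      \<open>j\<close> is left.\<close>
    have "hpart k m \<in> J" for k
    proof -
      obtain j r where jr: "j \<in> J" "r \<in> C" "m = j + ?x ^ Suc k * r" using div by blast
      have "homog (Suc k) (?x ^ Suc k)" using homog_power[OF homog_var[OF v(1)], of "Suc k"] by simp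
      then have "hpart k m = hpart k j" unfolding jr(3) hpart_add by (subst hpart_mult) auto
      then show ?thesis using jr J by (simp add: graded_def)
    qed
    then show "m \<in> J" using idl_sum[of J _ "\<lambda>k. hpart k m"] J sum_hpart by metis
  qed
  show "nzd (adj J f) ?x" unfolding nzd_def
  proof (intro ballI impI)
    fix m assume m: "m \<in> C" "?x * m \<in> adj J f"
    then obtain j r where jr: "j \<in> J" "r \<in> C" "?x * m = j + f * r" by (meson adjE)
    then have "f * r = - j + ?x * m" by simp
    then have "f * r \<in> adj J ?x" using jr m J adjI[of "- j" J m ?x] by (simp add: idl_uminus)
    then have "r \<in> adj J ?x" using f(2) jr(2) nzdD by blast
    then obtain j' r' where *: "j' \<in> J" "r' \<in> C" "r = j' + ?x * r'" by (rule adjE)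
    have "?x * (m - f * r') = j + f * j'" using jr(3) *(3) by (simp add: algebra_simps)
    moreover have "j + f * j' \<in> J" using jr * f J by (intro idl_add idl_mult)
    ultimately have "m - f * r' \<in> J" using nzdD[OF v(2), of "m - f * r'"] m f * by simp
    then show "m \<in> adj J f" using adjI[of "m - f * r'" J r' f] * by simp
  qed
qed

text \<open>Moves the variable from the front of a weakly regular sequence to its end. Being a
  nonzerodivisor at the end is what \<open>wreg_esym\<close> needs of each variable.\<close>

lemma wreg_permute:
  assumes "idl J" "graded J" "v \<in> V" "nzd J (var v)" "set fs \<subseteq> C" "\<forall>f\<in>set fs. \<exists>d. homog d f"
    "wreg (adj J (var v)) fs"
  shows "wreg J fs \<and> nzd (foldl adj J fs) (var v)"
  using assms
proof (induction fs arbitrary: J)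
  case (Cons f fs)
  have f: "f \<in> C" "nzd (adj J (var v)) f" using Cons.prems by auto
  note * = nzd_permute[OF Cons.prems(1-4) f]
  have "wreg (adj J f) fs \<and> nzd (foldl adj (adj J f) fs) (var v)"
  proof (rule Cons.IH)
    show "idl (adj J f)" using Cons.prems(1) f(1) by (rule idl_adj)
    show "graded (adj J f)" using Cons.prems(1,2,6) f(1) graded_adj by auto
    show "wreg (adj (adj J f) (var v)) fs" using Cons.prems(7) adj_commute[of J f "var v"] by simp
  qed (use Cons.prems * in auto)
  then show ?case using * by simp
qed simp

definition esym :: "nat \<Rightarrow> ('v \<Rightarrow>\<^sub>0 nat) \<Rightarrow>\<^sub>0 'k" where
  "esym d = (\<Sum>S | S \<subseteq> V \<and> card S = d. single (ind S) 1)"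

lemma finite_sub: "S \<subseteq> V \<Longrightarrow> finite S"
  using finite_V finite_subset by blast

lemma keys_esym: "m \<in> keys (esym d) \<Longrightarrow> \<exists>S\<subseteq>V. card S = d \<and> m = ind S"
proof (rule ccontr)
  assume "m \<in> keys (esym d)" "\<not> (\<exists>S\<subseteq>V. card S = d \<and> m = ind S)"
  then have "lookup (esym d) m = 0"
    unfolding esym_def lookup_sum by (intro sum.neutral) (auto simp: lookup_single when_def)
  with \<open>m \<in> keys (esym d)\<close> show False by (simp add: in_keys_iff)
qed

lemma esym_mem: "esym d \<in> C"
  unfolding esym_def by (intro sum_mem single_mem) (auto simp: keys_ind finite_sub)

lemma deg_ind: "S \<subseteq> V \<Longrightarrow> deg (ind S) = card S"
  using finite_sub[of S] finite_V by (simp add: deg_def lookup_ind sum.If_cases Int_absorb1)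

lemma homog_esym: "homog d (esym d)"
  unfolding homog_def using keys_esym deg_ind by blast

text \<open>Modulo a variable of \<open>F\<close> the face loses one vertex, where
  \<open>e\<^sub>1, \<dots>, e\<^sub>r\<close> with \<open>r = card F - 1\<close> are regular by
  induction. By \<open>wreg_permute\<close> they are regular on \<open>F\<close>, and every variable
  of \<open>F\<close> is a nonzerodivisor behind them. The last one, \<open>esym (card F)\<close>,
  is congruent to the product of these variables, because every other set of that size leaves
  \<open>F\<close>.\<close>

lemma wreg_esym:
  assumes "F \<subseteq> V" "d \<le> card F"
  shows "wreg (sr (Pow F)) (map esym [1..<Suc d])"
  using assms
proof (induction "card F" arbitrary: F d)
  case 0
  then show ?case by simp
next
  case (Suc r)
  have F: "finite F" "F \<noteq> {}" using Suc finite_sub by auto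
  have J: "idl (sr (Pow F))" by (simp add: idl_sr)
  have perm: "wreg (sr (Pow F)) (map esym [1..<Suc e]) \<and>
      nzd (foldl adj (sr (Pow F)) (map esym [1..<Suc e])) (var v)"
    if "v \<in> F" "e \<le> r" for v e
  proof (rule wreg_permute[OF J graded_sr])
    show "v \<in> V" using that Suc by auto
    show "nzd (sr (Pow F)) (var v)" using that Suc nzd_var_sr_Pow by blast
    show "set (map esym [1..<Suc e]) \<subseteq> C" using esym_mem by auto
    show "\<forall>f\<in>set (map esym [1..<Suc e]). \<exists>d. homog d f" using homog_esym by auto
    have "wreg (sr (Pow (F - {v}))) (map esym [1..<Suc e])"
      using that Suc F by (intro Suc.hyps(1)) auto
    then show "wreg (adj (sr (Pow F)) (var v)) (map esym [1..<Suc e])"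
      using adj_sr_Pow \<open>v \<in> V\<close> by simp
  qed
  show ?case
  proof (cases "d \<le> r")
    case True
    then show ?thesis using perm F by blast
  next
    case False
    then have d: "d = Suc r" "card F = d" using Suc by auto
    let ?es = "map esym [1..<Suc r]"
    let ?J = "foldl adj (sr (Pow F)) ?es"
    have idl: "idl ?J" using esym_mem by (intro idl_foldl J) auto
    have "nzd ?J (\<Prod>v\<in>F. var v)"
    proof (intro nzd_prod conjI)
      fix v assume "v \<in> F"
      then show "nzd ?J (var v)" "var v \<in> C" using perm[of v r] Suc.prems(1) var_mem by blast+
    qed
    moreover have "(\<Prod>v\<in>F. var v) - esym d \<in> ?J"
    proof -
      have fin: "finite {S. S \<subseteq> V \<and> card S = d}" using finite_V by simp
      have "esym d = single (ind F) 1
          + (\<Sum>S\<in>{S. S \<subseteq> V \<and> card S = d} - {F}. single (ind S) 1)"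
        unfolding esym_def by (rule sum.remove[OF fin]) (use Suc.prems d in simp)
      moreover have "(\<Sum>S\<in>{S. S \<subseteq> V \<and> card S = d} - {F}. single (ind S) (1::'k)) \<in> sr (Pow F)"
      proof (rule idl_sum[OF J])
        fix S assume S: "S \<in> {S. S \<subseteq> V \<and> card S = d} - {F}"
        then have "\<not> S \<subseteq> F" using d F card_subset_eq[of F S] by auto
        then show "single (ind S) (1::'k) \<in> sr (Pow F)"
          using S by (auto simp: sr_def C_iff keys_ind finite_sub)
      qed
      ultimately have "(\<Prod>v\<in>F. var v) - esym d \<in> sr (Pow F)"
        using idl_uminus[OF J] by (simp add: single_ind[OF F(1), symmetric])
      then show ?thesis using foldl_adj_superset by blast
    qed
    ultimately have "nzd ?J (esym d)" using idl nzd_cong by blast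
    moreover have "wreg (sr (Pow F)) ?es" using perm F by blast
    ultimately show ?thesis unfolding d(1) by (simp add: wreg_append)
  qed
qed

end

section \<open>Algebraic dependence modulo a monomial prime\<close>

text \<open>Gaussian elimination: an equation with nonzero coefficient at \<open>p\<close> is solved
  for the unknown \<open>p\<close> and substituted into the others.\<close>

lemma linear_system_nontrivial:
  fixes a :: "'t \<Rightarrow> 'e \<Rightarrow> 'k::field"
  assumes "finite T" "finite E" "card T < card E"
  shows "\<exists>c. (\<exists>e\<in>E. c e \<noteq> 0) \<and> (\<forall>t\<in>T. (\<Sum>e\<in>E. c e * a t e) = 0)"
  using assms
proof (induction T arbitrary: E a rule: finite_induct)
  case empty
  then have "E \<noteq> {}" by auto
  then show ?case by (intro exI[of _ "\<lambda>_. 1"]) auto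
next
  case (insert t T)
  show ?case
  proof (cases "\<forall>e\<in>E. a t e = 0")
    case True
    have "card T < card E" using insert by simp
    then obtain c where "\<exists>e\<in>E. c e \<noteq> 0" "\<forall>t\<in>T. (\<Sum>e\<in>E. c e * a t e) = 0"
      using insert by blast
    then show ?thesis using True by (intro exI[of _ c]) auto
  next
    case False
    then obtain p where p: "p \<in> E" "a t p \<noteq> 0" by blast
    define E' where "E' = E - {p}"
    have E: "E = insert p E'" "p \<notin> E'" "finite E'" using p insert unfolding E'_def by auto
    have "card T < card E'" using insert E by simp
    from insert.IH[OF E(3) this, of "\<lambda>s e. a s e - a s p / a t p * a t e"]
    obtain c where c: "\<exists>e\<in>E'. c e \<noteq> 0"
      "\<And>s. s \<in> T \<Longrightarrow> (\<Sum>e\<in>E'. c e * (a s e - a s p / a t p * a t e)) = 0" by blast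
    define d where "d = c(p := - (\<Sum>e\<in>E'. c e * a t e) / a t p)"
    have sumE: "(\<Sum>e\<in>E. d e * a s e) = d p * a s p + (\<Sum>e\<in>E'. c e * a s e)" for s
    proof -
      have "(\<Sum>e\<in>E'. d e * a s e) = (\<Sum>e\<in>E'. c e * a s e)"
        using E(2) by (intro sum.cong) (auto simp: d_def)
      then show ?thesis using E by simp
    qed
    have "(\<Sum>e\<in>E. d e * a s e) = 0" if "s \<in> insert t T" for s
    proof (cases "s = t")
      case True
      then show ?thesis using p unfolding sumE by (simp add: d_def)
    next
      case False
      then have "0 = (\<Sum>e\<in>E'. c e * (a s e - a s p / a t p * a t e))" using c(2) that by auto
      also have "\<dots> = (\<Sum>e\<in>E'. c e * a s e) - a s p / a t p * (\<Sum>e\<in>E'. c e * a t e)"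
        unfolding sum_distrib_left sum_subtractf[symmetric] by (intro sum.cong) (simp_all add: algebra_simps)
      finally show ?thesis unfolding sumE by (simp add: d_def)
    qed
    moreover have "\<exists>e\<in>E. d e \<noteq> 0" using c(1) E by (auto simp: d_def)
    ultimately show ?thesis by blast
  qed
qed

text \<open>The exponents are bounded one by one instead of by total degree, so that the exponent
  vectors to be counted form a box.\<close>

definition bnd :: "nat \<Rightarrow> (('v \<Rightarrow>\<^sub>0 nat) \<Rightarrow>\<^sub>0 'k::zero) \<Rightarrow> bool" where
  "bnd b p \<longleftrightarrow> (\<forall>m\<in>keys p. \<forall>v. lookup m v \<le> b)"

lemma bnd_mult: "\<lbrakk>bnd a p; bnd b q\<rbrakk> \<Longrightarrow> bnd (a + b) (p * q :: ('v \<Rightarrow>\<^sub>0 nat) \<Rightarrow>\<^sub>0 'k::semiring_0)"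
  using keys_mult[of p q] by (fastforce simp: bnd_def lookup_add intro: add_mono)

lemma bnd_power: "bnd b p \<Longrightarrow> bnd (n * b) (p ^ n :: ('v \<Rightarrow>\<^sub>0 nat) \<Rightarrow>\<^sub>0 'k::comm_semiring_1)"
proof (induction n)
  case 0 then show ?case by (simp add: bnd_def)
next
  case (Suc n) then show ?case using bnd_mult[of b p "n * b" "p ^ n"] by simp
qed

lemma bnd_mono: "\<lbrakk>bnd a p; a \<le> b\<rbrakk> \<Longrightarrow> bnd b p"
  unfolding bnd_def using le_trans by blast

lemma bnd_exists: "\<exists>b. bnd b p"
proof -
  define S where "S = (\<Union>m\<in>keys p. lookup m ` keys m)"
  have "finite S" by (simp add: S_def)
  have "bnd (Max (insert 0 S)) p" unfolding bnd_def
  proof (intro ballI allI)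
    fix m v assume m: "m \<in> keys p"
    show "lookup m v \<le> Max (insert 0 S)"
    proof (cases "v \<in> keys m")
      case True
      then show ?thesis using m \<open>finite S\<close> unfolding S_def by (intro Max_ge) auto
    qed (simp add: not_in_keys_iff_lookup_eq_zero)
  qed
  then show ?thesis ..
qed

context mpolys
begin

lemma bnd_mon:
  assumes "\<And>f. f \<in> set fs \<Longrightarrow> bnd B f" "set e \<subseteq> {..<N}" "length e = length fs"
  shows "bnd (length fs * (N * B)) (mon fs e)"
  using assms
proof (induction fs arbitrary: e)
  case Nil
  then show ?case by (simp add: bnd_def)
next
  case (Cons f fs)
  then obtain n e' where e: "e = n # e'" "length e' = length fs" by (cases e) auto
  have "bnd (n * B) (f ^ n)" using Cons.prems(1)[of f] by (intro bnd_power) simp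
  then have "bnd (N * B) (f ^ n)" using Cons.prems e by (elim bnd_mono) auto
  moreover have "bnd (length fs * (N * B)) (mon fs e')" using Cons e by auto
  ultimately show ?case using bnd_mult e by fastforce
qed

lemma finite_bounded_monomials:
  assumes "finite F"
  shows "finite {m :: 'v \<Rightarrow>\<^sub>0 nat. keys m \<subseteq> F \<and> (\<forall>v. lookup m v \<le> D)}" (is "finite ?T")
    and "card {m :: 'v \<Rightarrow>\<^sub>0 nat. keys m \<subseteq> F \<and> (\<forall>v. lookup m v \<le> D)} \<le> Suc D ^ card F"
proof -
  let ?h = "\<lambda>m. restrict (lookup m) F"
  have inj: "inj_on ?h ?T"
  proof (rule inj_onI)
    fix m m' assume m: "m \<in> ?T" "m' \<in> ?T" "?h m = ?h m'"
    show "m = m'"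
    proof (rule poly_mapping_eqI)
      fix v
      show "lookup m v = lookup m' v"
      proof (cases "v \<in> F")
        case True
        then show ?thesis using fun_cong[OF m(3), of v] by simp
      next
        case False
        then have "v \<notin> keys m" "v \<notin> keys m'" using m by auto
        then show ?thesis by (simp add: not_in_keys_iff_lookup_eq_zero)
      qed
    qed
  qed
  have sub: "?h ` ?T \<subseteq> F \<rightarrow>\<^sub>E {..D}" by auto
  have fin: "finite (F \<rightarrow>\<^sub>E {..D})" using assms by (intro finite_PiE) auto
  show "finite ?T" using inj_on_finite[OF inj sub fin] .
  show "card ?T \<le> Suc D ^ card F" using card_inj_on_le[OF inj sub fin] assms by (simp add: card_PiE)
qed

text \<open>Counting: there are \<open>N ^ l\<close> monomials in the \<open>l\<close> polynomials
  \<open>fs\<close> with exponents below \<open>N\<close>, but their terms supported in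
  \<open>F\<close> lie in a box whose size is of order \<open>N ^ card F\<close>. For large
  \<open>N\<close> a nontrivial combination therefore has no term supported in
  \<open>F\<close>.\<close>

lemma algebraically_dependent:
  assumes F: "F \<subseteq> V" and fs: "set fs \<subseteq> C" "card F < length fs"
  obtains E :: "nat list set" and c :: "nat list \<Rightarrow> ('v \<Rightarrow>\<^sub>0 nat) \<Rightarrow>\<^sub>0 'k" where
    "finite E" "E \<noteq> {}" "\<And>e. e \<in> E \<Longrightarrow> length e = length fs"
    "\<And>e. e \<in> E \<Longrightarrow> c e \<in> C \<and> (\<exists>d\<in>C. d * c e = 1)"
    "(\<Sum>e\<in>E. c e * mon fs e) \<in> sr (Pow F)"
proof -
  have finF: "finite F" using F finite_sub by blast
  obtain b where b: "\<And>f. bnd (b f) (f :: ('v \<Rightarrow>\<^sub>0 nat) \<Rightarrow>\<^sub>0 'k)" using bnd_exists by metis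
  define B where "B = (\<Sum>f\<leftarrow>fs. b f)"
  have B: "bnd B f" if "f \<in> set fs" for f
    using that b[of f] bnd_mono member_le_sum_list[of "b f" "map b fs"] unfolding B_def by auto
  define l where "l = length fs"
  \<comment> \<open>Chosen so that \<open>Suc D ^ card F \<le> Suc (l * B) ^ card F * N ^ card F < N
    ^ Suc (card F) \<le> N ^ l\<close>.\<close>
  define N where "N = Suc (Suc (l * B) ^ card F)"
  define D where "D = l * (N * B)"
  define T where "T = {m :: 'v \<Rightarrow>\<^sub>0 nat. keys m \<subseteq> F \<and> (\<forall>v. lookup m v \<le> D)}"
  define E0 where "E0 = {e. set e \<subseteq> {..<N} \<and> length e = l}"
  have bmon: "bnd D (mon fs e)" if "e \<in> E0" for e
    using that B bnd_mon[of fs B e N] unfolding E0_def D_def l_def by auto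
  have finT: "finite T" "card T \<le> Suc D ^ card F"
    unfolding T_def using finite_bounded_monomials[OF finF] by auto
  have finE0: "finite E0" "card E0 = N ^ l"
    unfolding E0_def by (simp_all add: finite_lists_length_eq card_lists_length_eq)
  have "Suc D \<le> Suc (l * B) * N" unfolding D_def by (simp add: N_def algebra_simps)
  then have "Suc D ^ card F \<le> Suc (l * B) ^ card F * N ^ card F"
    by (metis power_mono power_mult_distrib zero_le)
  also have "\<dots> < N * N ^ card F" by (intro mult_strict_right_mono) (auto simp: N_def)
  also have "\<dots> \<le> N ^ l" using fs(2) power_increasing[of "Suc (card F)" l N] unfolding l_def N_def by simp
  finally have "card T < card E0" using finT finE0 by simp
  then obtain c where c: "\<exists>e\<in>E0. c e \<noteq> (0::'k)"
    "\<And>t. t \<in> T \<Longrightarrow> (\<Sum>e\<in>E0. c e * lookup (mon fs e) t) = 0"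
    using linear_system_nontrivial[OF finT(1) finE0(1), of "\<lambda>t e. lookup (mon fs e) t"] by blast
  \<comment> \<open>Zero coefficients are dropped, since \<open>nzd_chain_relation\<close> asks for
    units.\<close>
  define E where "E = {e \<in> E0. c e \<noteq> 0}"
  let ?c = "\<lambda>e. single (0 :: 'v \<Rightarrow>\<^sub>0 nat) (c e)"
  let ?s = "\<Sum>e\<in>E. ?c e * mon fs e"
  have constC: "single 0 x \<in> C" for x :: 'k by (simp add: single_mem)
  have s: "?s = (\<Sum>e\<in>E0. ?c e * mon fs e)"
    using finE0 unfolding E_def by (intro sum.mono_neutral_left) auto
  have coeff: "lookup ?s m = (\<Sum>e\<in>E0. c e * lookup (mon fs e) m)" for m
    unfolding s lookup_sum using lookup_single_mult[of 0 _ _ m] by (intro sum.cong) auto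
  have zero: "lookup ?s m = 0" if mF: "keys m \<subseteq> F" for m
  proof (cases "m \<in> T")
    case True
    then show ?thesis using c(2) coeff by simp
  next
    case False
    then obtain v where v: "\<not> lookup m v \<le> D" using mF unfolding T_def by blast
    then have "lookup (mon fs e) m = 0" if "e \<in> E0" for e
      using bmon[OF that] unfolding bnd_def by (auto simp: not_in_keys_iff_lookup_eq_zero[symmetric])
    then show ?thesis unfolding coeff by simp
  qed
  have "?s \<in> C" using fs mon_mem constC by (intro sum_mem mult_mem) auto
  then have "?s \<in> sr (Pow F)" unfolding sr_def using zero by (auto simp: in_keys_iff)
  moreover have "\<exists>d\<in>C. d * ?c e = 1" if "e \<in> E" for e
    using that constC by (intro bexI[of _ "single 0 (inverse (c e))"]) (auto simp: E_def mult_single)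
  ultimately show ?thesis
  proof (intro that[of E ?c])
    show "finite E" "E \<noteq> {}" using c(1) finE0 unfolding E_def by auto
    show "length e = length fs" if "e \<in> E" for e using that unfolding E_def E0_def l_def by simp
  qed (use constC in auto)
qed

section \<open>The polynomial ring and its quotients\<close>

abbreviation R :: "(('v \<Rightarrow>\<^sub>0 nat) \<Rightarrow>\<^sub>0 'k) ring" where "R \<equiv> poly_ring V"

lemma R_simps [simp]: "mult R = (*)" "one R = 1" "zero R = 0" "add R = (+)"
  by (simp_all add: poly_ring_def)

lemma cring_R: "cring R"
proof (rule cringI)
  show "abelian_group R"
    by (rule abelian_groupI) (auto simp: algebra_simps intro: bexI[of _ "- x" for x])
  show "comm_monoid R"
    by (rule comm_monoidI) (auto simp: algebra_simps)
qed (simp add: algebra_simps)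

lemma ring_R: "ring R"
  using cring_R by (rule cring.axioms)

lemma ideal_R_iff: "ideal J R \<longleftrightarrow> idl J"
proof
  assume "ideal J R"
  then interpret ideal J R .
  show "idl J"
  proof (rule idlI)
    show "J \<subseteq> C" by (rule a_subset)
    show "0 \<in> J" using additive_subgroup.zero_closed[OF additive_subgroup_axioms] by simp
    show "a + b \<in> J" if "a \<in> J" "b \<in> J" for a b using additive_subgroup.a_closed[OF additive_subgroup_axioms that] by simp
    show "r * a \<in> J" if "r \<in> C" "a \<in> J" for r a using I_l_closed[OF that(2,1)] by simp
  qed
next
  assume J: "idl J"
  interpret ring R by (rule ring_R)
  show "ideal J R"
  proof (rule idealI[OF ring_R])
    show "subgroup J (add_monoid R)"
    proof (rule group.subgroupI)
      show "group (add_monoid R)" by (rule a_group)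
      show "J \<subseteq> carrier (add_monoid R)" "J \<noteq> {}" using J idl_subset idl_zero by auto
    next
      fix a assume "a \<in> J"
      then have a: "a \<in> C" "- a \<in> C" "- a \<in> J" using J idl_mem idl_uminus by auto
      then have "inv\<^bsub>add_monoid R\<^esub> a = - a"
        using minus_equality[of "- a" a] unfolding a_inv_def by simp
      then show "inv\<^bsub>add_monoid R\<^esub> a \<in> J" using a by simp
    next
      fix a b assume "a \<in> J" "b \<in> J"
      then show "a \<otimes>\<^bsub>add_monoid R\<^esub> b \<in> J" using J idl_add by simp
    qed
  qed (use J idl_mult idl_mult_right in auto)
qed

lemma primeideal_R_iff:
  "primeideal P R \<longleftrightarrow> idl P \<and> P \<noteq> C \<and> (\<forall>a\<in>C. \<forall>b\<in>C. a * b \<in> P \<longrightarrow> a \<in> P \<or> b \<in> P)"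
proof
  assume "primeideal P R"
  then interpret primeideal P R .
  show "idl P \<and> P \<noteq> C \<and> (\<forall>a\<in>C. \<forall>b\<in>C. a * b \<in> P \<longrightarrow> a \<in> P \<or> b \<in> P)"
    using ideal_R_iff is_ideal I_notcarr I_prime by auto
next
  assume "idl P \<and> P \<noteq> C \<and> (\<forall>a\<in>C. \<forall>b\<in>C. a * b \<in> P \<longrightarrow> a \<in> P \<or> b \<in> P)"
  then show "primeideal P R"
    by (intro primeidealI) (auto simp: ideal_R_iff cring_R)
qed

lemma primeideal_sr_Pow: "F \<subseteq> V \<Longrightarrow> primeideal (sr (Pow F)) R"
  unfolding primeideal_R_iff
proof (intro conjI)
  have "1 \<notin> sr (Pow F)" by (simp add: sr_def)
  then show "sr (Pow F) \<noteq> C" using one_mem by metis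
qed (use idl_sr sr_Pow_prime in auto)

lemma coset_eq: "I +>\<^bsub>R\<^esub> m = {i + m | i. i \<in> I}"
  by (auto simp: a_r_coset_def')

lemma coset_eq_iff:
  assumes "idl I" "a \<in> C" "b \<in> C"
  shows "I +>\<^bsub>R\<^esub> a = I +>\<^bsub>R\<^esub> b \<longleftrightarrow> a - b \<in> I"
proof
  assume "I +>\<^bsub>R\<^esub> a = I +>\<^bsub>R\<^esub> b"
  moreover have "a \<in> I +>\<^bsub>R\<^esub> a" using idl_zero[OF assms(1)] unfolding coset_eq by force
  ultimately show "a - b \<in> I" unfolding coset_eq by auto
next
  assume ab: "a - b \<in> I"
  have "{i + a | i. i \<in> I} \<subseteq> {i + b | i. i \<in> I}" if "a - b \<in> I" for a b
  proof clarify
    fix i assume "i \<in> I"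
    then show "\<exists>i'. i + a = i' + b \<and> i' \<in> I"
      using idl_add[OF assms(1) _ that, of i] by (intro exI[of _ "i + (a - b)"]) auto
  qed
  then show "I +>\<^bsub>R\<^esub> a = I +>\<^bsub>R\<^esub> b"
    unfolding coset_eq using ab idl_uminus[OF assms(1) ab] by (simp add: subset_antisym)
qed

lemma coset_mem_image_iff:
  assumes "idl I" "idl J" "I \<subseteq> J" "a \<in> C"
  shows "I +>\<^bsub>R\<^esub> a \<in> (\<lambda>m. I +>\<^bsub>R\<^esub> m) ` J \<longleftrightarrow> a \<in> J"
proof
  assume "I +>\<^bsub>R\<^esub> a \<in> (\<lambda>m. I +>\<^bsub>R\<^esub> m) ` J"
  then obtain b where "b \<in> J" "I +>\<^bsub>R\<^esub> a = I +>\<^bsub>R\<^esub> b" by blast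
  then have "a - b \<in> J" "b \<in> J" using assms coset_eq_iff idl_mem by blast+
  then show "a \<in> J" using idl_add[OF assms(2), of "a - b" b] by simp
qed blast

lemma carrier_Quot: "carrier (R Quot I) = (\<lambda>m. I +>\<^bsub>R\<^esub> m) ` C"
  by (auto simp: FactRing_def A_RCOSETS_def')

lemma quot_hom:
  assumes "idl I" shows "ring_hom_ring R (R Quot I) (\<lambda>m. I +>\<^bsub>R\<^esub> m)"
  using ideal.rcos_ring_hom_ring[of I R] assms by (simp add: ideal_R_iff)

lemma quot_ops:
  assumes "idl I" "a \<in> C" "b \<in> C"
  shows "(I +>\<^bsub>R\<^esub> a) \<otimes>\<^bsub>R Quot I\<^esub> (I +>\<^bsub>R\<^esub> b) = I +>\<^bsub>R\<^esub> (a * b)"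
    and "(I +>\<^bsub>R\<^esub> a) \<oplus>\<^bsub>R Quot I\<^esub> (I +>\<^bsub>R\<^esub> b) = I +>\<^bsub>R\<^esub> (a + b)"
    and "\<zero>\<^bsub>R Quot I\<^esub> = I +>\<^bsub>R\<^esub> 0"
proof -
  interpret h: ring_hom_ring R "R Quot I" "\<lambda>m. I +>\<^bsub>R\<^esub> m" using assms quot_hom by blast
  show "(I +>\<^bsub>R\<^esub> a) \<otimes>\<^bsub>R Quot I\<^esub> (I +>\<^bsub>R\<^esub> b) = I +>\<^bsub>R\<^esub> (a * b)"
    using h.hom_mult[of a b] assms by simp
  show "(I +>\<^bsub>R\<^esub> a) \<oplus>\<^bsub>R Quot I\<^esub> (I +>\<^bsub>R\<^esub> b) = I +>\<^bsub>R\<^esub> (a + b)"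
    using h.hom_add[of a b] assms by simp
  show "\<zero>\<^bsub>R Quot I\<^esub> = I +>\<^bsub>R\<^esub> 0" using h.hom_zero by simp
qed

lemma cring_Quot: "idl I \<Longrightarrow> cring (R Quot I)"
  using ideal.quotient_is_cring[of I R] by (simp add: ideal_R_iff cring_R)

lemma primeideal_preimage:
  assumes I: "idl I" and P: "primeideal P (R Quot I)"
  shows "primeideal {x \<in> C. I +>\<^bsub>R\<^esub> x \<in> P} R" "I \<subseteq> {x \<in> C. I +>\<^bsub>R\<^esub> x \<in> P}"
proof -
  interpret P: primeideal P "R Quot I" by fact
  show "primeideal {x \<in> C. I +>\<^bsub>R\<^esub> x \<in> P} R"
    using ring_hom_ring.primeideal_vimage[OF quot_hom[OF I] cring_R P] by simp
  show "I \<subseteq> {x \<in> C. I +>\<^bsub>R\<^esub> x \<in> P}"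
  proof
    fix x assume x: "x \<in> I"
    then have "I +>\<^bsub>R\<^esub> x = I +>\<^bsub>R\<^esub> 0" using I by (subst coset_eq_iff) (auto dest: idl_mem)
    also have "\<dots> \<in> P" using additive_subgroup.zero_closed[OF P.additive_subgroup_axioms] quot_ops(3)[OF I, of 0 0] by simp
    finally show "x \<in> {x \<in> C. I +>\<^bsub>R\<^esub> x \<in> P}" using x I idl_mem by blast
  qed
qed

lemma primeideal_image:
  assumes I: "idl I" and Q: "primeideal Q R" "I \<subseteq> Q"
  shows "primeideal ((\<lambda>m. I +>\<^bsub>R\<^esub> m) ` Q) (R Quot I)"
proof (rule primeidealI)
  have idlQ: "idl Q" and prime: "Q \<noteq> C" "\<And>a b. \<lbrakk>a \<in> C; b \<in> C; a * b \<in> Q\<rbrakk> \<Longrightarrow> a \<in> Q \<or> b \<in> Q"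
    using Q primeideal_R_iff by auto
  note iff = coset_mem_image_iff[OF I idlQ Q(2)]
  show "ideal ((\<lambda>m. I +>\<^bsub>R\<^esub> m) ` Q) (R Quot I)"
    using ring.ring_ideal_imp_quot_ideal[OF ring_R, of I Q] I idlQ ideal_R_iff by simp
  show "cring (R Quot I)" using I by (rule cring_Quot)
  show "carrier (R Quot I) \<noteq> (\<lambda>m. I +>\<^bsub>R\<^esub> m) ` Q"
  proof
    assume "carrier (R Quot I) = (\<lambda>m. I +>\<^bsub>R\<^esub> m) ` Q"
    then have "x \<in> Q" if "x \<in> C" for x using iff[OF that] that unfolding carrier_Quot by blast
    then show False using prime(1) idl_subset[OF idlQ] by blast
  qed
  fix X Y assume "X \<in> carrier (R Quot I)" "Y \<in> carrier (R Quot I)"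
    and XY: "X \<otimes>\<^bsub>R Quot I\<^esub> Y \<in> (\<lambda>m. I +>\<^bsub>R\<^esub> m) ` Q"
  then obtain a b where ab: "a \<in> C" "b \<in> C" "X = I +>\<^bsub>R\<^esub> a" "Y = I +>\<^bsub>R\<^esub> b" unfolding carrier_Quot by auto
  then have "a * b \<in> Q" using XY iff[of "a * b"] quot_ops(1)[OF I ab(1,2)] by simp
  then show "X \<in> (\<lambda>m. I +>\<^bsub>R\<^esub> m) ` Q \<or> Y \<in> (\<lambda>m. I +>\<^bsub>R\<^esub> m) ` Q" using prime(2)[OF ab(1,2)] ab(3,4) by auto
qed

end

section \<open>Krull dimension and depth of edge ideals\<close>

definition indep :: "'v set set \<Rightarrow> 'v set \<Rightarrow> bool" where
  "indep E S \<longleftrightarrow> (\<forall>x\<in>S. \<forall>y\<in>S. {x, y} \<notin> E)"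

definition Ind :: "'v set set \<Rightarrow> 'v set \<Rightarrow> 'v set set" where
  "Ind E W = {S. S \<subseteq> W \<and> indep E S}"

definition maximal_indep :: "'v set \<Rightarrow> 'v set set \<Rightarrow> 'v set \<Rightarrow> bool" where
  "maximal_indep V E F \<longleftrightarrow> F \<in> Ind E V \<and> (\<forall>v\<in>V - F. \<not> indep E (insert v F))"

lemma indep_subset: "\<lbrakk>indep E S; T \<subseteq> S\<rbrakk> \<Longrightarrow> indep E T"
  unfolding indep_def by blast

text \<open>A non-pure shelling of the independence complex: \<open>W\<close> minus the neighbours of \<open>v\<close>
  carries the star of \<open>v\<close>, \<open>W - {v}\<close> the deletion.\<close>

inductive good :: "'v set set \<Rightarrow> nat \<Rightarrow> 'v set \<Rightarrow> bool" for E d where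
  good_indep: "\<lbrakk>indep E W; d \<le> card W\<rbrakk> \<Longrightarrow> good E d W"
| good_split: "\<lbrakk>v \<in> W; good E d (W - {u. {u, v} \<in> E}); good E d (W - {v})\<rbrakk> \<Longrightarrow> good E d W"

locale edge_ring = mpolys V K for V :: "'v::linorder set" and K :: "'k::field itself" +
  fixes E :: "'v set set"
  assumes graph: "simple_graph V E"
begin

lemma edge_subset: "{x, y} \<in> E \<Longrightarrow> x \<in> V \<and> y \<in> V"
  using graph unfolding simple_graph_def by blast

lemma edge_neq: "{x, y} \<in> E \<Longrightarrow> x \<noteq> y"
  using graph unfolding simple_graph_def by force

lemma down_closed_Ind: "down_closed (Ind E W)"
  unfolding down_closed_def Ind_def using indep_subset by blast

lemma ideal_Idl: "S \<subseteq> C \<Longrightarrow> idl (Idl\<^bsub>R\<^esub> S)"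
  using ring.genideal_ideal[OF ring_R, of S] ideal_R_iff by blast

lemma edge_ideal_eq: "edge_ideal V E = sr (Ind E V)"
proof
  have sub: "{var x * var y | x y. {x, y} \<in> E} \<subseteq> sr (Ind E V)"
  proof clarify
    fix x y assume xy: "{x, y} \<in> E"
    have "var x * var y = (single (single x 1 + single y 1) 1 ::
        ('v \<Rightarrow>\<^sub>0 nat) \<Rightarrow>\<^sub>0 'k)" by (simp add: var_def mult_single)
    then show "var x * var y \<in> sr (Ind E V)"
      using xy edge_subset[OF xy] by (simp add: sr_def C_iff keys_add_nat Ind_def indep_def)
  qed
  have idl: "idl (sr (Ind E V))" by (intro idl_sr down_closed_Ind)
  then have "sr (Ind E V) \<subseteq> C" by (rule idl_subset)
  then have gens: "{var x * var y | x y. {x, y} \<in> E} \<subseteq> C" using sub by blast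
  show "edge_ideal V E \<subseteq> sr (Ind E V)"
    unfolding edge_ideal_def using idl sub ideal_R_iff by (intro ring.genideal_minimal[OF ring_R]) auto
  have idl': "idl (edge_ideal V E)" unfolding edge_ideal_def by (rule ideal_Idl[OF gens])
  have mem: "var x * var y \<in> (edge_ideal V E :: (('v \<Rightarrow>\<^sub>0 nat) \<Rightarrow>\<^sub>0 'k) set)" if "{x, y} \<in> E" for x y
    unfolding edge_ideal_def
    by (rule subsetD[OF ring.genideal_self[OF ring_R gens]]) (use that in blast)
  show "sr (Ind E V) \<subseteq> edge_ideal V E"
  proof
    fix p assume p: "p \<in> sr (Ind E V)"
    show "p \<in> edge_ideal V E"
    proof (rule idl_monomials[OF idl'])
      fix m assume "m \<in> keys p"
      then have mV: "keys m \<subseteq> V" and "\<not> indep E (keys m)"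
        using p by (auto simp: sr_def C_iff Ind_def)
      then obtain x y where xy: "x \<in> keys m" "y \<in> keys m" "{x, y} \<in> E"
        unfolding indep_def by blast
      let ?m' = "m - single x 1"
      let ?c = "lookup p m"
      have y: "y \<in> keys ?m'"
        using xy edge_neq[OF xy(3)] by (simp add: in_keys_iff lookup_minus lookup_single)
      have "single m ?c = var x * (var y * single (?m' - single y 1) ?c)"
        unfolding split_var[OF xy(1)] split_var[OF y] ..
      also have "\<dots> = var x * var y * single (?m' - single y 1) ?c"
        by (simp add: mult.assoc)
      also have "\<dots> \<in> edge_ideal V E"
      proof (rule idl_mult_right[OF idl' _ mem[OF xy(3)]])
        show "single (?m' - single y 1) ?c \<in> C"
          using mV keys_minus_nat by (intro single_mem) blast
      qed
      finally show "single m ?c \<in> edge_ideal V E" .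
    qed
  qed
qed

lemma irrelevant_ideal_eq: "irrelevant_ideal V = sr (Pow {})"
proof
  have gens: "var ` V \<subseteq> C" using var_mem by blast
  have "single x (Suc 0) \<noteq> 0" for x :: 'v
    by (metis lookup_single_eq lookup_zero nat.distinct(1))
  then have "var ` V \<subseteq> sr (Pow {})" by (auto simp: sr_def C_iff var_def)
  then show "irrelevant_ideal V \<subseteq> sr (Pow {})"
    unfolding irrelevant_ideal_def
    by (intro ring.genideal_minimal[OF ring_R] ideal_R_iff[THEN iffD2] idl_sr down_closed_Pow)
  have idl': "idl (irrelevant_ideal V)" unfolding irrelevant_ideal_def by (rule ideal_Idl[OF gens])
  have mem: "var x \<in> (irrelevant_ideal V :: (('v \<Rightarrow>\<^sub>0 nat) \<Rightarrow>\<^sub>0 'k) set)" if "x \<in> V" for x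
    unfolding irrelevant_ideal_def
    by (rule subsetD[OF ring.genideal_self[OF ring_R gens]]) (use that in blast)
  show "sr (Pow {}) \<subseteq> irrelevant_ideal V"
  proof
    fix p assume p: "p \<in> sr (Pow {})"
    show "p \<in> irrelevant_ideal V"
    proof (rule idl_monomials[OF idl'])
      fix m assume "m \<in> keys p"
      then have mV: "keys m \<subseteq> V" and "keys m \<noteq> {}"
        using p by (auto simp: sr_def C_iff)
      then obtain x where x: "x \<in> keys m" by blast
      show "single m (lookup p m) \<in> irrelevant_ideal V"
        unfolding split_var[OF x]
      proof (rule idl_mult_right[OF idl'])
        show "single (m - single x 1) (lookup p m) \<in> C"
          using mV keys_minus_nat by (intro single_mem) blast
      qed (use mem x mV in blast)
    qed
  qed
qed

abbreviation I :: "(('v \<Rightarrow>\<^sub>0 nat) \<Rightarrow>\<^sub>0 'k) set" where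
  "I \<equiv> sr (Ind E V)"

lemma idl_I: "idl I"
  by (intro idl_sr down_closed_Ind)

section \<open>Krull dimension as the largest size of an independent set\<close>

lemma nzd_chain_primes:
  assumes "\<And>i. i \<le> r \<Longrightarrow> primeideal (Q i) R"
    and "\<And>i. i < r \<Longrightarrow> Q i \<subseteq> Q (Suc i) \<and> a i \<in> Q (Suc i) - Q i"
    and "i \<le> r"
  shows "nzd_chain (Q i) (map a [i..<r]) (Q r)"
  using assms(3)
proof (induction rule: inc_induct)
  case base
  then show ?case by (simp add: nzd_chain_Nil)
next
  case (step i)
  have p: "idl (Q i)" "idl (Q (Suc i))" "\<And>x y. \<lbrakk>x \<in> C; y \<in> C; x * y \<in> Q i\<rbrakk> \<Longrightarrow> x \<in> Q i \<or> y \<in> Q i"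
    using assms(1)[of i] assms(1)[of "Suc i"] step unfolding primeideal_R_iff by auto
  have a: "a i \<in> Q (Suc i)" "a i \<notin> Q i" "Q i \<subseteq> Q (Suc i)" using assms(2)[of i] step by auto
  then have "a i \<in> C" using idl_mem[OF p(2)] by blast
  \<comment> \<open>Primality of \<open>Q i\<close> makes every element outside it a nonzerodivisor
    modulo \<open>Q i\<close>.\<close>
  moreover from this have "nzd (Q i) (a i)" using p(3) a unfolding nzd_def by blast
  ultimately have "nzd_chain (Q i) (a i # map a [Suc i..<r]) (Q r)"
    using nzd_chain.nzd_chain_Cons[OF p(1) _ _ a(3,1) step.IH] by blast
  then show ?case using step by (simp add: upt_conv_Cons)
qed

text \<open>The variables outside \<open>Q 0\<close> form an independent set \<open>F\<close>,
  because \<open>Q 0\<close> is prime and contains the edge monomials. As \<open>Q 0\<close>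
  contains \<open>sr (Pow F)\<close>, a chain with more than \<open>card F\<close> steps would turn
  an algebraic relation into \<open>1 \<in> Q r\<close>.\<close>

lemma prime_chain_length:
  assumes prime: "\<And>i. i \<le> r \<Longrightarrow> primeideal (Q i) R"
    and strict: "\<And>i. i < r \<Longrightarrow> Q i \<subset> Q (Suc i)" and "I \<subseteq> Q 0"
  shows "\<exists>F\<in>Ind E V. r \<le> card F"
proof -
  have Q0: "idl (Q 0)" "\<And>x y. \<lbrakk>x \<in> C; y \<in> C; x * y \<in> Q 0\<rbrakk> \<Longrightarrow> x \<in> Q 0 \<or> y \<in> Q 0"
    using prime[of 0] unfolding primeideal_R_iff by auto
  have Qr: "idl (Q r)" "Q r \<noteq> C" using prime[of r] unfolding primeideal_R_iff by auto
  define F where "F = {v \<in> V. var v \<notin> Q 0}"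
  have "indep E F" unfolding indep_def
  proof (intro ballI notI)
    fix x y assume xy: "x \<in> F" "y \<in> F" "{x, y} \<in> E"
    have sub: "{var x * var y | x y. {x, y} \<in> E} \<subseteq> C"
      using edge_subset var_mem by auto
    have "var x * var y \<in> (edge_ideal V E :: (('v \<Rightarrow>\<^sub>0 nat) \<Rightarrow>\<^sub>0 'k) set)"
      unfolding edge_ideal_def
      by (rule subsetD[OF ring.genideal_self[OF ring_R sub]]) (use xy(3) in blast)
    then have "var x * var y \<in> Q 0" using edge_ideal_eq \<open>I \<subseteq> Q 0\<close> by blast
    moreover have "var x \<in> C" "var y \<in> C" using xy var_mem unfolding F_def by auto
    ultimately show False using xy Q0(2) unfolding F_def by blast
  qed
  then have F: "F \<in> Ind E V" unfolding Ind_def F_def by blast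
  have srF: "sr (Pow F) \<subseteq> Q 0"
  proof
    fix p assume p: "p \<in> sr (Pow F)"
    show "p \<in> Q 0"
    proof (rule idl_monomials[OF Q0(1)])
      fix m assume "m \<in> keys p"
      then have mV: "keys m \<subseteq> V" and "\<not> keys m \<subseteq> F"
        using p by (auto simp: sr_def C_iff)
      then obtain x where x: "x \<in> keys m" "var x \<in> Q 0" unfolding F_def by blast
      show "single m (lookup p m) \<in> Q 0"
        unfolding split_var[OF x(1)]
      proof (rule idl_mult_right[OF Q0(1) _ x(2)])
        show "single (m - single x 1) (lookup p m) \<in> C"
          using mV keys_minus_nat by (intro single_mem) blast
      qed
    qed
  qed
  have "r \<le> card F"
  proof (rule ccontr)
    assume "\<not> r \<le> card F"
    have "\<exists>a. a \<in> Q (Suc i) - Q i" if "i < r" for i using strict[OF that] by blast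
    then obtain a where a: "\<And>i. i < r \<Longrightarrow> a i \<in> Q (Suc i) - Q i" by metis
    let ?as = "map a [0..<r]"
    have chain: "nzd_chain (Q 0) ?as (Q r)"
      using a strict by (intro nzd_chain_primes prime) auto
    have "F \<subseteq> V" "card F < length ?as" using F \<open>\<not> r \<le> card F\<close> by (auto simp: Ind_def)
    then obtain S c where S: "finite S" "S \<noteq> {}" "\<And>e. e \<in> S \<Longrightarrow> length e = length ?as"
      "\<And>e. e \<in> S \<Longrightarrow> c e \<in> C \<and> (\<exists>d\<in>C. d * c e = 1)" "(\<Sum>e\<in>S. c e * mon ?as e) \<in> sr (Pow F)"
      using algebraically_dependent[OF _ nzd_chain_mem[OF chain]] by blast
    have "1 * (\<Sum>e\<in>S. c e * mon ?as e) \<in> Q 0" using S(5) srF by auto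
    with S(3,4) have "1 \<in> Q r"
      by (intro nzd_chain_relation[OF chain Q0(1) one_mem S(1,2) _ _ _ Qr(1), of c])
    then have "x \<in> Q r" if "x \<in> C" for x using idl_mult[OF Qr(1) that, of 1] by simp
    then show False using Qr idl_subset by blast
  qed
  then show ?thesis using F by blast
qed

lemma graph_dim_eq:
  assumes max: "\<And>F. F \<in> Ind E V \<Longrightarrow> card F \<le> n" and F0: "F0 \<in> Ind E V" "card F0 = n"
  shows "graph_dim K V E = enat n"
proof -
  have "graph_dim K V E = krull_dim (R Quot I)" by (simp add: graph_dim_def edge_ideal_eq)
  also have "\<dots> = enat n"
  proof (rule antisym)
    show "krull_dim (R Quot I) \<le> enat n"
      unfolding krull_dim_def
    proof (rule Sup_least, clarify)
      fix r P assume P: "\<forall>i\<le>r. primeideal (P i) (R Quot I)" "\<forall>i<r. P i \<subset> P (Suc i)"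
      define Q where "Q i = {x \<in> C. I +>\<^bsub>R\<^esub> x \<in> P i}" for i
      have "primeideal (Q i) R" if "i \<le> r" for i
        using P(1) that primeideal_preimage[OF idl_I] unfolding Q_def by blast
      moreover have "Q i \<subset> Q (Suc i)" if i: "i < r" for i
      proof -
        obtain X where X: "X \<in> P (Suc i)" "X \<notin> P i" using P(2) i by blast
        have "primeideal (P (Suc i)) (R Quot I)" using P(1) i by simp
        then have "P (Suc i) \<subseteq> carrier (R Quot I)"
          by (meson additive_subgroup.a_subset ideal.axioms(1) primeideal.axioms(1))
        then obtain x where "x \<in> C" "X = I +>\<^bsub>R\<^esub> x" using X unfolding carrier_Quot by blast
        then show ?thesis using X P(2) i unfolding Q_def by blast
      qed
      moreover have "I \<subseteq> Q 0" unfolding Q_def using primeideal_preimage(2)[OF idl_I] P(1) by blast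
      ultimately obtain F where "F \<in> Ind E V" "r \<le> card F" using prime_chain_length by blast
      then show "enat r \<le> enat n" using max by fastforce
    qed
    have "finite F0" using F0 finite_sub unfolding Ind_def by auto
    then obtain xs where xs: "set xs = F0" "distinct xs" using finite_distinct_list by blast
    then have len: "length xs = n" using F0 distinct_card by fastforce
    \<comment> \<open>Removing the vertices of \<open>F0\<close> one at a time gives
      \<open>n + 1\<close> monomial primes above \<open>I\<close>, from \<open>sr (Pow F0)\<close>
      up to \<open>sr (Pow {})\<close>.\<close>
    define Q where "Q i = sr (Pow (set (drop i xs)))" for i
    have subV: "set (drop i xs) \<subseteq> V" for i
      using xs F0 set_drop_subset unfolding Ind_def by fastforce
    have Qprime: "primeideal (Q i) R" for i unfolding Q_def using subV by (rule primeideal_sr_Pow)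
    have IQ: "I \<subseteq> Q i" for i
    proof -
      have "set (drop i xs) \<in> Ind E V"
        using subV F0 set_drop_subset[of i xs] xs indep_subset unfolding Ind_def by blast
      then have "Pow (set (drop i xs)) \<subseteq> Ind E V" using down_closed_Ind unfolding down_closed_def by blast
      then show ?thesis unfolding Q_def sr_def by blast
    qed
    have strict: "Q i \<subset> Q (Suc i)" if "i < n" for i
    proof -
      have d: "drop i xs = xs ! i # drop (Suc i) xs" using that len by (simp add: Cons_nth_drop_Suc)
      then have v: "xs ! i \<in> set (drop i xs)" "xs ! i \<notin> set (drop (Suc i) xs)"
        using distinct_drop[OF xs(2), of i] by auto
      have "var (xs ! i) \<in> Q (Suc i)" "var (xs ! i) \<notin> Q i"
        using v subV[of i] unfolding Q_def sr_def by (auto simp: C_iff var_def)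
      moreover have "Q i \<subseteq> Q (Suc i)" unfolding Q_def sr_def using d by auto
      ultimately show ?thesis by blast
    qed
    let ?P = "\<lambda>i. (\<lambda>m. I +>\<^bsub>R\<^esub> m) ` Q i"
    have "\<forall>i\<le>n. primeideal (?P i) (R Quot I)"
      using primeideal_image[OF idl_I Qprime IQ] by blast
    moreover have "\<forall>i<n. ?P i \<subset> ?P (Suc i)"
    proof (intro allI impI)
      fix i assume "i < n"
      from strict[OF this] obtain x where x: "x \<in> Q (Suc i)" "x \<notin> Q i" by blast
      have Q: "idl (Q i)" "idl (Q (Suc i))" using Qprime primeideal_R_iff by auto
      then have "I +>\<^bsub>R\<^esub> x \<notin> ?P i" "I +>\<^bsub>R\<^esub> x \<in> ?P (Suc i)"
        using x coset_mem_image_iff[OF idl_I Q(1) IQ] idl_mem[OF Q(2)] by auto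
      moreover have "?P i \<subseteq> ?P (Suc i)" using strict[OF \<open>i < n\<close>] by blast
      ultimately show "?P i \<subset> ?P (Suc i)" by blast
    qed
    ultimately show "enat n \<le> krull_dim (R Quot I)"
      unfolding krull_dim_def by (intro Sup_upper CollectI exI[of _ n] conjI exI[of _ ?P] refl)
  qed
  finally show ?thesis .
qed

section \<open>Regular sequences on the quotient by the edge ideal, and its depth\<close>

lemma quotient_module_simps [simp]:
  "carrier (quotient_module R I) = carrier (R Quot I)"
  "smult (quotient_module R I) a X = (I +>\<^bsub>R\<^esub> a) \<otimes>\<^bsub>R Quot I\<^esub> X"
  by (simp_all add: quotient_module_def)

lemma subgroup_quotient_module:
  "subgroup N (add_monoid (quotient_module R I)) \<longleftrightarrow> subgroup N (add_monoid (R Quot I))"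
  by (simp add: quotient_module_def subgroup_def m_inv_def)

text \<open>Submodules of the quotient correspond to ideals above \<open>I\<close>: the preimage of
  a submodule that contains all multiples of \<open>ys\<close> is an ideal containing
  \<open>I\<close> and, through the coset of \<open>1\<close>, the elements \<open>ys\<close>
  themselves.\<close>

lemma multiples_eq:
  assumes "set ys \<subseteq> C"
  shows "multiples R (quotient_module R I) (set ys) = (\<lambda>m. I +>\<^bsub>R\<^esub> m) ` foldl adj I ys"
proof
  let ?J = "foldl adj I ys" and ?M = "quotient_module R I" and ?h = "\<lambda>m. I +>\<^bsub>R\<^esub> m"
  have J: "idl ?J" "I \<subseteq> ?J" "set ys \<subseteq> ?J"
    using assms idl_I by (auto intro: idl_foldl foldl_adj_superset[THEN subsetD] foldl_adj_gen[THEN subsetD])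
  have ideal: "ideal (?h ` ?J) (R Quot I)"
    using ring.ring_ideal_imp_quot_ideal[OF ring_R, of I ?J] idl_I J ideal_R_iff by simp
  have "submodule (?h ` ?J) R ?M"
  proof (intro submodule.intro submodule_axioms.intro)
    show "subgroup (?h ` ?J) (add_monoid ?M)"
      unfolding subgroup_quotient_module using additive_subgroup.a_subgroup[OF ideal.axioms(1)[OF ideal]] .
    fix a X assume a: "a \<in> C" "X \<in> ?h ` ?J"
    then show "a \<odot>\<^bsub>?M\<^esub> X \<in> ?h ` ?J"
      using ideal.I_l_closed[OF ideal a(2), of "?h a"] unfolding carrier_Quot by simp
  qed
  moreover have "a \<odot>\<^bsub>?M\<^esub> X \<in> ?h ` ?J" if aX: "a \<in> set ys" "X \<in> carrier ?M" for a X
  proof -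
    obtain m where m: "m \<in> C" "X = ?h m" using aX unfolding quotient_module_simps carrier_Quot by blast
    have "a \<in> C" "a * m \<in> ?J" using aX J m assms idl_mult_right by blast+
    then show ?thesis using quot_ops(1)[OF idl_I, of a m] m by simp
  qed
  ultimately show "multiples R ?M (set ys) \<subseteq> ?h ` ?J"
    unfolding multiples_def by blast
  show "?h ` ?J \<subseteq> multiples R ?M (set ys)"
    unfolding multiples_def
  proof (rule Inter_greatest)
    fix N assume "N \<in> {N. submodule N R ?M \<and> (\<forall>a\<in>set ys. \<forall>m\<in>carrier ?M. a \<odot>\<^bsub>?M\<^esub> m \<in> N)}"
    then have N: "submodule N R ?M" "\<And>a X. \<lbrakk>a \<in> set ys; X \<in> carrier ?M\<rbrakk> \<Longrightarrow> a \<odot>\<^bsub>?M\<^esub> X \<in> N" by auto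
    have sg: "subgroup N (add_monoid (R Quot I))" using submodule.axioms(1)[OF N(1)] unfolding subgroup_quotient_module .
    define L where "L = {m \<in> C. ?h m \<in> N}"
    have zero: "?h 0 \<in> N" using subgroup.one_closed[OF sg] quot_ops(3)[OF idl_I, of 0 0] by simp
    have "idl L"
    proof (rule idlI)
      show "L \<subseteq> C" "0 \<in> L" using zero unfolding L_def by auto
    next
      fix a b assume "a \<in> L" "b \<in> L"
      then show "a + b \<in> L"
        using subgroup.m_closed[OF sg, of "?h a" "?h b"] quot_ops(2)[OF idl_I, of a b] unfolding L_def by simp
    next
      fix a b assume "a \<in> C" "b \<in> L"
      then show "a * b \<in> L"
        using submodule.smult_closed[OF N(1), of a "?h b"] quot_ops(1)[OF idl_I, of a b] unfolding L_def by simp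
    qed
    moreover have "I \<subseteq> L"
    proof
      fix x assume x: "x \<in> I"
      then have "x \<in> C" using idl_mem[OF idl_I] by blast
      moreover from this have "?h x = ?h 0" using x coset_eq_iff[OF idl_I, of x 0] by simp
      ultimately show "x \<in> L" using zero unfolding L_def by simp
    qed
    moreover have "set ys \<subseteq> L"
    proof
      fix y assume y: "y \<in> set ys"
      then have "y \<in> C" "?h 1 \<in> carrier ?M" using assms carrier_Quot by auto
      then show "y \<in> L" using N(2)[OF y, of "?h 1"] quot_ops(1)[OF idl_I, of y 1] unfolding L_def by simp
    qed
    ultimately have "?J \<subseteq> L" by (rule foldl_adj_least)
    then show "?h ` ?J \<subseteq> N" unfolding L_def by blast
  qed
qed

lemma regular_sequence_iff:
  "regular_sequence R (quotient_module R I) xs \<longleftrightarrow> set xs \<subseteq> C \<and> wreg I xs \<and> foldl adj I xs \<noteq> C"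
proof (cases "set xs \<subseteq> C")
  case True
  let ?h = "\<lambda>m. I +>\<^bsub>R\<^esub> m"
  have J: "idl (foldl adj I (take i xs))" "I \<subseteq> foldl adj I (take i xs)" for i
    using True set_take_subset[of i xs] by (auto intro: idl_foldl idl_I foldl_adj_superset[THEN subsetD])
  have mult: "multiples R (quotient_module R I) (set (take i xs)) = ?h ` foldl adj I (take i xs)" for i
    using True set_take_subset[of i xs] by (intro multiples_eq) auto
  have iff: "?h m \<in> ?h ` foldl adj I (take i xs) \<longleftrightarrow> m \<in> foldl adj I (take i xs)" if "m \<in> C" for m i
    using coset_mem_image_iff[OF idl_I J that] .
  have "(\<forall>m\<in>carrier (quotient_module R I).
        xs ! i \<odot>\<^bsub>quotient_module R I\<^esub> m \<in> multiples R (quotient_module R I) (set (take i xs)) \<longrightarrow>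
        m \<in> multiples R (quotient_module R I) (set (take i xs))) \<longleftrightarrow> nzd (foldl adj I (take i xs)) (xs ! i)"
    if "i < length xs" for i
  proof -
    have xi: "xs ! i \<in> C" using True that by auto
    show ?thesis
      unfolding mult quotient_module_simps carrier_Quot nzd_def ball_simps
      by (intro ball_cong refl) (simp add: quot_ops(1)[OF idl_I xi] iff xi)
  qed
  then have 1: "(\<forall>i<length xs. \<forall>m\<in>carrier (quotient_module R I).
        xs ! i \<odot>\<^bsub>quotient_module R I\<^esub> m \<in> multiples R (quotient_module R I) (set (take i xs)) \<longrightarrow>
        m \<in> multiples R (quotient_module R I) (set (take i xs))) \<longleftrightarrow> wreg I xs"
    unfolding wreg_iff_nth by blast
  have "?h ` foldl adj I xs = ?h ` C \<longleftrightarrow> foldl adj I xs = C"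
    using iff[of _ "length xs"] idl_subset[OF J(1)[of "length xs"]] by auto
  then have 2: "multiples R (quotient_module R I) (set xs) \<noteq> carrier (quotient_module R I) \<longleftrightarrow> foldl adj I xs \<noteq> C"
    using mult[of "length xs"] carrier_Quot by simp
  show ?thesis unfolding regular_sequence_def using 1 2 True by blast
qed (simp add: regular_sequence_def)

lemma regular_sequence_length:
  assumes F: "maximal_indep V E F" and xs: "set xs \<subseteq> irrelevant_ideal V" "wreg I xs"
  shows "length xs \<le> card F"
proof (rule ccontr)
  assume len: "\<not> length xs \<le> card F"
  have FV: "F \<subseteq> V" "indep E F" using F unfolding maximal_indep_def Ind_def by auto
  then have finF: "finite F" using finite_sub by blast
  define s where "s = Suc (card F)"
  define fs where "fs = map (\<lambda>f. f ^ s) xs"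
  have xsC: "set xs \<subseteq> C" using xs idl_subset[OF idl_sr[OF down_closed_Pow]] unfolding irrelevant_ideal_eq by blast
  have fsC: "set fs \<subseteq> C" using xsC unfolding fs_def by auto
  have "wreg I fs" unfolding fs_def using idl_I xsC xs(2) by (rule wreg_map_power)
  then have chain: "nzd_chain I fs (foldl adj I fs)" using idl_I fsC by (rule wreg_nzd_chain)
  \<comment> \<open>\<open>L\<close> contains \<open>I\<close> and all powers \<open>f ^ s\<close>
    of the sequence, but not the monomial of \<open>F\<close>, which has degree
    \<open>card F < s\<close> and independent support.\<close>
  define L where "L = {p \<in> C. \<forall>m\<in>keys p. s \<le> deg m \<or> keys m \<notin> Ind E V}"
  have idlL: "idl L"
  proof (rule idlI)
    fix a b assume "a \<in> L" "b \<in> L"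
    then show "a + b \<in> L" using keys_add[of a b] unfolding L_def by fastforce
  next
    fix r a assume r: "r \<in> C" "a \<in> L"
    show "r * a \<in> L" unfolding L_def
    proof (intro CollectI conjI ballI)
      show "r * a \<in> C" using r unfolding L_def by simp
      fix m assume "m \<in> keys (r * a)"
      then obtain m1 m2 where m: "m = m1 + m2" "m2 \<in> keys a" using keys_mult[of r a] by blast
      then have "s \<le> deg m2 \<or> keys m2 \<notin> Ind E V" using r unfolding L_def by blast
      then show "s \<le> deg m \<or> keys m \<notin> Ind E V"
        unfolding m(1) deg_add keys_add_nat using down_closed_Ind unfolding down_closed_def
        by (meson Un_upper2 trans_le_add2)
    qed
  qed (auto simp: L_def)
  have "fs' \<in> L" if fs': "fs' \<in> set fs" for fs'
  proof -
    obtain f where f: "f \<in> set xs" "fs' = f ^ s" using fs' unfolding fs_def by auto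
    have fC: "f \<in> C" "\<And>m. m \<in> keys f \<Longrightarrow> keys m \<noteq> {}"
      using f xs(1) unfolding irrelevant_ideal_eq sr_def by auto
    have "\<forall>m\<in>keys (f ^ n). n \<le> deg m" for n
    proof (induction n)
      case (Suc n)
      have "1 \<le> deg m" if m: "m \<in> keys f" for m
      proof -
        obtain v where v: "v \<in> keys m" using fC(2)[OF m] by blast
        then have "v \<in> V" using fC(1) m C_iff by blast
        then have "lookup m v \<le> deg m"
          unfolding deg_def using finite_V by (intro member_le_sum) auto
        then show ?thesis using v by (simp add: in_keys_iff)
      qed
      then show ?case using keys_mult[of f "f ^ n"] Suc by (fastforce simp: deg_add)
    qed simp
    then show ?thesis using f fC unfolding L_def by auto
  qed
  moreover have "I \<subseteq> L" unfolding L_def sr_def by blast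
  ultimately have sub: "foldl adj I fs \<subseteq> L" using foldl_adj_least[OF idlL] by blast
  define z where "z = (single (ind F) 1 :: ('v \<Rightarrow>\<^sub>0 nat) \<Rightarrow>\<^sub>0 'k)"
  have zC: "z \<in> C" unfolding z_def using FV finF by (intro single_mem) (simp add: keys_ind)
  have "card F < length fs" using len unfolding fs_def by simp
  then obtain S c where S: "finite S" "S \<noteq> {}" "\<And>e. e \<in> S \<Longrightarrow> length e = length fs"
    "\<And>e. e \<in> S \<Longrightarrow> c e \<in> C \<and> (\<exists>d\<in>C. d * c e = 1)" "(\<Sum>e\<in>S. c e * mon fs e) \<in> sr (Pow F)"
    using algebraically_dependent[OF FV(1) fsC] by blast
  \<comment> \<open>By maximality each variable outside \<open>F\<close> completes an edge with
    \<open>F\<close>. So \<open>I : z\<close> contains the prime \<open>sr (Pow F)\<close>, and a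
    relation modulo this prime becomes one modulo \<open>I\<close> after multiplication by
    \<open>z\<close>.\<close>
  have zp: "z * p \<in> I" if p: "p \<in> sr (Pow F)" for p
  proof -
    have "keys m \<notin> Ind E V" if "m \<in> keys (z * p)" for m
    proof -
      obtain n where n: "n \<in> keys p" "m = ind F + n"
        using \<open>m \<in> _\<close> unfolding z_def keys_single_mult by blast
      then obtain v where v: "v \<in> keys n" "v \<in> V - F" using p unfolding sr_def C_iff by blast
      then have "\<not> indep E (insert v F)" using F unfolding maximal_indep_def by blast
      moreover have "insert v F \<subseteq> keys m" using v n finF by (simp add: keys_add_nat keys_ind)
      ultimately show ?thesis unfolding Ind_def using indep_subset by blast
    qed
    moreover have "z * p \<in> C" using zC p unfolding sr_def by simp
    ultimately show ?thesis unfolding sr_def by blast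
  qed
  have "idl (foldl adj I fs)" using idl_I fsC by (rule idl_foldl)
  with S(3,4) have "z \<in> foldl adj I fs"
    by (intro nzd_chain_relation[OF chain idl_I zC S(1,2) _ _ zp[OF S(5)]])
  then have "z \<in> L" using sub by blast
  then show False
    using FV finF deg_ind[OF FV(1)] unfolding L_def z_def s_def by (simp add: keys_ind Ind_def)
qed

lemma wreg_good:
  assumes "good E d W" "W \<subseteq> V"
  shows "wreg (sr (Ind E W)) (map esym [1..<Suc d])"
  using assms
proof (induction rule: good.induct)
  case (good_indep W)
  then have "Ind E W = Pow W" unfolding Ind_def using indep_subset by blast
  then show ?case using wreg_esym good_indep by simp
next
  case (good_split v W)
  have v: "v \<in> V" using good_split by blast
  \<comment> \<open>The sets compatible with \<open>v\<close> are those avoiding its neighbours. As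
    \<open>v\<close> itself is kept on the right, this is the star and not the link.\<close>
  have "{S. S \<subseteq> V \<and> insert v S \<in> Ind E W} = Ind E (W - {u. {u, v} \<in> E})"
  proof -
    have "indep E (insert v S) \<longleftrightarrow> indep E S \<and> (\<forall>u\<in>S. {u, v} \<notin> E)" for S
      using edge_neq[of v v] unfolding indep_def by (auto simp: insert_commute)
    then show ?thesis using good_split unfolding Ind_def by auto
  qed
  then have "colon (sr (Ind E W)) (var v) = sr (Ind E (W - {u. {u, v} \<in> E}))"
    using var_mult_mem_sr[OF v] by simp
  moreover have "adj (sr (Ind E W)) (var v) = sr (Ind E (W - {v}))"
  proof -
    have "{S \<in> Ind E W. v \<notin> S} = Ind E (W - {v})" unfolding Ind_def by auto
    then show ?thesis using adj_sr[OF down_closed_Ind v] by simp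
  qed
  moreover have "wreg (sr (Ind E (W - {u. {u, v} \<in> E}))) (map esym [1..<Suc d])"
    "wreg (sr (Ind E (W - {v}))) (map esym [1..<Suc d])"
    using good_split by (meson Diff_subset subset_trans)+
  moreover have "set (map esym [1..<Suc d]) \<subseteq> C" using esym_mem by auto
  ultimately show ?case
    using wreg_exact[OF idl_sr[OF down_closed_Ind] var_mem[OF v]] by metis
qed

lemma graph_depth_eq:
  assumes "good E d V" "maximal_indep V E F" "card F = d"
  shows "graph_depth K V E = enat d"
proof -
  have "graph_depth K V E = depth R (irrelevant_ideal V) (quotient_module R I)"
    by (simp add: graph_depth_def edge_ideal_eq Let_def)
  also have "\<dots> = enat d"
  proof (rule antisym)
    show "depth R (irrelevant_ideal V) (quotient_module R I) \<le> enat d"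
      unfolding depth_def
    proof (rule Sup_least, clarify)
      fix xs assume "set xs \<subseteq> irrelevant_ideal V" "regular_sequence R (quotient_module R I) xs"
      then show "enat (length xs) \<le> enat d"
        using regular_sequence_length[OF assms(2)] assms(3) regular_sequence_iff by simp
    qed
    let ?es = "map esym [1..<Suc d]"
    have es: "set ?es \<subseteq> sr (Pow {})"
    proof
      fix f assume "f \<in> set ?es"
      then obtain j where j: "f = esym j" "j \<noteq> 0" by auto
      have "keys m \<noteq> {}" if "m \<in> keys (esym j)" for m
        using keys_esym[OF that] j(2) finite_sub by (force simp: keys_ind)
      then show "f \<in> sr (Pow {})" using j esym_mem unfolding sr_def by simp
    qed
    \<comment> \<open>Neither \<open>I\<close> nor \<open>?es\<close> contains a constant term,
      which keeps the last quotient nonzero.\<close>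
    have "I \<subseteq> sr (Pow {})" unfolding sr_def Ind_def indep_def by auto
    then have "foldl adj I ?es \<subseteq> sr (Pow {})" using es by (intro foldl_adj_least idl_sr down_closed_Pow)
    moreover have "1 \<notin> sr (Pow {})" by (simp add: sr_def)
    ultimately have "foldl adj I ?es \<noteq> C" using one_mem by blast
    then have "regular_sequence R (quotient_module R I) ?es"
      unfolding regular_sequence_iff using wreg_good[OF assms(1)] esym_mem by auto
    moreover have "length ?es = d" by simp
    ultimately show "enat d \<le> depth R (irrelevant_ideal V) (quotient_module R I)"
      unfolding depth_def irrelevant_ideal_eq using es
      by (intro Sup_upper CollectI exI[of _ ?es] conjI) simp_all
  qed
  finally show ?thesis .
qed

end

section \<open>The structure of Cameron--Walker graphs\<close>

text \<open>A maximum induced matching \<open>{a i, b i}\<close> that is also a maximum matching: \<open>S\<close> indexes the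
  edges where \<open>b i\<close> is a leaf, \<open>T\<close> those that form a pendant triangle with the vertex \<open>w i\<close>.
  The set \<open>W\<close> of unmatched vertices contains the \<open>v\<^sub>j\<close> and the remaining leaves.\<close>

locale cw_structure =
  fixes V :: "'v set" and E :: "'v set set" and a b w :: "'i \<Rightarrow> 'v" and S T :: "'i set" and W :: "'v set"
  assumes graph: "simple_graph V E"
    and fin: "finite S" "finite T" and disj: "S \<inter> T = {}"
    and V_eq: "V = a ` (S \<union> T) \<union> b ` (S \<union> T) \<union> W"
    and inj: "inj_on a (S \<union> T)" "inj_on b (S \<union> T)"
    and ab: "\<And>i j. \<lbrakk>i \<in> S \<union> T; j \<in> S \<union> T\<rbrakk> \<Longrightarrow> a i \<noteq> b j"
    and notW: "\<And>i. i \<in> S \<union> T \<Longrightarrow> a i \<notin> W \<and> b i \<notin> W"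
    and leaf: "\<And>i x. i \<in> S \<Longrightarrow> {b i, x} \<in> E \<longleftrightarrow> x = a i"
    and stem: "\<And>i x. \<lbrakk>i \<in> S; {a i, x} \<in> E\<rbrakk> \<Longrightarrow> x = b i \<or> x \<in> W"
    and tri_a: "\<And>i x. i \<in> T \<Longrightarrow> {a i, x} \<in> E \<longleftrightarrow> x = b i \<or> x = w i"
    and tri_b: "\<And>i x. i \<in> T \<Longrightarrow> {b i, x} \<in> E \<longleftrightarrow> x = a i \<or> x = w i"
    and apex: "\<And>i. i \<in> T \<Longrightarrow> w i \<in> W"
    and W_indep: "indep E W"
    and W_stem: "\<And>x. x \<in> W \<Longrightarrow> \<exists>i\<in>S. {a i, x} \<in> E"
    and W_ne: "W \<noteq> {}" and two: "2 \<le> card S + card T"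
begin

lemma finite_V: "finite V"
  using graph unfolding simple_graph_def by blast

lemma finite_W: "finite W"
  using finite_V V_eq by simp

lemma no_loop: "{x} \<notin> E"
  using graph unfolding simple_graph_def by force

lemma edge_neq: "{x, y} \<in> E \<Longrightarrow> x \<noteq> y"
  using no_loop by auto

lemma edge_mem: "{x, y} \<in> E \<Longrightarrow> x \<in> V \<and> y \<in> V"
  using graph unfolding simple_graph_def by blast

lemma sym: "{x, y} \<in> E \<longleftrightarrow> {y, x} \<in> E"
  by (simp add: insert_commute)

lemma matched: "i \<in> S \<union> T \<Longrightarrow> {a i, b i} \<in> E"
  using leaf[of i "a i"] tri_a[of i "b i"] by (auto simp: insert_commute)

lemma mem_V [simp]: "i \<in> S \<union> T \<Longrightarrow> a i \<in> V" "i \<in> S \<union> T \<Longrightarrow> b i \<in> V" "x \<in> W \<Longrightarrow> x \<in> V"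
  using V_eq by auto

lemma V_cases:
  assumes "v \<in> V"
  obtains i where "i \<in> S \<union> T" "v = a i" | i where "i \<in> S \<union> T" "v = b i" | "v \<in> W"
  using assms V_eq by auto

definition idx :: "'v \<Rightarrow> 'i" where
  "idx v = (THE i. i \<in> S \<union> T \<and> (v = a i \<or> v = b i))"

lemma idx [simp]: assumes "i \<in> S \<union> T" shows "idx (a i) = i" "idx (b i) = i"
proof -
  show "idx (a i) = i" unfolding idx_def
    using assms ab[of i] inj by (intro the_equality) (auto dest: inj_onD)
  show "idx (b i) = i" unfolding idx_def
    using assms ab[of _ i, THEN not_sym] inj by (intro the_equality) (auto dest: inj_onD)
qed

lemma nbr_W: "\<lbrakk>x \<in> W; {x, y} \<in> E\<rbrakk> \<Longrightarrow> (\<exists>i\<in>S. y = a i) \<or> (\<exists>i\<in>T. w i = x \<and> (y = a i \<or> y = b i))"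
proof -
  assume x: "x \<in> W" and xy: "{x, y} \<in> E"
  then have yx: "{y, x} \<in> E" by (simp add: insert_commute)
  have "y \<in> V" using edge_mem xy by blast
  then show ?thesis
  proof (cases rule: V_cases)
    case (1 i)
    then show ?thesis using yx tri_a[of i x] x notW[of i] by auto
  next
    case (2 i)
    then show ?thesis using yx tri_b[of i x] leaf[of i x] x notW[of i] by auto
  next
    case 3
    then show ?thesis using x xy W_indep unfolding indep_def by blast
  qed
qed

lemma card_V: "card V = 2 * card S + 2 * card T + card W"
proof -
  have ST: "finite (S \<union> T)" "card (S \<union> T) = card S + card T" using fin disj card_Un_disjoint by auto
  have "card V = card (a ` (S \<union> T) \<union> b ` (S \<union> T)) + card W"
    unfolding V_eq using ST finite_W notW by (intro card_Un_disjoint) auto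
  also have "card (a ` (S \<union> T) \<union> b ` (S \<union> T)) = card (a ` (S \<union> T)) + card (b ` (S \<union> T))"
    using ST ab by (intro card_Un_disjoint) auto
  finally show ?thesis using inj ST by (simp add: card_image)
qed

definition q :: nat where "q = card (w ` T)"

lemma w_sub: "w ` T \<subseteq> W"
  using apex by blast

lemma q_le: "q \<le> card T" "q \<le> card W"
  unfolding q_def using fin card_image_le finite_W w_sub card_mono by blast+

lemma q_zero: "q = 0 \<longleftrightarrow> T = {}"
  unfolding q_def using fin by simp

lemma card_S_pos: "1 \<le> card S"
proof -
  have "S \<noteq> {}" using W_ne W_stem by blast
  then show ?thesis using fin by (simp add: Suc_leI card_gt_0_iff)
qed

lemma card_W_pos: "1 \<le> card W"
  using W_ne finite_W by (simp add: Suc_leI card_gt_0_iff)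

section \<open>Sizes of independent and of maximal independent sets\<close>

definition pos :: "'v \<Rightarrow> 'i" where
  "pos x = (SOME i. i \<in> T \<and> w i = x)"

lemma pos: "x \<in> w ` T \<Longrightarrow> pos x \<in> T \<and> w (pos x) = x"
proof -
  assume "x \<in> w ` T"
  then obtain i where "i \<in> T \<and> w i = x" by auto
  then show ?thesis unfolding pos_def by (rule someI)
qed

text \<open>A cover by cliques, each of which meets \<open>F\<close> at most once: the matched
  edges, where an apex \<open>x\<close> is added to the edge of \<open>pos x\<close>, and the
  unmatched vertices that are no apexes as singletons. The map \<open>g\<close> names the clique of
  a vertex.\<close>

lemma indep_card_le:
  assumes F: "F \<in> Ind E V"
  shows "card F \<le> card S + card T + (card W - q)"
proof -
  define g where "g v = (if v \<in> W then if v \<in> w ` T then Inl (pos v) else Inr v else Inl (idx v))" for v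
  have FE: "\<And>x y. \<lbrakk>x \<in> F; y \<in> F\<rbrakk> \<Longrightarrow> {x, y} \<notin> E" and FV: "F \<subseteq> V"
    using F unfolding Ind_def indep_def by auto
  have gl: "g v = Inl i \<Longrightarrow> v \<in> V \<Longrightarrow> i \<in> S \<union> T \<and> (v = a i \<or> v = b i \<or> i \<in> T \<and> v = w i)" for v i
  proof -
    assume gv: "g v = Inl i" and "v \<in> V"
    from this(2) show ?thesis
    proof (cases rule: V_cases)
      case (1 j) then show ?thesis using gv notW[of j] by (simp add: g_def)
    next
      case (2 j) then show ?thesis using gv notW[of j] by (simp add: g_def)
    next
      case 3
      then have "v \<in> w ` T" "pos v = i" using gv by (auto simp: g_def split: if_splits)
      then show ?thesis using pos[of v] by auto
    qed
  qed
  have gr: "g v = Inr x \<Longrightarrow> v = x \<and> v \<in> W - w ` T" for v x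
    by (auto simp: g_def split: if_splits)
  have inj_g: "inj_on g F"
  proof (rule inj_onI)
    fix x y assume x: "x \<in> F" and y: "y \<in> F" and eq: "g x = g y"
    show "x = y"
    proof (cases "g x")
      case (Inl i)
      then have "i \<in> S \<union> T" "x = a i \<or> x = b i \<or> i \<in> T \<and> x = w i" "y = a i \<or> y = b i \<or> i \<in> T \<and> y = w i"
        using gl[of x i] gl[of y i] eq x y FV by auto
      moreover have "{a i, b i} \<in> E" "{b i, a i} \<in> E" if "i \<in> S \<union> T"
        using matched[OF that] by (simp_all add: insert_commute)
      moreover have "{a i, w i} \<in> E" "{w i, a i} \<in> E" "{b i, w i} \<in> E" "{w i, b i} \<in> E" if "i \<in> T"
        using tri_a[OF that, of "w i"] tri_b[OF that, of "w i"] by (simp_all add: insert_commute)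
      ultimately show ?thesis using FE x y by metis
    next
      case (Inr z)
      then show ?thesis using gr[of x z] gr[of y z] eq by simp
    qed
  qed
  have sub: "g ` F \<subseteq> (S \<union> T) <+> (W - w ` T)"
  proof
    fix z assume "z \<in> g ` F"
    then obtain v where v: "v \<in> F" "z = g v" by blast
    show "z \<in> (S \<union> T) <+> (W - w ` T)"
    proof (cases z)
      case (Inl i)
      then show ?thesis using gl[of v i] v FV by auto
    next
      case (Inr x)
      then show ?thesis using gr[of v x] v by auto
    qed
  qed
  have fin': "finite ((S \<union> T) <+> (W - w ` T))" using fin finite_W by simp
  have "card F \<le> card ((S \<union> T) <+> (W - w ` T))" by (rule card_inj_on_le[OF inj_g sub fin'])
  also have "\<dots> = card S + card T + (card W - q)"
    using fin finite_W disj w_sub by (simp add: card_Plus card_Un_disjoint card_Diff_subset q_def)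
  finally show ?thesis .
qed

text \<open>The witness takes one vertex from each clique of the cover behind
  \<open>indep_card_le\<close>, always avoiding stems and apexes.\<close>

lemma indep_card_attained: "\<exists>F\<in>Ind E V. card F = card S + card T + (card W - q)"
proof -
  define F where "F = b ` S \<union> a ` T \<union> (W - w ` T)"
  have "indep E F" unfolding indep_def
  proof (intro ballI notI)
    fix x y assume x: "x \<in> F" and y: "y \<in> F" and E: "{x, y} \<in> E"
    have bS: "z \<notin> b ` S" if "z \<in> F" "{z, z'} \<in> E" "z' \<in> F" for z z'
    proof
      assume "z \<in> b ` S"
      then obtain i where i: "i \<in> S" "z = b i" by blast
      then have "a i \<in> F" using leaf[of i z'] that by simp
      then show False unfolding F_def using ab[of i] i notW[of i] disj inj by (auto dest: inj_onD)
    qed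
    have aT: "z \<notin> a ` T" if "z \<in> F" "{z, z'} \<in> E" "z' \<in> F" for z z'
    proof
      assume "z \<in> a ` T"
      then obtain i where i: "i \<in> T" "z = a i" by blast
      then have "z' = b i \<or> z' = w i" using tri_a[of i z'] that by simp
      then show False
      proof
        assume "z' = b i"
        with that(3) consider j where "j \<in> S" "b i = b j" | j where "j \<in> T" "b i = a j" | "b i \<in> W"
          unfolding F_def by auto
        then show False
        proof cases
          case (1 j)
          then have "i = j" using inj_onD[OF inj(2), of i j] i by blast
          then show False using 1 i disj by blast
        next
          case (2 j)
          then show False using ab[of j i] i by simp
        next
          case 3
          then show False using notW[of i] i by simp
        qed
      next
        assume z': "z' = w i"
        then have "z' \<in> W" "z' \<in> w ` T" using apex i by auto
        then show False using that(3) notW unfolding F_def by auto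
      qed
    qed
    have E': "{y, x} \<in> E" using E by (simp add: insert_commute)
    have "x \<in> W" "y \<in> W"
      using bS[OF x E y] aT[OF x E y] bS[OF y E' x] aT[OF y E' x] x y unfolding F_def by blast+
    then show False using W_indep E unfolding indep_def by blast
  qed
  moreover have "F \<subseteq> V" unfolding F_def V_eq by blast
  moreover have "card F = card S + card T + (card W - q)"
  proof -
    have "card F = card (b ` S \<union> a ` T) + card (W - w ` T)"
      unfolding F_def using fin finite_W notW by (intro card_Un_disjoint) auto
    moreover have "card (b ` S \<union> a ` T) = card (b ` S) + card (a ` T)"
      using fin ab by (intro card_Un_disjoint) fastforce+
    moreover have "card (b ` S) = card S" "card (a ` T) = card T"
      using inj by (auto intro!: card_image intro: inj_on_subset)
    ultimately show ?thesis using fin w_sub by (simp add: card_Diff_subset q_def)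
  qed
  ultimately show ?thesis unfolding Ind_def by blast
qed

lemma maximal_blocked:
  assumes "maximal_indep V E F" "v \<in> V" "v \<notin> F"
  shows "\<exists>y\<in>F. {v, y} \<in> E"
proof -
  have "\<not> indep E (insert v F)" "indep E F" using assms unfolding maximal_indep_def Ind_def by auto
  then show ?thesis using no_loop[of v] unfolding indep_def by (auto simp: insert_commute)
qed

text \<open>A maximal independent set meets every closed neighbourhood. Those of the leaves
  \<open>b i\<close> with \<open>i \<in> S\<close> and of one triangle vertex
  \<open>a (pos x)\<close> for each apex \<open>x\<close> are pairwise disjoint, and there are
  \<open>card S + q\<close> of them.\<close>

lemma maximal_indep_card_ge:
  assumes F: "maximal_indep V E F"
  shows "card S + q \<le> card F"
proof -
  have FV: "F \<subseteq> V" "finite F" using F finite_V finite_subset unfolding maximal_indep_def Ind_def by auto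
  have 1: "\<exists>v\<in>F. v = a i \<or> v = b i" if "i \<in> S" for i
    using maximal_blocked[OF F, of "b i"] leaf[OF that] that by auto
  have 2: "\<exists>v\<in>F. v = a (pos x) \<or> v = b (pos x) \<or> v = x" if "x \<in> w ` T" for x
  proof (cases "a (pos x) \<in> F")
    case False
    have px: "pos x \<in> T" "w (pos x) = x" using pos[OF that] by auto
    then obtain y where "y \<in> F" "{a (pos x), y} \<in> E" using maximal_blocked[OF F _ False] by auto
    then show ?thesis using tri_a[OF px(1), of y] px(2) by blast
  qed blast
  define hS where "hS i = (SOME v. v \<in> F \<and> (v = a i \<or> v = b i))" for i
  define hT where "hT x = (SOME v. v \<in> F \<and> (v = a (pos x) \<or> v = b (pos x) \<or> v = x))" for x
  define h where "h = case_sum hS hT"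
  have hl: "h (Inl i) \<in> F" "h (Inl i) = a i \<or> h (Inl i) = b i" if "i \<in> S" for i
    using someI_ex[of "\<lambda>v. v \<in> F \<and> (v = a i \<or> v = b i)"] 1[OF that] unfolding h_def hS_def by auto
  have hr: "h (Inr x) \<in> F" "h (Inr x) = a (pos x) \<or> h (Inr x) = b (pos x) \<or> h (Inr x) = x" if "x \<in> w ` T" for x
    using someI_ex[of "\<lambda>v. v \<in> F \<and> (v = a (pos x) \<or> v = b (pos x) \<or> v = x)"] 2[OF that]
    unfolding h_def hT_def by auto
  have idl: "idx (h (Inl i)) = i \<and> h (Inl i) \<notin> W" if "i \<in> S" for i
    using hl(2)[OF that] notW[of i] that by auto
  have idr: "(h (Inr x) \<in> W \<longrightarrow> h (Inr x) = x) \<and> (h (Inr x) \<notin> W \<longrightarrow> idx (h (Inr x)) = pos x)" if "x \<in> w ` T" for x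
    using hr(2)[OF that] notW[of "pos x"] pos[OF that] w_sub that by auto
  have "inj_on h (S <+> w ` T)"
  proof (rule inj_onI)
    fix y z assume y: "y \<in> S <+> w ` T" and z: "z \<in> S <+> w ` T" and eq: "h y = h z"
    show "y = z"
    proof (cases y; cases z)
      fix i j assume *: "y = Inl i" "z = Inl j"
      then show ?thesis using y z idl[of i] idl[of j] eq by auto
    next
      fix i x assume *: "y = Inl i" "z = Inr x"
      then have "i \<in> S" "x \<in> w ` T" using y z by auto
      then show ?thesis using idl[of i] idr[of x] pos[of x] eq * disj by auto
    next
      fix x i assume *: "y = Inr x" "z = Inl i"
      then have "i \<in> S" "x \<in> w ` T" using y z by auto
      then show ?thesis using idl[of i] idr[of x] pos[of x] eq * disj by auto
    next
      fix x x' assume *: "y = Inr x" "z = Inr x'"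
      then have "x \<in> w ` T" "x' \<in> w ` T" using y z by auto
      then show ?thesis using idr[of x] idr[of x'] pos[of x] pos[of x'] eq * by metis
    qed
  qed
  moreover have "h ` (S <+> w ` T) \<subseteq> F" using hl(1) hr(1) by (auto elim!: PlusE)
  ultimately have "card (S <+> w ` T) \<le> card F" using card_inj_on_le FV by blast
  then show ?thesis using fin by (simp add: card_Plus q_def)
qed

lemma maximal_indep_stems: "maximal_indep V E (a ` (S \<union> T))"
  unfolding maximal_indep_def Ind_def
proof (intro conjI CollectI ballI notI)
  show "a ` (S \<union> T) \<subseteq> V" by auto
  show "indep E (a ` (S \<union> T))" unfolding indep_def
  proof (intro ballI notI)
    fix x y assume "x \<in> a ` (S \<union> T)" "y \<in> a ` (S \<union> T)" "{x, y} \<in> E"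
    then obtain i j where ij: "i \<in> S \<union> T" "j \<in> S \<union> T" "{a i, a j} \<in> E" by blast
    then show False using stem[of i "a j"] tri_a[of i "a j"] ab[of j i] notW[of j] apex[of i] by auto
  qed
  fix v assume v: "v \<in> V - a ` (S \<union> T)" "indep E (insert v (a ` (S \<union> T)))"
  then have no: "\<And>i. i \<in> S \<union> T \<Longrightarrow> {a i, v} \<notin> E" unfolding indep_def by blast
  from v have "v \<in> V" by blast
  then show False
  proof (cases rule: V_cases)
    case (2 i) then show False using no matched by blast
  next
    case 3 then show False using no W_stem by blast
  qed (use v in blast)
qed

lemma card_stems: "card (a ` (S \<union> T)) = card S + card T"
  using inj fin disj by (simp add: card_image card_Un_disjoint)

text \<open>Serves the exceptional depth 2 in \<open>Reg\<close>. The common apex must lie in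
  \<open>F\<close>, since otherwise \<open>F\<close> would need a vertex in the stem edge and in
  each of at least two triangles. So the stem is excluded and \<open>F\<close> consists of the apex
  and the leaf \<open>b i0\<close>; any other unmatched vertex has only the stem as a neighbour and
  could be added.\<close>

lemma maximal_pair_case:
  assumes F: "maximal_indep V E F" "card F = 2" and "card S = 1" "q = 1" "2 \<le> card T"
  shows "card W = 1"
proof -
  obtain i0 where S: "S = {i0}" using assms by (auto simp: card_1_singleton_iff)
  obtain x0 where wT: "w ` T = {x0}" using \<open>q = 1\<close> unfolding q_def by (auto simp: card_1_singleton_iff)
  have x0: "x0 \<in> W" "\<And>i. i \<in> T \<Longrightarrow> w i = x0" using wT w_sub by auto
  have FV: "F \<subseteq> V" "finite F" "\<And>x y. \<lbrakk>x \<in> F; y \<in> F\<rbrakk> \<Longrightarrow> {x, y} \<notin> E"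
    using F finite_V finite_subset unfolding maximal_indep_def Ind_def indep_def by auto
  have i0: "{a i0, x0} \<in> E" using W_stem[OF x0(1)] S by auto
  have bi0: "a i0 \<in> F \<or> b i0 \<in> F"
    using maximal_blocked[OF F(1), of "b i0"] leaf[of i0] S by auto
  have x0F: "x0 \<in> F"
  proof (rule ccontr)
    assume "x0 \<notin> F"
    then have T: "\<exists>v\<in>F. v = a i \<or> v = b i" if "i \<in> T" for i
      using maximal_blocked[OF F(1), of "a i"] tri_a[OF that] x0(2)[OF that] that by auto
    have "S \<union> T \<subseteq> idx ` F"
    proof
      fix i assume i: "i \<in> S \<union> T"
      then obtain v where "v \<in> F" "v = a i \<or> v = b i" using T bi0 S by blast
      then show "i \<in> idx ` F" using idx[OF i] by (intro image_eqI[of _ _ v]) auto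
    qed
    then have "card (S \<union> T) \<le> card F" using FV(2) surj_card_le by blast
    then show False using assms fin disj by (simp add: card_Un_disjoint)
  qed
  then have "a i0 \<notin> F" using i0 FV(3) by blast
  then have "b i0 \<in> F" using bi0 by blast
  moreover have "b i0 \<noteq> x0" using notW[of i0] S x0 by blast
  ultimately have "F = {x0, b i0}" using x0F F(2) FV(2) card_seteq[of F "{x0, b i0}"] by auto
  have "y = x0" if y: "y \<in> W" for y
  proof (rule ccontr)
    assume "y \<noteq> x0"
    then have "y \<notin> F" using \<open>F = _\<close> y notW[of i0] S by blast
    then obtain z where z: "z \<in> F" "{y, z} \<in> E" using maximal_blocked[OF F(1), of y] y by auto
    then have "z = a i0" using nbr_W[OF y z(2)] S x0(2) \<open>y \<noteq> x0\<close> by auto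
    then show False using \<open>a i0 \<notin> F\<close> z by blast
  qed
  then have "W = {x0}" using x0 by blast
  then show ?thesis by simp
qed

text \<open>If every neighbour in \<open>U\<close> of some \<open>x\<close> adjacent to
  \<open>v\<close> is \<open>v\<close> or a neighbour of \<open>v\<close>, then maximal independent
  sets of \<open>U\<close> without the neighbours of \<open>v\<close>, and of
  \<open>U - {v}\<close>, are maximal in \<open>U\<close>, so the bound \<open>d\<close> is
  inherited. Such a \<open>v\<close> is a stem still joined to its leaf or, failing that, a vertex
  of a triangle. The condition on stems is the invariant that guarantees the leaf: a stem that has
  lost it is isolated.\<close>

lemma good_of_maximal:
  assumes "U \<subseteq> V"
    and "\<And>i. \<lbrakk>i \<in> S; a i \<in> U\<rbrakk> \<Longrightarrow> b i \<in> U \<or> (\<forall>u\<in>U. {u, a i} \<notin> E)"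
    and "\<And>F. maximal_indep U E F \<Longrightarrow> d \<le> card F"
  shows "good E d U"
  using assms
proof (induction "card U" arbitrary: U rule: less_induct)
  case less
  have finU: "finite U" using less.prems(1) finite_V finite_subset by blast
  show ?case
  proof (cases "indep E U")
    case True
    then have "maximal_indep U E U" unfolding maximal_indep_def Ind_def by blast
    then show ?thesis using True less.prems(3) good_indep by blast
  next
    case False
    then obtain p p' where p: "p \<in> U" "p' \<in> U" "{p, p'} \<in> E" unfolding indep_def by blast
    have step: "good E d U"
      if v: "v \<in> U" "x \<in> U" "{x, v} \<in> E" "\<And>y. \<lbrakk>y \<in> U; {x, y} \<in> E\<rbrakk> \<Longrightarrow> y = v \<or> {y, v} \<in> E"
      and K1: "\<And>i. \<lbrakk>i \<in> S; a i \<in> U - {u. {u, v} \<in> E}\<rbrakk> \<Longrightarrow>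
        b i \<in> U - {u. {u, v} \<in> E} \<or> (\<forall>u\<in>U - {u. {u, v} \<in> E}. {u, a i} \<notin> E)"
      and K2: "\<And>i. \<lbrakk>i \<in> S; a i \<in> U - {v}\<rbrakk> \<Longrightarrow> b i \<in> U - {v} \<or> (\<forall>u\<in>U - {v}. {u, a i} \<notin> E)"
    for v x
    proof (rule good_split[OF v(1)])
      let ?N = "{u. {u, v} \<in> E}"
      have vN: "v \<in> U - ?N" using v(1) no_loop by simp
      show "good E d (U - ?N)"
      proof (rule less.hyps)
        show "card (U - ?N) < card U" using v(2,3) finU by (intro psubset_card_mono) auto
        show "U - ?N \<subseteq> V" using less.prems(1) by blast
        fix F assume F: "maximal_indep (U - ?N) E F"
        have "v \<in> F"
        proof (rule ccontr)
          assume "v \<notin> F"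
          then have "\<not> indep E (insert v F)" "indep E F" "F \<subseteq> U - ?N"
            using F vN unfolding maximal_indep_def Ind_def by auto
          then show False using no_loop[of v] unfolding indep_def by (auto simp: insert_commute)
        qed
        then have "maximal_indep U E F" using F unfolding maximal_indep_def Ind_def indep_def by blast
        then show "d \<le> card F" by (rule less.prems(3))
      qed (use K1 in blast)
      show "good E d (U - {v})"
      proof (rule less.hyps)
        show "card (U - {v}) < card U" using v(1) finU by (intro psubset_card_mono) auto
        show "U - {v} \<subseteq> V" using less.prems(1) by blast
        fix F assume F: "maximal_indep (U - {v}) E F"
        then have iF: "indep E F" "F \<subseteq> U - {v}" unfolding maximal_indep_def Ind_def by auto
        have "\<exists>y\<in>F. {y, v} \<in> E"
        proof (cases "x \<in> F")
          case True then show ?thesis using v(3) by blast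
        next
          case False
          then have "\<not> indep E (insert x F)" using F v(2,3) no_loop unfolding maximal_indep_def by auto
          then obtain y where y: "y \<in> F" "{x, y} \<in> E"
            using iF(1) no_loop[of x] unfolding indep_def by (auto simp: insert_commute)
          then show ?thesis using v(4)[of y] iF(2) by blast
        qed
        then have "\<not> indep E (insert v F)" unfolding indep_def by blast
        then have "maximal_indep U E F" using F unfolding maximal_indep_def Ind_def by blast
        then show "d \<le> card F" by (rule less.prems(3))
      qed (use K2 in blast)
    qed
    show ?thesis
    proof (cases "\<exists>i\<in>S. a i \<in> U \<and> (\<exists>u\<in>U. {u, a i} \<in> E)")
      case True
      then obtain i where i: "i \<in> S" "a i \<in> U" "b i \<in> U" using less.prems(2) by blast
      show ?thesis
      proof (rule step[of "a i" "b i"])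
        show "{b i, a i} \<in> E" using leaf i by blast
        show "y = a i \<or> {y, a i} \<in> E" if "{b i, y} \<in> E" for y using leaf i that by blast
      next
        \<comment> \<open>Removing the neighbours of \<open>a i\<close> isolates \<open>a i\<close>
          and takes away no leaf except \<open>b i\<close>, so the invariant survives.\<close>
        fix j assume j: "j \<in> S" "a j \<in> U - {u. {u, a i} \<in> E}"
        show "b j \<in> U - {u. {u, a i} \<in> E} \<or> (\<forall>u\<in>U - {u. {u, a i} \<in> E}. {u, a j} \<notin> E)"
        proof (cases "j = i")
          case False
          then have "{b j, a i} \<notin> E" using leaf[OF j(1), of "a i"] inj(1) i j by (auto dest: inj_onD)
          then show ?thesis using less.prems(2)[of j] j by blast
        qed blast
      next
        fix j assume j: "j \<in> S" "a j \<in> U - {a i}"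
        then have "b j \<noteq> a i" using ab[of i j] i by auto
        then show "b j \<in> U - {a i} \<or> (\<forall>u\<in>U - {a i}. {u, a j} \<notin> E)"
          using less.prems(2)[of j] j by blast
      qed (use i in auto)
    next
      case False
      \<comment> \<open>All stems left in \<open>U\<close> are isolated, so every remaining edge
        lies in a triangle. With \<open>x\<close> a base vertex of it, the apex is shed or, if the
        apex is gone, the other base vertex.\<close>
      then have isol: "\<And>i u. \<lbrakk>i \<in> S; a i \<in> U; u \<in> U\<rbrakk> \<Longrightarrow> {u, a i} \<notin> E" by blast
      have tri: "\<exists>i\<in>T. x = a i \<or> x = b i" if x: "x \<in> U" "x \<notin> W" "y \<in> U" "{x, y} \<in> E" for x y
      proof -
        have "x \<in> V" using x less.prems(1) by blast
        then show ?thesis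
        proof (cases rule: V_cases)
          case (1 i) then show ?thesis using isol[of i y] x by (auto simp: insert_commute)
        next
          case (2 i) then show ?thesis using isol[of i x] x leaf[of i y] by (auto simp: insert_commute)
        qed (use x in blast)
      qed
      have "\<exists>x\<in>U. \<exists>y\<in>U. {x, y} \<in> E \<and> (\<exists>i\<in>T. x = a i \<or> x = b i)"
      proof (cases "p \<in> W")
        case True
        then have "p' \<notin> W" using p W_indep unfolding indep_def by blast
        then show ?thesis using tri[of p' p] p by (auto simp: insert_commute)
      next
        case False
        then show ?thesis using tri[of p p'] p by blast
      qed
      then obtain x y i where xy: "x \<in> U" "y \<in> U" "{x, y} \<in> E" and i: "i \<in> T" "x = a i \<or> x = b i" by blast
      define x' where "x' = (if x = a i then b i else a i)"
      have "b i \<noteq> a i" using ab[of i i] i by auto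
      then have nx: "{x, z} \<in> E \<longleftrightarrow> z = x' \<or> z = w i" for z
        using i tri_a[OF i(1), of z] tri_b[OF i(1), of z] unfolding x'_def by auto
      have x'w: "{x', w i} \<in> E"
        using tri_a[OF i(1), of "w i"] tri_b[OF i(1), of "w i"] unfolding x'_def by auto
      show ?thesis
      proof (cases "w i \<in> U")
        case True
        show ?thesis
          by (rule step[of "w i" x]) (use True xy nx x'w isol in auto)
      next
        case False
        then have "y = x'" using nx xy by blast
        then show ?thesis
          by (intro step[of x' x]) (use False xy nx isol in auto)
      qed
    qed
  qed
qed

lemma good_V:
  assumes "\<And>F. maximal_indep V E F \<Longrightarrow> d \<le> card F"
  shows "good E d V"
  by (rule good_of_maximal) (use assms in auto)

section \<open>Connected graphs with this structure are Cameron--Walker graphs\<close>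

lemma matching_card_le:
  assumes "matching E N"
  shows "card N \<le> card S + card T"
proof -
  \<comment> \<open>Every edge contains the stem of some \<open>i \<in> S\<close> or lies in the
    triangle of some \<open>i \<in> T\<close>. Disjoint edges can neither share a stem nor fit into
    one triangle, so a matching has at most one edge for each index.\<close>
  have hit: "\<exists>i. i \<in> S \<union> T \<and> f \<inter> {a i, b i} \<noteq> {} \<and> (i \<in> S \<longrightarrow> a i \<in> f) \<and> (i \<in> T \<longrightarrow> f \<subseteq> {a i, b i, w i})"
    if f: "f \<in> E" for f
  proof -
    obtain x y where xy: "f = {x, y}" "x \<noteq> y"
      using f graph unfolding simple_graph_def by (metis card_2_iff)
    have main: ?thesis if fx: "f = {x, y}" "x \<notin> W" for x y
    proof -
      have E: "{x, y} \<in> E" using f fx by simp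
      then have "x \<in> V" using edge_mem by blast
      then show ?thesis
      proof (cases rule: V_cases)
        case (1 i)
        then show ?thesis using tri_a[of i y] E fx by (intro exI[of _ i]) auto
      next
        case (2 i)
        then show ?thesis using tri_b[of i y] leaf[of i y] E fx by (intro exI[of _ i]) auto
      qed (use fx in blast)
    qed
    show ?thesis
    proof (cases "x \<in> W")
      case True
      then have "y \<notin> W" using W_indep f xy unfolding indep_def by blast
      then show ?thesis using main[of y x] xy by (simp add: insert_commute)
    next
      case False
      then show ?thesis using main[of x y] xy by simp
    qed
  qed
  then obtain g where g: "\<And>f. f \<in> E \<Longrightarrow> g f \<in> S \<union> T \<and> (g f \<in> S \<longrightarrow> a (g f) \<in> f)
      \<and> (g f \<in> T \<longrightarrow> f \<subseteq> {a (g f), b (g f), w (g f)})" by metis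
  have NE: "N \<subseteq> E" "\<And>e f. \<lbrakk>e \<in> N; f \<in> N; e \<noteq> f\<rbrakk> \<Longrightarrow> e \<inter> f = {}"
    using assms unfolding matching_def by auto
  have "inj_on g N"
  proof (rule inj_onI, rule ccontr)
    fix e f assume ef: "e \<in> N" "f \<in> N" "g e = g f" "e \<noteq> f"
    then have dis: "e \<inter> f = {}" and E: "e \<in> E" "f \<in> E" using NE by auto
    show False
    proof (cases "g e \<in> S")
      case True
      then show False using g[OF E(1)] g[OF E(2)] ef(3) dis by auto
    next
      case False
      let ?D = "{a (g e), b (g e), w (g e)}"
      have "e \<union> f \<subseteq> ?D" using g[OF E(1)] g[OF E(2)] ef(3) False by auto
      moreover have "card e = 2" "card f = 2" using E graph unfolding simple_graph_def by auto
      moreover from this have "card (e \<union> f) = 4"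
        using dis by (subst card_Un_disjoint) (auto intro: card_ge_0_finite)
      moreover have "card ?D \<le> 3" by (simp add: card_insert_if)
      ultimately show False using card_mono[of ?D "e \<union> f"] by auto
    qed
  qed
  moreover have "g ` N \<subseteq> S \<union> T" using g NE by blast
  ultimately have "card N \<le> card (S \<union> T)" using fin by (intro card_inj_on_le) auto
  then show ?thesis using fin disj by (simp add: card_Un_disjoint)
qed

lemma induced_matching_stems:
  "induced_matching E ((\<lambda>i. {a i, b i}) ` (S \<union> T))" "card ((\<lambda>i. {a i, b i}) ` (S \<union> T)) = card S + card T"
proof -
  let ?M = "(\<lambda>i. {a i, b i}) ` (S \<union> T)"
  have dis: "{a i, b i} \<inter> {a j, b j} = {}" if "i \<in> S \<union> T" "j \<in> S \<union> T" "i \<noteq> j" for i j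
    using that ab inj by (auto dest: inj_onD)
  have no: False if ij: "i \<in> S \<union> T" "j \<in> S \<union> T" "i \<noteq> j" and g: "g \<in> E" "g \<inter> {a i, b i} \<noteq> {}" "g \<inter> {a j, b j} \<noteq> {}" for i j g
  proof -
    obtain x y where xy: "x \<in> {a i, b i}" "y \<in> {a j, b j}" "x \<in> g" "y \<in> g" using g by blast
    then have "x \<noteq> y" using dis[OF ij] by blast
    moreover have "card g = 2" "finite g" using g graph unfolding simple_graph_def by (auto intro: card_ge_0_finite)
    ultimately have "g = {x, y}" using xy card_seteq[of g "{x, y}"] by auto
    then have E: "{x, y} \<in> E" using g by simp
    have "y \<notin> W" using notW[OF ij(2)] xy(2) by auto
    then have "y = a i \<or> y = b i"
      using ij(1) xy(1) E leaf[of i y] stem[of i y] tri_a[of i y] tri_b[of i y] apex[of i] by blast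
    then show False using dis[OF ij] xy(2) by blast
  qed
  have "?M \<subseteq> E" using matched by blast
  then show "induced_matching E ?M"
    unfolding induced_matching_def matching_def
  proof (intro conjI ballI impI notI)
    fix e f assume "e \<in> ?M" "f \<in> ?M" "e \<noteq> f"
    then obtain i j where ij: "i \<in> S \<union> T" "j \<in> S \<union> T" "i \<noteq> j" "e = {a i, b i}" "f = {a j, b j}" by auto
    then show "e \<inter> f = {}" using dis by simp
    assume "\<exists>g\<in>E. g \<inter> e \<noteq> {} \<and> g \<inter> f \<noteq> {}"
    then show False using no[OF ij(1-3)] ij(4,5) by auto
  qed auto
  have "inj_on (\<lambda>i. {a i, b i}) (S \<union> T)"
    using dis by (intro inj_onI) blast
  then show "card ?M = card S + card T" using fin disj by (simp add: card_image card_Un_disjoint)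
qed

lemma cameron_walkerI:
  assumes "connected_graph V E"
  shows "cameron_walker V E"
proof -
  have finE: "finite E" using graph finite_V unfolding simple_graph_def
    by (meson PowI finite_Pow_iff finite_subset subsetI)
  have fin1: "finite {card N | N. matching E N}"
    by (rule finite_subset[of _ "{..card S + card T}"]) (use matching_card_le in auto)
  have fin2: "finite {card N | N. induced_matching E N}"
    by (rule finite_subset[OF _ fin1]) (auto simp: induced_matching_def)
  have 1: "matching_number E = card S + card T" unfolding matching_number_def
  proof (rule Max_eqI[OF fin1])
    show "card S + card T \<in> {card N | N. matching E N}"
      using induced_matching_stems unfolding induced_matching_def
      by (intro CollectI exI[of _ "(\<lambda>i. {a i, b i}) ` (S \<union> T)"]) simp
  qed (use matching_card_le in blast)
  have 2: "induced_matching_number E = card S + card T" unfolding induced_matching_number_def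
  proof (rule Max_eqI[OF fin2])
    show "card S + card T \<in> {card N | N. induced_matching E N}"
      using induced_matching_stems
      by (intro CollectI exI[of _ "(\<lambda>i. {a i, b i}) ` (S \<union> T)"]) simp
  qed (use matching_card_le in \<open>auto simp: induced_matching_def\<close>)
  obtain i where i: "i \<in> S" using card_S_pos by fastforce
  have "\<not> is_star V E"
  proof
    assume "is_star V E"
    then obtain c where c: "E = {{c, v} | v. v \<in> V - {c}}" unfolding is_star_def by blast
    \<comment> \<open>The centre of a star lies on every edge, hence on every matched edge, but
      there are at least two of these.\<close>
    have "idx c = j" if j: "j \<in> S \<union> T" for j
    proof -
      obtain v where "{a j, b j} = {c, v}" using matched[OF j] unfolding c by blast
      then have "c = a j \<or> c = b j" by (auto simp: doubleton_eq_iff)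
      then show ?thesis using idx[OF j] by auto
    qed
    then have "S \<union> T \<subseteq> {idx c}" by blast
    then have "card (S \<union> T) \<le> 1" using card_mono[of "{idx c}"] by fastforce
    then show False using two fin disj by (simp add: card_Un_disjoint)
  qed
  moreover have "\<not> is_star_triangle V E"
  proof
    assume "is_star_triangle V E"
    then obtain c A where A: "\<And>t. t \<in> A \<Longrightarrow> card t = 3" "V = \<Union>A" "E = {e. card e = 2 \<and> (\<exists>t\<in>A. e \<subseteq> t)}"
      unfolding is_star_triangle_def by blast
    have "b i \<in> V" using i by simp
    then obtain t where t: "t \<in> A" "b i \<in> t" using A(2) by blast
    \<comment> \<open>In a star triangle the leaf \<open>b i\<close> would have two
      neighbours.\<close>
    have "t \<subseteq> {b i, a i}"
    proof
      fix x assume x: "x \<in> t"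
      show "x \<in> {b i, a i}"
      proof (cases "x = b i")
        case False
        then have "{b i, x} \<in> E" unfolding A(3) using t x by auto
        then show ?thesis using leaf[OF i] by simp
      qed simp
    qed
    then have "card t \<le> card {b i, a i}" by (intro card_mono) auto
    also have "\<dots> \<le> 2" by (simp add: card_insert_if)
    finally show False using A(1)[OF t(1)] by simp
  qed
  ultimately show ?thesis unfolding cameron_walker_def using graph assms 1 2 by simp
qed

end

section \<open>Every Cameron--Walker graph has the structure\<close>

lemma connected_closed:
  assumes "connected_graph V E" "u \<in> U" "u \<in> V" "\<And>x y. \<lbrakk>x \<in> U; {x, y} \<in> E\<rbrakk> \<Longrightarrow> y \<in> U"
  shows "V \<subseteq> U"
proof
  fix v assume "v \<in> V"
  then have "(u, v) \<in> {(x, y). {x, y} \<in> E}\<^sup>*" using assms unfolding connected_graph_def by blast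
  then show "v \<in> U" by (induction rule: rtrancl_induct) (use assms in auto)
qed

lemma matching_insert:
  assumes "matching E N" "e \<in> E" "\<And>f. f \<in> N \<Longrightarrow> e \<inter> f = {}"
  shows "matching E (insert e N)"
  unfolding matching_def
proof (intro conjI ballI impI)
  show "insert e N \<subseteq> E" using assms unfolding matching_def by blast
  fix f g assume fg: "f \<in> insert e N" "g \<in> insert e N" "f \<noteq> g"
  show "f \<inter> g = {}"
  proof (cases "f \<in> N \<and> g \<in> N")
    case True
    then show ?thesis using assms(1) fg unfolding matching_def by blast
  next
    case False
    then show ?thesis using assms(3)[of f] assms(3)[of g] fg by auto
  qed
qed

text \<open>An edge of \<open>M\<close> whose endpoints had distinct unmatched neighbours could be replaced by two
  edges, contradicting the maximality of \<open>M\<close> among all matchings.\<close>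

lemma cameron_walker_structure:
  fixes V :: "'v set"
  assumes "cameron_walker V E"
  shows "\<exists>a b w S T W. cw_structure V E a b w S (T :: 'v set set) W"
proof -
  have graph: "simple_graph V E" and conn: "connected_graph V E"
    and eq: "matching_number E = induced_matching_number E"
    and nostar: "\<not> is_star V E" and notri: "\<not> is_star_triangle V E"
    using assms unfolding cameron_walker_def by auto
  have finV: "finite V" and E2: "\<And>e. e \<in> E \<Longrightarrow> e \<subseteq> V \<and> card e = 2"
    using graph unfolding simple_graph_def by auto
  have finE: "finite E" by (rule finite_subset[of _ "Pow V"]) (use E2 finV in auto)
  have pair: "\<exists>x y. e = {x, y} \<and> x \<noteq> y" if "e \<in> E" for e
    using E2[OF that] by (auto simp: card_2_iff)
  have neq: "x \<noteq> y" if "{x, y} \<in> E" for x y using E2[OF that] by auto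
  have mem: "x \<in> V" "y \<in> V" if "{x, y} \<in> E" for x y using E2[OF that] by auto
  have finN: "finite N" if "matching E N" for N
    using that finE finite_subset unfolding matching_def by blast
  have fin1: "finite {card N | N. matching E N}"
    by (rule finite_subset[of _ "{..card E}"]) (use finE card_mono in \<open>auto simp: matching_def\<close>)
  have fin2: "finite {card N | N. induced_matching E N}"
    by (rule finite_subset[OF _ fin1]) (auto simp: induced_matching_def)
  have "induced_matching E {}" by (simp add: induced_matching_def matching_def)
  then have "{card N | N. induced_matching E N} \<noteq> {}" by blast
  then have "induced_matching_number E \<in> {card N | N. induced_matching E N}"
    unfolding induced_matching_number_def using Max_in fin2 by blast
  then obtain M where M: "induced_matching E M" "card M = matching_number E" using eq by auto
  then have MM: "matching E M" unfolding induced_matching_def by blast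
  have max: "card N \<le> card M" if "matching E N" for N
    using that M(2) Max_ge[OF fin1, of "card N"] unfolding matching_number_def by auto
  have ME: "M \<subseteq> E" and dis: "\<And>e f. \<lbrakk>e \<in> M; f \<in> M; e \<noteq> f\<rbrakk> \<Longrightarrow> e \<inter> f = {}"
    using MM unfolding matching_def by auto
  have finM: "finite M" by (rule finN[OF MM])
  have F3: False if "e \<in> M" "f \<in> M" "e \<noteq> f" "x \<in> e" "y \<in> f" "{x, y} \<in> E" for e f x y
  proof -
    have "{x, y} \<inter> e \<noteq> {}" "{x, y} \<inter> f \<noteq> {}" using that(4,5) by auto
    then have "\<exists>g\<in>E. g \<inter> e \<noteq> {} \<and> g \<inter> f \<noteq> {}" by (intro bexI[OF _ that(6)] conjI)
    moreover have "\<not> (\<exists>g\<in>E. g \<inter> e \<noteq> {} \<and> g \<inter> f \<noteq> {})"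
      using M(1) that(1-3) unfolding induced_matching_def by simp
    ultimately show False by (rule notE[rotated])
  qed
  define W where "W = V - \<Union>M"
  have W: "W \<subseteq> V" "\<And>x e. \<lbrakk>x \<in> W; e \<in> M\<rbrakk> \<Longrightarrow> x \<notin> e" unfolding W_def by blast+
  \<comment> \<open>An edge between unmatched vertices would enlarge the maximum matching.\<close>
  have F1: "{x, y} \<notin> E" if xy: "x \<in> W" "y \<in> W" for x y
  proof
    assume E: "{x, y} \<in> E"
    have "matching E (insert {x, y} M)"
      using W(2)[OF xy(1)] W(2)[OF xy(2)] by (intro matching_insert[OF MM E]) auto
    moreover have "{x, y} \<notin> M" using W(2)[OF xy(1)] by auto
    ultimately show False using max[of "insert {x, y} M"] finM by simp
  qed
  have F2: "x = y" if e: "{p, p'} \<in> M" "x \<in> W" "y \<in> W" "{p, x} \<in> E" "{p', y} \<in> E" for p p' x y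
  proof (rule ccontr)
    assume "x \<noteq> y"
    let ?N = "insert {p, x} (insert {p', y} (M - {{p, p'}}))"
    have pp: "p \<noteq> p'" using neq e(1) ME by blast
    have p: "p \<notin> W" "p' \<notin> W" using W(2) e(1) by auto
    have off: "p \<notin> f" "p' \<notin> f" "x \<notin> f" "y \<notin> f" if "f \<in> M - {{p, p'}}" for f
      using dis[of f "{p, p'}"] that e W(2) by auto
    have "{p, x} \<inter> {p', y} = {}" using pp p e \<open>x \<noteq> y\<close> by auto
    moreover have "matching E (M - {{p, p'}})" using ME dis unfolding matching_def by blast
    ultimately have "matching E ?N" using e(4,5) off by (intro matching_insert) auto
    moreover have "card ?N = card M + 1"
    proof -
      have "{p', y} \<notin> M - {{p, p'}}" "{p, x} \<notin> insert {p', y} (M - {{p, p'}})"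
        using off \<open>{p, x} \<inter> {p', y} = {}\<close> by auto
      then have "card ?N = Suc (Suc (card (M - {{p, p'}})))" using finM by simp
      then show ?thesis using card_Suc_Diff1[OF finM e(1)] by linarith
    qed
    ultimately show False using max by fastforce
  qed
  define tri where "tri e a b x \<longleftrightarrow> e = {a, b} \<and> x \<in> W \<and> {a, x} \<in> E \<and> {b, x} \<in> E" for e a b x
  define T where "T = {e \<in> M. \<exists>a b x. tri e a b x}"
  define S where "S = M - T"
  \<comment> \<open>By \<open>F2\<close>, an edge of \<open>M\<close> both of whose ends have
    unmatched neighbours is in \<open>T\<close>. In the remaining edges the end without such
    neighbours is named \<open>b\<close>; it will be the leaf.\<close>
  have "\<exists>a b x. e = {a, b} \<and> (e \<in> T \<longrightarrow> tri e a b x) \<and> (e \<in> S \<longrightarrow> (\<forall>y\<in>W. {b, y} \<notin> E))" if eM: "e \<in> M" for e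
  proof (cases "e \<in> T")
    case True
    then obtain a b x where "tri e a b x" unfolding T_def by auto
    moreover from this have "e = {a, b}" unfolding tri_def by simp
    moreover have "e \<notin> S" using True unfolding S_def by simp
    ultimately show ?thesis by (intro exI[of _ a] exI[of _ b] exI[of _ x] conjI impI) simp_all
  next
    case False
    obtain p p' where p: "e = {p, p'}" using pair[of e] eM ME by auto
    show ?thesis
    proof (cases "\<exists>x\<in>W. {p, x} \<in> E")
      case True
      then obtain x where x: "x \<in> W" "{p, x} \<in> E" by blast
      have "{p', y} \<notin> E" if "y \<in> W" for y
      proof
        assume y: "{p', y} \<in> E"
        then have "x = y" using F2[of p p' x y] x p that \<open>e \<in> M\<close> by auto
        then show False using False x y p \<open>e \<in> M\<close> unfolding T_def tri_def by blast
      qed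
      then show ?thesis using p False by (intro exI[of _ p] exI[of _ p'] exI[of _ x] conjI impI) simp_all
    next
      case F: False
      then show ?thesis
        using p False by (intro exI[of _ p'] exI[of _ p] exI[of _ p] conjI impI) (auto simp: insert_commute)
    qed
  qed
  then obtain a b w where abw: "\<And>e. e \<in> M \<Longrightarrow> e = {a e, b e}"
    "\<And>e. e \<in> T \<Longrightarrow> tri e (a e) (b e) (w e)" "\<And>e y. \<lbrakk>e \<in> S; y \<in> W\<rbrakk> \<Longrightarrow> {b e, y} \<notin> E"
  proof -
    assume *: "\<And>a b w. \<lbrakk>\<And>e. e \<in> M \<Longrightarrow> e = {a e, b e}; \<And>e. e \<in> T \<Longrightarrow> tri e (a e) (b e) (w e);
      \<And>e y. \<lbrakk>e \<in> S; y \<in> W\<rbrakk> \<Longrightarrow> {b e, y} \<notin> E\<rbrakk> \<Longrightarrow> thesis"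
    assume "\<And>e. e \<in> M \<Longrightarrow> \<exists>a b x. e = {a, b} \<and> (e \<in> T \<longrightarrow> tri e a b x) \<and> (e \<in> S \<longrightarrow> (\<forall>y\<in>W. {b, y} \<notin> E))"
    then obtain a b w where "\<And>e. e \<in> M \<Longrightarrow> e = {a e, b e} \<and> (e \<in> T \<longrightarrow> tri e (a e) (b e) (w e))
        \<and> (e \<in> S \<longrightarrow> (\<forall>y\<in>W. {b e, y} \<notin> E))" by metis
    moreover have "T \<subseteq> M" "S \<subseteq> M" unfolding S_def T_def by auto
    ultimately show thesis by (intro *[of a b w]) blast+
  qed
  have ST: "S \<union> T = M" "S \<inter> T = {}" unfolding S_def T_def by auto
  have abE: "{a e, b e} \<in> E" "a e \<noteq> b e" "a e \<in> e" "b e \<in> e" if "e \<in> M" for e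
    using abw(1)[OF that] ME that neq[of "a e" "b e"] by auto
  have mem_e: "x = a e \<or> x = b e" if "e \<in> M" "x \<in> e" for e x
    using that(2) by (subst (asm) abw(1)[OF that(1)]) auto
  have same: "e = f" if "e \<in> M" "f \<in> M" "x \<in> e" "x \<in> f" for e f x
    using dis that by blast
  have V_eq: "V = a ` (S \<union> T) \<union> b ` (S \<union> T) \<union> W"
  proof -
    have "\<Union>M = a ` M \<union> b ` M" using abw(1) by auto
    moreover have "\<Union>M \<subseteq> V" using ME E2 by blast
    ultimately show ?thesis unfolding ST W_def by blast
  qed
  have apex: "w e \<in> W" "{a e, w e} \<in> E" "{b e, w e} \<in> E" if "e \<in> T" for e
    using abw(2)[OF that] unfolding tri_def by auto
  have nbr: "y \<in> W \<or> y \<in> e" if "e \<in> M" "x \<in> e" "{x, y} \<in> E" for e x y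
  proof (rule ccontr)
    assume no: "\<not> (y \<in> W \<or> y \<in> e)"
    have "y \<in> V" using mem that by blast
    then obtain f where "f \<in> M" "y \<in> f" using no unfolding W_def by blast
    then show False using F3[of e f x y] that no by blast
  qed
  have apex_a: "y = w e" if "e \<in> T" "y \<in> W" "{a e, y} \<in> E" for e y
    using F2[of "a e" "b e" y "w e"] apex[OF that(1)] abw(1)[of e] that ST by auto
  have apex_b: "y = w e" if "e \<in> T" "y \<in> W" "{b e, y} \<in> E" for e y
    using F2[of "b e" "a e" y "w e"] apex[OF that(1)] abw(1)[of e] that ST by (auto simp: insert_commute)
  have leaf: "{b e, x} \<in> E \<longleftrightarrow> x = a e" if "e \<in> S" for e x
  proof
    assume E: "{b e, x} \<in> E"
    have e: "e \<in> M" using that ST by blast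
    have "x \<notin> W" using abw(3)[OF that] E by blast
    then have "x \<in> e" using nbr[OF e abE(4)[OF e] E] by blast
    then show "x = a e" using mem_e[OF e, of x] neq[OF E] by auto
  qed (use abE[of e] that ST in \<open>auto simp: insert_commute\<close>)
  have stem: "x = b e \<or> x \<in> W" if "e \<in> S" "{a e, x} \<in> E" for e x
  proof -
    have e: "e \<in> M" using that ST by blast
    show ?thesis using nbr[OF e abE(3)[OF e] that(2)] mem_e[OF e, of x] neq[OF that(2)] by auto
  qed
  have tri_a: "{a e, x} \<in> E \<longleftrightarrow> x = b e \<or> x = w e" if "e \<in> T" for e x
  proof
    assume E: "{a e, x} \<in> E"
    have e: "e \<in> M" using that ST by blast
    show "x = b e \<or> x = w e"
      using nbr[OF e abE(3)[OF e] E] mem_e[OF e, of x] neq[OF E] apex_a[OF that _ E] by auto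
  qed (use abE[of e] apex[OF that] that ST in auto)
  have tri_b: "{b e, x} \<in> E \<longleftrightarrow> x = a e \<or> x = w e" if "e \<in> T" for e x
  proof
    assume E: "{b e, x} \<in> E"
    have e: "e \<in> M" using that ST by blast
    show "x = a e \<or> x = w e"
      using nbr[OF e abE(4)[OF e] E] mem_e[OF e, of x] neq[OF E] apex_b[OF that _ E] by auto
  qed (use abE[of e] apex[OF that] that ST in \<open>auto simp: insert_commute\<close>)
  have Vne: "V \<noteq> {}" using conn unfolding connected_graph_def by blast
  have M_ne: "M \<noteq> {}"
  proof
    assume "M = {}"
    have "E = {}"
    proof (rule ccontr)
      assume "E \<noteq> {}"
      then obtain e where "e \<in> E" by blast
      then have "matching E {e}" by (simp add: matching_def)
      then show False using max[of "{e}"] \<open>M = {}\<close> by simp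
    qed
    obtain v where v: "v \<in> V" using Vne by blast
    have "V \<subseteq> {v}" using connected_closed[OF conn, of v "{v}"] v \<open>E = {}\<close> by blast
    then have "is_star V E" unfolding is_star_def using v \<open>E = {}\<close> by blast
    then show False using nostar by blast
  qed
  \<comment> \<open>Without unmatched vertices each edge of \<open>M\<close> is closed under
    adjacency, so the graph would be a single edge, which is a star.\<close>
  have W_ne: "W \<noteq> {}"
  proof
    assume "W = {}"
    obtain e where e: "e \<in> M" using M_ne by blast
    have Ve: "V \<subseteq> e" using nbr[OF e] \<open>W = {}\<close> abE(3)[OF e] mem(1)[OF abE(1)[OF e]]
      by (intro connected_closed[OF conn, of "a e"]) auto
    have "e \<subseteq> V" using E2 ME e by blast
    then have V: "V = {a e, b e}" using Ve abw(1)[OF e] by blast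
    have "E = {{a e, b e}}"
    proof (intro equalityI subsetI)
      fix f assume f: "f \<in> E"
      then have "f \<subseteq> V" "card f = card V" using E2 V abE(2)[OF e] by auto
      then show "f \<in> {{a e, b e}}" using V card_subset_eq[OF finV] by auto
    qed (use abE[OF e] in auto)
    then have "is_star V E" unfolding is_star_def V using abE(2)[OF e] by (intro bexI[of _ "a e"]) auto
    then show False using nostar by blast
  qed
  have W_stem: "\<exists>e\<in>S. {a e, x} \<in> E" if x: "x \<in> W" for x
  proof (rule ccontr)
    assume no: "\<not> (\<exists>e\<in>S. {a e, x} \<in> E)"
    \<comment> \<open>The vertex \<open>x\<close> with all triangles at it. If no stem is adjacent
      to \<open>x\<close>, this set is closed under adjacency and the whole graph is a star
      triangle.\<close>
    define U where "U = insert x (\<Union>{e \<in> T. w e = x})"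
    have "V \<subseteq> U"
    proof (rule connected_closed[OF conn])
      show "x \<in> U" "x \<in> V" using x W unfolding U_def by auto
      fix y z assume y: "y \<in> U" and yz: "{y, z} \<in> E"
      show "z \<in> U"
      proof (cases "y = x")
        case True
        have "z \<in> V" "z \<notin> W" using mem[OF yz] F1[OF x, of z] yz True by auto
        then obtain e where e: "e \<in> M" "z \<in> e" unfolding W_def by blast
        have zx: "{z, x} \<in> E" using yz True by (simp add: insert_commute)
        have "z = a e \<or> z = b e" using abw(1)[OF e(1)] e(2) by auto
        have "e \<notin> S"
          using no zx leaf[of e x] \<open>z = a e \<or> z = b e\<close> W(2)[OF x e(1)] abE(3)[OF e(1)] by auto
        then have "e \<in> T" using e ST by blast
        then have "w e = x" using apex_a[of e x] apex_b[of e x] zx x \<open>z = a e \<or> z = b e\<close> by auto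
        then show ?thesis using \<open>e \<in> T\<close> e unfolding U_def by blast
      next
        case False
        then obtain e where e: "e \<in> T" "w e = x" "y \<in> e" using y unfolding U_def by blast
        then have eM: "e \<in> M" using ST by blast
        then have "y = a e \<or> y = b e" using abw(1)[OF eM] e(3) by auto
        then have "z = a e \<or> z = b e \<or> z = x" using tri_a[OF e(1), of z] tri_b[OF e(1), of z] yz e(2) by auto
        then show ?thesis using e abE[OF eM] unfolding U_def by blast
      qed
    qed
    have "M \<subseteq> T" "\<And>e. e \<in> M \<Longrightarrow> w e = x"
    proof -
      have *: "e \<in> T \<and> w e = x" if e: "e \<in> M" for e
      proof -
        have "a e \<in> V" "a e \<noteq> x" using mem(1)[OF abE(1)[OF e]] W(2)[OF x e] abE(3)[OF e] by auto
        then obtain f where f: "f \<in> T" "w f = x" "a e \<in> f" using \<open>V \<subseteq> U\<close> unfolding U_def by blast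
        then have "e = f" using same[of e f "a e"] e abE(3)[OF e] ST by blast
        then show ?thesis using f by blast
      qed
      show "M \<subseteq> T" using * by blast
      show "w e = x" if "e \<in> M" for e using * that by blast
    qed
    then have MT: "M = T" and wx: "\<And>e. e \<in> M \<Longrightarrow> w e = x" using ST by auto
    have UM: "V = insert x (\<Union>M)" using \<open>V \<subseteq> U\<close> x W E2 ME unfolding U_def MT by blast
    have xe: "x \<notin> e" if "e \<in> M" for e using W(2)[OF x that] .
    have "is_star_triangle V E" unfolding is_star_triangle_def
    proof (intro exI[of _ x] exI[of _ "insert x ` M"] conjI)
      show "insert x ` M \<noteq> {}" using M_ne by blast
      show "\<forall>t\<in>insert x ` M. card t = 3 \<and> x \<in> t"
      proof
        fix t assume "t \<in> insert x ` M"
        then obtain e where e: "e \<in> M" "t = insert x e" by blast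
        then have "card e = 2" "finite e" using E2[of e] ME finite_subset[OF _ finV] by auto
        then show "card t = 3 \<and> x \<in> t" using xe e by simp
      qed
      show "\<forall>s\<in>insert x ` M. \<forall>t\<in>insert x ` M. s \<noteq> t \<longrightarrow> s \<inter> t = {x}"
        using dis by fastforce
      show "V = \<Union> (insert x ` M)" using UM M_ne by auto
      show "E = {e. card e = 2 \<and> (\<exists>t\<in>insert x ` M. e \<subseteq> t)}"
      proof (intro equalityI subsetI)
        fix f assume f: "f \<in> E"
        then obtain y z where yz: "f = {y, z}" "y \<noteq> z" using pair[of f] by auto
        have main: "\<exists>t\<in>insert x ` M. f \<subseteq> t" if yz': "f = {y, z}" "y \<noteq> x" for y z
        proof -
          have E: "{y, z} \<in> E" using f yz' by simp
          then obtain e where e: "e \<in> M" "y \<in> e" using mem[OF E] UM yz' by auto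
          have "z \<in> W \<or> z \<in> e" using nbr[OF e E] .
          then have "z \<in> insert x e" using UM unfolding W_def by blast
          then have "f \<subseteq> insert x e" using e(2) yz'(1) by simp
          then show ?thesis using e(1) by (intro bexI[of _ "insert x e"]) auto
        qed
        show "f \<in> {e. card e = 2 \<and> (\<exists>t\<in>insert x ` M. e \<subseteq> t)}"
        proof (cases "y = x")
          case True
          then show ?thesis using main[of z y] yz f E2 by (auto simp: insert_commute)
        next
          case False
          then show ?thesis using main[of y z] yz f E2 by auto
        qed
      next
        fix f assume "f \<in> {e. card e = 2 \<and> (\<exists>t\<in>insert x ` M. e \<subseteq> t)}"
        then obtain e where e: "card f = 2" "e \<in> M" "f \<subseteq> {x, a e, b e}" using abw(1) by fastforce
        then have eT: "e \<in> T" using MT by blast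
        obtain y z where yz: "f = {y, z}" "y \<noteq> z" using e(1) by (auto simp: card_2_iff)
        have "{a e, b e} \<in> E" "{a e, x} \<in> E" "{b e, x} \<in> E"
          using abE[OF e(2)] apex[OF eT] wx[OF e(2)] by auto
        then show "f \<in> E" using e(3) yz by (auto simp: insert_commute)
      qed
    qed
    then show False using notri by blast
  qed
  \<comment> \<open>A single matched edge must, by \<open>W_stem\<close>, have its stem adjacent to
    all of \<open>W\<close>, and this graph is a star.\<close>
  have two: "2 \<le> card S + card T"
  proof (rule ccontr)
    assume "\<not> 2 \<le> card S + card T"
    moreover have "card M = card S + card T"
      using ST finM card_Un_disjoint[of S T] by (metis finite_Un)
    moreover have "0 < card M" using M_ne finM by (simp add: card_gt_0_iff)
    ultimately have "card M = 1" by linarith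
    then obtain e where e: "M = {e}" by (auto simp: card_1_singleton_iff)
    obtain x where "x \<in> W" using W_ne by blast
    then obtain i where "i \<in> S" using W_stem by blast
    then have "i = e" using ST(1) e by blast
    then have S: "S = {e}" "T = {}" using \<open>i \<in> S\<close> ST e by blast+
    have Vae: "V = {a e, b e} \<union> W" using V_eq S by auto
    have "E = {{a e, v} | v. v \<in> V - {a e}}"
    proof (intro equalityI subsetI)
      fix f assume f: "f \<in> E"
      then obtain y z where yz: "f = {y, z}" "y \<noteq> z" using pair[of f] by auto
      have main: "f \<in> {{a e, v} | v. v \<in> V - {a e}}" if fy: "f = {y, z}" "y \<notin> W" for y z
      proof -
        have E: "{y, z} \<in> E" using f fy by simp
        then have "y = a e \<or> y = b e" using mem[OF E] Vae fy(2) by blast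
        then show ?thesis
        proof
          assume "y = a e"
          then show ?thesis using fy(1) mem(2)[OF E] neq[OF E] by (intro CollectI exI[of _ z]) auto
        next
          assume y: "y = b e"
          then have "z = a e" using leaf[of e z] S E by simp
          then show ?thesis
            using y fy(1) mem(1)[OF E] neq[OF E] by (intro CollectI exI[of _ y]) (simp add: insert_commute)
        qed
      qed
      show "f \<in> {{a e, v} | v. v \<in> V - {a e}}"
      proof (cases "y \<in> W")
        case True
        then have "z \<notin> W" using F1[of y z] f yz by blast
        then show ?thesis using main[of z y] yz by (simp add: insert_commute)
      next
        case False
        then show ?thesis using main[of y z] yz by simp
      qed
    next
      fix f assume "f \<in> {{a e, v} | v. v \<in> V - {a e}}"
      then obtain v where v: "f = {a e, v}" "v = b e \<or> v \<in> W" using Vae by auto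
      then show "f \<in> E" using W_stem[of v] abE(1)[of e] e S by auto
    qed
    then have "is_star V E" unfolding is_star_def using Vae by blast
    then show False using nostar by blast
  qed
  have "cw_structure V E a b w S T W"
  proof
    show "finite S" "finite T" using ST finM by (metis finite_Un)+
    show "inj_on a (S \<union> T)" unfolding ST
    proof (rule inj_onI)
      fix e f assume "e \<in> M" "f \<in> M" "a e = a f"
      then show "e = f" using same[of e f "a e"] abE(3)[of e] abE(3)[of f] by simp
    qed
    show "inj_on b (S \<union> T)" unfolding ST
    proof (rule inj_onI)
      fix e f assume "e \<in> M" "f \<in> M" "b e = b f"
      then show "e = f" using same[of e f "b e"] abE(4)[of e] abE(4)[of f] by simp
    qed
    fix i j assume ij: "i \<in> S \<union> T" "j \<in> S \<union> T"
    show "a i \<noteq> b j"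
    proof
      assume "a i = b j"
      then have "i = j" using same[of i j "a i"] ij ST abE(3)[of i] abE(4)[of j] by simp
      then show False using \<open>a i = b j\<close> abE(2)[of i] ij ST by simp
    qed
  next
    fix i assume "i \<in> S \<union> T"
    then have i: "i \<in> M" using ST by simp
    show "a i \<notin> W \<and> b i \<notin> W" using W(2)[OF _ i] abE(3,4)[OF i] by blast
  next
    show "indep E W" unfolding indep_def using F1 by blast
  qed (use graph ST V_eq leaf stem tri_a tri_b apex W_stem W_ne two in blast)+
  then show ?thesis by (intro exI)
qed

section \<open>The pairs of depth and dimension\<close>

text \<open>Here \<open>x\<close> is the depth and \<open>y\<close> the dimension. With the
  parameters of the overview, \<open>2 * y + x - n \<ge> s + (p - q) \<ge> 1\<close>, and
  \<open>2 * x + 1 \<le> n\<close> because \<open>x \<le> s + t\<close> and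
  \<open>p \<ge> 1\<close>. For \<open>x = 2\<close> one has \<open>s + q = 2\<close>, and the three
  alternatives come, in this order, from \<open>s = t = 1\<close>, from \<open>s = 2, t = 0\<close>,
  and from \<open>s = q = p = 1\<close> with \<open>t \<ge> 2\<close>.\<close>

definition Reg :: "nat \<Rightarrow> (nat \<times> nat) set" where
  "Reg n = {(x, y). 2 \<le> x \<and> x \<le> y \<and> x + y \<le> n \<and> n + 1 \<le> 2 * y + x \<and> 2 * x + 1 \<le> n \<and>
     (x = 2 \<longrightarrow> y + 3 = n \<or> y + 2 = n \<or> 2 * y + 1 = n)}"

lemma (in cw_structure) minimal_maximal_indep:
  obtains F where "maximal_indep V E F" "\<And>F'. maximal_indep V E F' \<Longrightarrow> card F \<le> card F'"
  using ex_has_least_nat[of "maximal_indep V E" _ card, OF maximal_indep_stems] by auto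

lemma (in cw_structure) Reg_mem:
  assumes F: "maximal_indep V E F" "\<And>F'. maximal_indep V E F' \<Longrightarrow> card F \<le> card F'"
  shows "(card F, card S + card T + (card W - q)) \<in> Reg (card V)"
proof -
  have lower: "card S + q \<le> card F" using maximal_indep_card_ge[OF F(1)] .
  have upper: "card F \<le> card S + card T" using F(2)[OF maximal_indep_stems] card_stems by simp
  have "F \<in> Ind E V" using F(1) unfolding maximal_indep_def by blast
  then have le: "card F \<le> card S + card T + (card W - q)" by (rule indep_card_le)
  have T0: "q = 0 \<longleftrightarrow> card T = 0" using q_zero fin by simp
  obtain e where e: "card W = q + e" using q_le(2) le_Suc_ex by blast
  have "2 \<le> card S + q" using T0 two card_S_pos by linarith
  then have "2 \<le> card F" using lower by linarith
  moreover have "card F \<le> card S + card T + e" using le e by simp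
  moreover have "card F + (card S + card T + e) \<le> card V" "2 * card F + 1 \<le> card V"
    using upper lower card_V e card_W_pos card_S_pos by linarith+
  moreover have "card V + 1 \<le> 2 * (card S + card T + e) + card F"
  proof -
    have "1 + q \<le> card F" using lower card_S_pos by (rule order_trans[OF add_right_mono, rotated])
    then show ?thesis unfolding card_V e by simp
  qed
  moreover have "card S + card T + e + 3 = card V \<or> card S + card T + e + 2 = card V
      \<or> 2 * (card S + card T + e) + 1 = card V" if F2: "card F = 2"
  proof (cases "q = 0")
    case True
    then have "card T = 0" "card S = 2" using T0 two lower F2 by linarith+
    then show ?thesis using True card_V e by simp
  next
    case False
    then have S1: "card S = 1" "q = 1" using lower card_S_pos F2 by linarith+
    show ?thesis
    proof (cases "2 \<le> card T")
      case True
      then have "card W = 1" using maximal_pair_case[OF F(1) F2 S1] by simp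
      then show ?thesis using S1 card_V e by simp
    next
      case False
      then have "card T = 1" using S1 T0 by linarith
      then show ?thesis using S1 card_V e by simp
    qed
  qed
  ultimately show ?thesis unfolding Reg_def using e by simp
qed

lemma maximal_indepI:
  assumes "indep E F" "F \<subseteq> V" "\<And>v. v \<in> V - F \<Longrightarrow> \<exists>y\<in>F. {v, y} \<in> E"
  shows "maximal_indep V E F"
  unfolding maximal_indep_def Ind_def
proof (intro conjI CollectI ballI notI)
  fix v assume "v \<in> V - F" "indep E (insert v F)"
  then show False using assms(3)[of v] unfolding indep_def by blast
qed (use assms in auto)

lemma cw_depth_dim:
  fixes V :: "'v::linorder set" and a b w :: "'i \<Rightarrow> 'v"
  assumes "cw_structure V E a b w S T W"
    and F: "maximal_indep V E F" "\<And>F'. maximal_indep V E F' \<Longrightarrow> card F \<le> card F'"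
  shows "graph_depth TYPE('k::field) V E = enat (card F)"
    and "graph_dim TYPE('k) V E = enat (card S + card T + (card W - card (w ` T)))"
proof -
  interpret cw_structure V E a b w S T W by fact
  interpret edge_ring V "TYPE('k)" E
    by unfold_locales (use finite_V graph in auto)
  show "graph_depth TYPE('k) V E = enat (card F)"
    by (rule graph_depth_eq[OF good_V[OF F(2)] F(1)]) simp_all
  obtain F0 where "F0 \<in> Ind E V" "card F0 = card S + card T + (card W - q)" using indep_card_attained by blast
  then show "graph_dim TYPE('k) V E = enat (card S + card T + (card W - card (w ` T)))"
    using graph_dim_eq[OF indep_card_le] unfolding q_def by blast
qed

text \<open>Stems \<open>0..<m\<close> and \<open>m..<m+t\<close> with partners shifted by \<open>m+t\<close>; the first \<open>r\<close> of the remaining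
  \<open>p\<close> vertices are the apexes of triangles. If \<open>r < p\<close>, then the only stem next to them is \<open>0\<close>, so
  that they, the leaf at \<open>0\<close> and the stems \<open>1..<m\<close> form a small maximal independent set.\<close>

context
  fixes m t r p :: nat
  assumes m: "1 \<le> m" and p: "1 \<le> p" and r: "r \<le> t" "r \<le> p" "r = 0 \<longleftrightarrow> t = 0" and mt: "2 \<le> m + t"
begin

definition cwk where "cwk = m + t"
definition cwW where "cwW = {2 * cwk..<2 * cwk + p}"
definition cwb where "cwb i = cwk + i"
text \<open>The first \<open>r\<close> triangles get different apexes; all later ones share the last
  apex.\<close>

definition cww where "cww i = 2 * cwk + min (i - m) (r - 1)"
definition cwadj where "cwadj i z \<longleftrightarrow> i < m \<and> z \<in> cwW \<and> (z < 2 * cwk + r \<and> r < p \<longrightarrow> i = 0)"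
definition cwV where "cwV = {0..<2 * cwk + p}"
definition cwE where "cwE = {{i, cwb i} | i. i < cwk} \<union> {{i, cww i} | i. i \<in> {m..<cwk}}
  \<union> {{cwb i, cww i} | i. i \<in> {m..<cwk}} \<union> {{i, z} | i z. cwadj i z}"

lemmas cw_defs = cwW_def cwb_def cww_def cwadj_def cwV_def

lemma cww_mem: "i \<in> {m..<cwk} \<Longrightarrow> cww i \<in> cwW"
  using p r unfolding cw_defs by auto

lemma cww_image: "cww ` {m..<cwk} = {2 * cwk..<2 * cwk + r}"
proof
  show "cww ` {m..<cwk} \<subseteq> {2 * cwk..<2 * cwk + r}" using r unfolding cww_def cwk_def by auto
  show "{2 * cwk..<2 * cwk + r} \<subseteq> cww ` {m..<cwk}"
  proof
    fix z assume z: "z \<in> {2 * cwk..<2 * cwk + r}"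
    then have "z = cww (m + (z - 2 * cwk))" "m + (z - 2 * cwk) \<in> {m..<cwk}" using r unfolding cww_def cwk_def by auto
    then show "z \<in> cww ` {m..<cwk}" by blast
  qed
qed

lemma cw_edge_iff: "{x, y} \<in> cwE \<longleftrightarrow>
   (x < cwk \<and> y = cwb x) \<or> (y < cwk \<and> x = cwb y) \<or> (x \<in> {m..<cwk} \<and> y = cww x) \<or> (y \<in> {m..<cwk} \<and> x = cww y)
   \<or> (\<exists>i\<in>{m..<cwk}. (x = cwb i \<and> y = cww i) \<or> (y = cwb i \<and> x = cww i)) \<or> cwadj x y \<or> cwadj y x"
  unfolding cwE_def by (auto simp: doubleton_eq_iff)

lemma cw_edge_small: "{x, y} \<in> cwE \<Longrightarrow> x < 2 * cwk \<or> y < 2 * cwk"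
  unfolding cw_edge_iff cwb_def cwadj_def cwk_def by auto

lemma cwadj_bounds: "cwadj i z \<Longrightarrow> i < m \<and> i < cwk \<and> 2 * cwk \<le> z \<and> z < 2 * cwk + p"
  unfolding cwadj_def cwW_def cwk_def by auto

lemma cww_bounds: "i \<in> {m..<cwk} \<Longrightarrow> 2 * cwk \<le> cww i \<and> cww i < 2 * cwk + p"
  using cww_mem unfolding cwW_def by simp

lemma cw_simps:
  "i < cwk \<Longrightarrow> cwk + i \<noteq> cww j" "i < cwk \<Longrightarrow> i \<noteq> cww j"
  "i < cwk \<Longrightarrow> \<not> cwadj j (cwk + i)" "i < cwk \<Longrightarrow> \<not> cwadj j i"
  "\<not> cwadj (cwk + i) j" "m \<le> i \<Longrightarrow> \<not> cwadj i j"
  by (auto simp: cww_def dest: cwadj_bounds)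

lemma cw_structure_realization: "cw_structure cwV cwE id cwb cww {0..<m} {m..<cwk} cwW"
proof
  have W: "x \<in> cwW \<Longrightarrow> 2 * cwk \<le> x \<and> x < 2 * cwk + p" for x unfolding cwW_def by simp
  have nW: "cwadj i z \<Longrightarrow> i < m \<and> z \<in> cwW" for i z unfolding cwadj_def by simp
  have mk: "m \<le> cwk" unfolding cwk_def by simp
  show "simple_graph cwV cwE" unfolding simple_graph_def
  proof (intro conjI ballI)
    show "finite cwV" unfolding cwV_def by simp
    fix e assume "e \<in> cwE"
    then consider i where "i < cwk" "e = {i, cwb i}" | i where "i \<in> {m..<cwk}" "e = {i, cww i}"
      | i where "i \<in> {m..<cwk}" "e = {cwb i, cww i}" | i z where "cwadj i z" "e = {i, z}"
      unfolding cwE_def by blast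
    then have "e \<subseteq> cwV \<and> card e = 2"
    proof cases
      case (2 i)
      then show ?thesis using cww_bounds[of i] by (simp add: cwV_def)
    next
      case (3 i)
      then show ?thesis using cww_bounds[of i] by (simp add: cwV_def cwb_def)
    next
      case (4 i z)
      then show ?thesis using cwadj_bounds[of i z] by (simp add: cwV_def)
    qed (simp add: cwV_def cwb_def)
    then show "e \<subseteq> cwV" "card e = 2" by simp_all
  qed
  show "finite {0..<m}" "finite {m..<cwk}" "{0..<m} \<inter> {m..<cwk} = {}" by auto
  have ST: "{0..<m} \<union> {m..<cwk} = {0..<cwk}" using mk by auto
  show "inj_on id ({0..<m} \<union> {m..<cwk})" "inj_on cwb ({0..<m} \<union> {m..<cwk})" by (auto simp: inj_on_def cwb_def)
  show "cwV = id ` ({0..<m} \<union> {m..<cwk}) \<union> cwb ` ({0..<m} \<union> {m..<cwk}) \<union> cwW"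
  proof -
    have "cwb ` {0..<cwk} = {cwk..<2 * cwk}"
      using image_add_atLeastLessThan[of cwk 0 cwk] unfolding cwb_def by (simp add: mult_2)
    then show ?thesis unfolding ST cwV_def cwW_def by auto
  qed
  show "id i \<noteq> cwb j" if "i \<in> {0..<m} \<union> {m..<cwk}" "j \<in> {0..<m} \<union> {m..<cwk}" for i j
    using that mk by (auto simp: cwb_def)
  show "id i \<notin> cwW \<and> cwb i \<notin> cwW" if "i \<in> {0..<m} \<union> {m..<cwk}" for i
    using that mk by (auto simp: cwb_def cwW_def)
  show "{cwb i, x} \<in> cwE \<longleftrightarrow> x = id i" if "i \<in> {0..<m}" for i x
    using that mk by (auto simp: cw_edge_iff cwb_def cw_simps)
  show "x = cwb i \<or> x \<in> cwW" if "i \<in> {0..<m}" "{id i, x} \<in> cwE" for i x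
    using that mk nW by (auto simp: cw_edge_iff cwb_def cw_simps)
  show "{id i, x} \<in> cwE \<longleftrightarrow> x = cwb i \<or> x = cww i" if "i \<in> {m..<cwk}" for i x
    using that mk by (auto simp: cw_edge_iff cwb_def cw_simps)
  show "{cwb i, x} \<in> cwE \<longleftrightarrow> x = id i \<or> x = cww i" if "i \<in> {m..<cwk}" for i x
    using that mk by (auto simp: cw_edge_iff cwb_def cw_simps)
  show "cww i \<in> cwW" if "i \<in> {m..<cwk}" for i using cww_mem[OF that] .
  show "indep cwE cwW"
    unfolding indep_def using cw_edge_small W by (meson leD)
  show "\<exists>i\<in>{0..<m}. {id i, x} \<in> cwE" if "x \<in> cwW" for x
    using that m by (intro bexI[of _ 0]) (auto simp: cw_edge_iff cwadj_def)
  show "cwW \<noteq> {}" using p unfolding cwW_def by simp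
  show "2 \<le> card {0..<m} + card {m..<cwk}" using mt unfolding cwk_def by simp
qed

interpretation S: cw_structure cwV cwE id cwb cww "{0..<m}" "{m..<cwk}" cwW
  by (rule cw_structure_realization)

lemma cw_connected: "connected_graph cwV cwE"
proof -
  let ?r = "{(x, y). {x, y} \<in> cwE}\<^sup>*"
  \<comment> \<open>The last unmatched vertex is adjacent to every stem: it is an apex only if
    \<open>r = p\<close>, and then all stems are joined to all of \<open>cwW\<close>.\<close>
  let ?z = "2 * cwk + p - 1"
  have sym: "(x, y) \<in> ?r \<Longrightarrow> (y, x) \<in> ?r" for x y
  proof -
    have "sym {(x, y). {x, y} \<in> cwE}" by (auto simp: sym_def insert_commute)
    then show "(x, y) \<in> ?r \<Longrightarrow> (y, x) \<in> ?r" using sym_rtrancl by (meson symD)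
  qed
  have step: "{x, y} \<in> cwE \<Longrightarrow> (y, z) \<in> ?r \<Longrightarrow> (x, z) \<in> ?r" for x y z
    by (rule converse_rtrancl_into_rtrancl) auto
  have stem: "(i, ?z) \<in> ?r" if "i < m" for i
  proof -
    have "cwadj i ?z" using that p r(2) unfolding cwadj_def cwW_def by auto
    then show ?thesis by (intro r_into_rtrancl) (simp add: cw_edge_iff)
  qed
  have W: "(x, ?z) \<in> ?r" if x: "x \<in> cwW" for x
  proof -
    obtain i where "i < m" "{i, x} \<in> cwE" using S.W_stem[OF x] by auto
    then show ?thesis using step[of x i] stem by (simp add: insert_commute)
  qed
  have "(x, ?z) \<in> ?r" if "x \<in> cwV" for x
    using that
  proof (cases rule: S.V_cases)
    case (1 i)
    then show ?thesis using stem[of i] S.tri_a[of i "cww i"] step[of i "cww i"] W[OF S.apex, of i] by auto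
  next
    case (2 i)
    then show ?thesis
      using stem[of i] S.leaf[of i i] S.tri_b[of i "cww i"] step[of "cwb i" i] step[of "cwb i" "cww i"] W[OF S.apex, of i]
      by auto
  next
    case 3
    then show ?thesis by (rule W)
  qed
  then have "(x, y) \<in> ?r" if "x \<in> cwV" "y \<in> cwV" for x y
    using that sym by (meson rtrancl_trans)
  moreover have "cwV \<noteq> {}" using p unfolding cwV_def by simp
  ultimately show ?thesis unfolding connected_graph_def by blast
qed

text \<open>If \<open>r = t\<close>, the stems already have the right number. If
  \<open>r = p\<close>, all unmatched vertices are apexes and serve together with the leaves. In the
  third case a second stem is needed to dominate the unmatched vertices that are no apexes, whence
  \<open>2 \<le> m\<close>.\<close>

lemma cw_small_maximal_indep:
  assumes "r = t \<or> r = p \<or> 2 \<le> m"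
  shows "\<exists>F. maximal_indep cwV cwE F \<and> card F = m + r"
proof -
  have W: "x \<in> cwW \<Longrightarrow> 2 * cwk \<le> x \<and> x < 2 * cwk + p" for x unfolding cwW_def by simp
  have nW: "cwadj i z \<Longrightarrow> i < m \<and> z \<in> cwW" for i z unfolding cwadj_def by simp
  have mk: "m \<le> cwk" unfolding cwk_def by simp
  have ww: "i \<in> {m..<cwk} \<Longrightarrow> cww i \<in> {2 * cwk..<2 * cwk + r}" for i using cww_image by blast
  consider "r = t" | "r = p" | "r < t" "r < p" "2 \<le> m" using assms r by linarith
  then show ?thesis
  proof cases
    case 1
    show ?thesis
    proof (intro exI conjI)
      show "maximal_indep cwV cwE (id ` ({0..<m} \<union> {m..<cwk}))" by (rule S.maximal_indep_stems)
      show "card (id ` ({0..<m} \<union> {m..<cwk})) = m + r" unfolding S.card_stems using 1 by (simp add: cwk_def)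
    qed
  next
    case 2
    define F where "F = {2 * cwk..<2 * cwk + r} \<union> {cwk..<cwk + m}"
    have "indep cwE F"
      unfolding indep_def F_def cw_edge_iff cwb_def using W nW mk ww by fastforce
    moreover have "F \<subseteq> cwV" unfolding F_def cwV_def using 2 mk by auto
    moreover have "\<exists>y\<in>F. {v, y} \<in> cwE" if v: "v \<in> cwV - F" for v
    proof -
      have "v \<in> cwV" using v by blast
      then show ?thesis
      proof (cases rule: S.V_cases)
        case (1 i)
        show ?thesis
        proof (cases "i < m")
          case True
          then show ?thesis using 1 mk by (intro bexI[of _ "cwb i"]) (auto simp: F_def cwb_def cw_edge_iff)
        next
          case False
          then show ?thesis using 1 ww[of i] by (intro bexI[of _ "cww i"]) (auto simp: F_def cw_edge_iff)
        qed
      next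
        case (2 i)
        then have "\<not> i < m" using v unfolding F_def cwb_def by auto
        then show ?thesis using 2 ww[of i] by (intro bexI[of _ "cww i"]) (auto simp: F_def cw_edge_iff)
      next
        case 3
        then show ?thesis using v 2 W[of v] unfolding F_def by auto
      qed
    qed
    moreover have "card F = m + r" unfolding F_def using mk by (subst card_Un_disjoint) auto
    ultimately show ?thesis using maximal_indepI by metis
  next
    case 3
    \<comment> \<open>The vertex \<open>cwk\<close> is the leaf of the stem
      \<open>0\<close>.\<close>
    define F where "F = insert cwk ({2 * cwk..<2 * cwk + r} \<union> {1..<m})"
    have no: False if xy: "x \<in> F" "y \<in> F" "{x, y} \<in> cwE" "x \<notin> cwW" for x y
    proof (cases "x = cwk")
      case True
      then have "y = 0" using S.leaf[of 0 y] xy(3) m by (simp add: cwb_def)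
      then show False using xy(2) m mk unfolding F_def by auto
    next
      case False
      then have x: "1 \<le> x" "x < m" using xy 3 unfolding F_def cwW_def by auto
      then have "y = cwk + x \<or> cwadj x y"
        using xy(3) mk by (auto simp: cw_edge_iff cwb_def cw_simps)
      then show False using x xy(2) mk 3(2) unfolding F_def cwadj_def cwW_def by auto
    qed
    have "indep cwE F"
      unfolding indep_def
    proof (intro ballI notI)
      fix x y assume "x \<in> F" "y \<in> F" "{x, y} \<in> cwE"
      then show False
        using no[of x y] no[of y x] S.W_indep unfolding indep_def by (auto simp: insert_commute)
    qed
    moreover have "F \<subseteq> cwV" unfolding F_def cwV_def using 3 mk by auto
    moreover have "\<exists>y\<in>F. {v, y} \<in> cwE" if v: "v \<in> cwV - F" for v
    proof -
      have "v \<in> cwV" using v by blast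
      then show ?thesis
      proof (cases rule: S.V_cases)
        case (1 i)
        show ?thesis
        proof (cases "i < m")
          case True
          then have "i = 0" using v 1 unfolding F_def by auto
          then show ?thesis using 1 mk m by (intro bexI[of _ cwk]) (auto simp: F_def cwb_def cw_edge_iff)
        next
          case False
          then show ?thesis using 1 ww[of i] by (intro bexI[of _ "cww i"]) (auto simp: F_def cw_edge_iff)
        qed
      next
        case (2 i)
        show ?thesis
        proof (cases "i < m")
          case True
          then have "i \<noteq> 0" using v 2 unfolding F_def cwb_def by auto
          then show ?thesis using 2 True mk by (intro bexI[of _ i]) (auto simp: F_def cw_edge_iff)
        next
          case False
          then show ?thesis using 2 ww[of i] by (intro bexI[of _ "cww i"]) (auto simp: F_def cw_edge_iff)
        qed
      next
        case z: 3
        then have "cwadj 1 v" using v 3 W[of v] unfolding F_def cwadj_def by auto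
        then show ?thesis using 3 by (intro bexI[of _ 1]) (auto simp: F_def cw_edge_iff)
      qed
    qed
    moreover have "card F = m + r"
    proof -
      have "card ({2 * cwk..<2 * cwk + r} \<union> {1..<m}) = r + (m - 1)" using mk by (subst card_Un_disjoint) auto
      moreover have "cwk \<notin> {2 * cwk..<2 * cwk + r} \<union> {1..<m}" using mk m by auto
      ultimately show ?thesis unfolding F_def using m by simp
    qed
    ultimately show ?thesis using maximal_indepI by metis
  qed
qed

lemma cw_realization:
  assumes "r = t \<or> r = p \<or> 2 \<le> m"
  shows "\<exists>(V :: nat set) E. cameron_walker V E \<and> card V = 2 * m + 2 * t + p \<and>
    graph_depth TYPE('k::field) V E = enat (m + r) \<and> graph_dim TYPE('k) V E = enat (m + t + (p - r))"
proof -
  obtain F where F: "maximal_indep cwV cwE F" "card F = m + r" using cw_small_maximal_indep[OF assms] by blast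
  have q: "card (cww ` {m..<cwk}) = r" unfolding cww_image by simp
  have min: "card F \<le> card F'" if "maximal_indep cwV cwE F'" for F'
    using S.maximal_indep_card_ge[OF that] F(2) q unfolding S.q_def by simp
  have "cameron_walker cwV cwE" using S.cameron_walkerI[OF cw_connected] .
  moreover have "card cwV = 2 * m + 2 * t + p" unfolding cwV_def cwk_def by simp
  ultimately show ?thesis
    using cw_depth_dim[OF cw_structure_realization F(1) min, where 'k = 'k] F(2) q
    by (intro exI[of _ cwV] exI[of _ cwE]) (auto simp: cwW_def cwk_def)
qed

end

text \<open>The three equations give \<open>t = n - x - y\<close>, and they determine
  \<open>r\<close> and \<open>p\<close> from \<open>m\<close>, so that \<open>m\<close> is the only
  choice.\<close>

lemma Reg_parameters:
  assumes "(x, y) \<in> Reg n"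
  shows "\<exists>m t r p. 1 \<le> m \<and> 1 \<le> p \<and> r \<le> t \<and> r \<le> p \<and> (r = 0 \<longleftrightarrow> t = 0) \<and> 2 \<le> m + t \<and>
    (r = t \<or> r = p \<or> 2 \<le> m) \<and> n = 2 * m + 2 * t + p \<and> x = m + r \<and> y = m + t + (p - r)"
proof -
  have R: "2 \<le> x" "x \<le> y" "x + y \<le> n" "n + 1 \<le> 2 * y + x" "2 * x + 1 \<le> n"
    "x = 2 \<longrightarrow> y + 3 = n \<or> y + 2 = n \<or> 2 * y + 1 = n"
    using assms unfolding Reg_def by auto
  define t where "t = n - x - y"
  \<comment> \<open>For \<open>t = 0\<close> also \<open>r = 0\<close>, and for \<open>t < x\<close>
    one can take \<open>r = t\<close>. Otherwise \<open>p - r = x + 2 * y - n - m\<close> must not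
    be negative: this permits \<open>m = 2\<close> unless \<open>x + 2 * y = n + 1\<close>, where
    \<open>m = 1\<close> gives \<open>r = p\<close>. The condition in \<open>Reg\<close> for
    \<open>x = 2\<close> rules out \<open>m = 2\<close> with \<open>r = 0\<close> and
    \<open>t > 0\<close>.\<close>
  define m where "m = (if t = 0 then x else if t < x then x - t else if x + 2 * y = n + 1 then 1 else 2)"
  define r where "r = x - m"
  define p where "p = 2 * x + 2 * y - n - 2 * m"
  have t: "n = t + x + y" using R unfolding t_def by simp
  have mx: "m \<le> x" "1 \<le> m" using R unfolding m_def by auto
  have m': "2 * m + n + 1 \<le> 2 * x + 2 * y" "x - m \<le> t" "m + n \<le> x + 2 * y" "x - m = 0 \<longleftrightarrow> t = 0"
    using R t unfolding m_def by (auto split: if_splits)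
  have cases: "x - m = t \<or> m + n = x + 2 * y \<or> 2 \<le> m" using R t unfolding m_def by auto
  have r: "x = m + r" using mx unfolding r_def by simp
  have p: "p + n + 2 * m = 2 * x + 2 * y" using m'(1) unfolding p_def by simp
  have rt: "r \<le> t" "r = 0 \<longleftrightarrow> t = 0" using m' unfolding r_def by auto
  have rp: "r \<le> p" using r p m'(3) by linarith
  have "r = t \<or> r = p \<or> 2 \<le> m" using cases r p by (elim disjE) linarith+
  moreover have "y = m + t + (p - r)" "n = 2 * m + 2 * t + p" "2 \<le> m + t" "1 \<le> p"
    using rp r p t rt R(1) m'(1) by linarith+
  ultimately show ?thesis using mx(2) r rt rp
    by (intro exI[of _ m] exI[of _ t] exI[of _ r] exI[of _ p] conjI)
qed

theorem CW_depth_dim_eq: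
  "CW_depth_dim TYPE('k::field) (int n) = map_prod enat enat ` Reg n"
proof
  show "CW_depth_dim TYPE('k) (int n) \<subseteq> map_prod enat enat ` Reg n"
  proof
    fix z assume "z \<in> CW_depth_dim TYPE('k) (int n)"
    then obtain V :: "nat set" and E where z: "z = (graph_depth TYPE('k) V E, graph_dim TYPE('k) V E)"
      "cameron_walker V E" "card V = n" unfolding CW_depth_dim_def by auto
    obtain a b w S and T :: "nat set set" and W where cw: "cw_structure V E a b w S T W"
      using cameron_walker_structure[OF z(2)] by blast
    obtain F where F: "maximal_indep V E F" "\<And>F'. maximal_indep V E F' \<Longrightarrow> card F \<le> card F'"
      using cw_structure.minimal_maximal_indep[OF cw] by blast
    have "(card F, card S + card T + (card W - card (w ` T))) \<in> Reg n"
      using cw_structure.Reg_mem[OF cw F] z(3) unfolding cw_structure.q_def[OF cw] by simp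
    then show "z \<in> map_prod enat enat ` Reg n"
      by (rule rev_image_eqI) (simp add: z(1) cw_depth_dim[OF cw F])
  qed
  show "map_prod enat enat ` Reg n \<subseteq> CW_depth_dim TYPE('k) (int n)"
  proof clarify
    fix x y assume "(x, y) \<in> Reg n"
    then obtain m t r p where *: "1 \<le> m" "1 \<le> p" "r \<le> t" "r \<le> p" "r = 0 \<longleftrightarrow> t = 0" "2 \<le> m + t"
      "r = t \<or> r = p \<or> 2 \<le> m" "n = 2 * m + 2 * t + p" "x = m + r" "y = m + t + (p - r)"
      using Reg_parameters[of x y n] by (elim meta_impE exE conjE) (assumption, rule that, assumption+)
    show "(enat x, enat y) \<in> CW_depth_dim TYPE('k) (int n)"
    proof -
      obtain V :: "nat set" and E where "cameron_walker V E" "card V = n"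
        "graph_depth TYPE('k) V E = enat x" "graph_dim TYPE('k) V E = enat y"
        using cw_realization[OF *(1-7), where 'k = 'k] unfolding *(8-10) by auto
      then show ?thesis
        unfolding CW_depth_dim_def by (intro CollectI exI[of _ V] exI[of _ E]) simp
    qed
  qed
qed

section \<open>Counting\<close>

lemma square_div_4:
  "(2 * y)\<^sup>2 div 4 = (y::nat)\<^sup>2" "(2 * y + 1)\<^sup>2 div 4 = y\<^sup>2 + y"
proof -
  show "(2 * y)\<^sup>2 div 4 = y\<^sup>2" by (simp add: power_mult_distrib)
  have "(2 * y + 1)\<^sup>2 = 1 + (y\<^sup>2 + y) * 4" by (simp add: power2_eq_square algebra_simps)
  then show "(2 * y + 1)\<^sup>2 div 4 = y\<^sup>2 + y" by simp
qed

lemma square_div_4_Suc: "(Suc y)\<^sup>2 div 4 = y\<^sup>2 div 4 + Suc y div 2"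
proof (cases "even y")
  case True
  then obtain j where "y = 2 * j" by blast
  then show ?thesis using square_div_4[of j] by simp
next
  case False
  then obtain j where "y = 2 * j + 1" by (elim oddE)
  then have y: "y = 2 * j + 1" "Suc y = 2 * Suc j" by simp_all
  show ?thesis unfolding y(2) square_div_4(1) unfolding y(1) square_div_4(2) by (simp add: power2_eq_square)
qed

text \<open>Telescopes: by \<open>square_div_4_Suc\<close> each summand is a difference of
  consecutive values of \<open>y\<^sup>2 div 4\<close>.\<close>

lemma sum_half:
  assumes "2 \<le> A" "A \<le> n"
  shows "(\<Sum>x\<in>{3..A}. int ((n + 1 - x) div 2)) = int ((n - 2)\<^sup>2 div 4) - int ((n - A)\<^sup>2 div 4)"
  using assms
proof (induction A rule: dec_induct)
  case (step A)
  have "n - A = Suc (n - Suc A)" using step by simp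
  then have "(n - A)\<^sup>2 div 4 = (n - Suc A)\<^sup>2 div 4 + (n - A) div 2" using square_div_4_Suc by metis
  moreover have "{3..Suc A} = insert (Suc A) {3..A}" using step by auto
  ultimately show ?case using step by simp
qed simp

lemma sum_linear:
  assumes "a \<le> b"
  shows "(\<Sum>x\<in>{Suc a..b}. int n + 1 - 2 * int x) = (int b - int a) * (int n - int a - int b)"
  using assms
proof (induction b rule: dec_induct)
  case (step b)
  have "{Suc a..Suc b} = insert (Suc b) {Suc a..b}" using step by auto
  then show ?case using step by (simp add: algebra_simps)
qed simp

lemma finite_Reg: "finite (Reg n)"
  by (rule finite_subset[of _ "{..n} \<times> {..n}"]) (auto simp: Reg_def)

text \<open>Row 2 has two points and a third one for odd \<open>n\<close>, distinct from the others
  as \<open>6 \<le> n\<close>. The rows from 3 to \<open>b\<close> end at \<open>n - x\<close>; they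
  start at \<open>(n + 2 - x) div 2\<close> as long as \<open>3 * x \<le> n + 2\<close>, that is
  \<open>x \<le> a\<close>, and at \<open>x\<close> afterwards. Their lengths are accordingly
  \<open>(n + 1 - x) div 2\<close> and \<open>n + 1 - 2 * x\<close>.\<close>

lemma card_Reg:
  assumes n: "6 \<le> n"
  defines "a \<equiv> (n + 2) div 3" and "b \<equiv> (n - 1) div 2"
  shows "int (card (Reg n)) = 2 + (if odd n then 1 else 0) + int ((n - 2)\<^sup>2 div 4) - int ((n - a)\<^sup>2 div 4)
    + (int b - int a) * (int n - int a - int b)"
proof -
  define A where "A = {2::nat} \<times> ({n - 3, n - 2} \<union> (if odd n then {(n - 1) div 2} else {}))"
  define L where "L x = max x ((n + 2 - x) div 2)" for x
  define B where "B = (SIGMA x:{3..b}. {L x..n - x})"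
  have Reg: "Reg n = A \<union> B"
  proof (intro equalityI subrelI)
    fix x y assume xy: "(x, y) \<in> Reg n"
    show "(x, y) \<in> A \<union> B"
    proof (cases "x = 2")
      case True
      then have "y + 3 = n \<or> y + 2 = n \<or> 2 * y + 1 = n" using xy unfolding Reg_def by simp
      then have "y = n - 3 \<or> y = n - 2 \<or> odd n \<and> y = (n - 1) div 2" by (elim disjE) auto
      then show ?thesis using True unfolding A_def by auto
    next
      case False
      then have "x \<in> {3..b}" "x \<le> y" "(n + 2 - x) div 2 \<le> y" "y \<le> n - x"
        using xy unfolding Reg_def b_def by auto
      then show ?thesis unfolding B_def L_def by simp
    qed
  next
    fix x y assume "(x, y) \<in> A \<union> B"
    then consider "(x, y) \<in> A" | "(x, y) \<in> B" by blast
    then show "(x, y) \<in> Reg n"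
    proof cases
      case 1
      then have "x = 2" "y = n - 3 \<or> y = n - 2 \<or> odd n \<and> y = (n - 1) div 2" unfolding A_def by (auto split: if_splits)
      moreover from this(2) have "y + 3 = n \<or> y + 2 = n \<or> 2 * y + 1 = n" using n by (elim disjE) auto
      ultimately show ?thesis using n unfolding Reg_def by auto
    next
      case 2
      then have *: "3 \<le> x" "x \<le> b" "x \<le> y" "(n + 2 - x) div 2 \<le> y" "y \<le> n - x" unfolding B_def L_def by auto
      then have "2 * x + 1 \<le> n" unfolding b_def by linarith
      moreover have "n + 1 \<le> 2 * y + x" using *(4) by linarith
      ultimately show ?thesis using * unfolding Reg_def by auto
    qed
  qed
  have "A \<inter> B = {}" "finite A" "finite B" unfolding A_def B_def by auto
  then have "int (card (Reg n)) = int (card A) + int (card B)" unfolding Reg by (simp add: card_Un_disjoint)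
  moreover have "int (card A) = 2 + (if odd n then 1 else 0)"
  proof -
    define c where "c = (n - 1) div 2"
    have "c \<noteq> n - 3" "c \<noteq> n - 2" if "odd n" using n that unfolding c_def by presburger+
    moreover have "n - 3 \<noteq> n - 2" using n by simp
    ultimately show ?thesis
      unfolding A_def card_cartesian_product c_def[symmetric] by (cases "odd n") (auto simp: card_insert_if)
  qed
  moreover have "int (card B) = int ((n - 2)\<^sup>2 div 4) - int ((n - a)\<^sup>2 div 4)
    + (int b - int a) * (int n - int a - int b)"
  proof -
    have ab: "2 \<le> a" "a \<le> b" "a \<le> n" "2 * b \<le> n" using n unfolding a_def b_def by linarith+
    have "card B = (\<Sum>x\<in>{3..b}. Suc (n - x) - L x)" unfolding B_def by simp
    then have "int (card B) = (\<Sum>x\<in>{3..b}. int (Suc (n - x) - L x))" by simp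
    also have "{3..b} = {3..a} \<union> {Suc a..b}" using ab by auto
    also have "(\<Sum>x\<in>{3..a} \<union> {Suc a..b}. int (Suc (n - x) - L x))
        = (\<Sum>x\<in>{3..a}. int (Suc (n - x) - L x)) + (\<Sum>x\<in>{Suc a..b}. int (Suc (n - x) - L x))"
      by (rule sum.union_disjoint) auto
    also have "(\<Sum>x\<in>{3..a}. int (Suc (n - x) - L x)) = (\<Sum>x\<in>{3..a}. int ((n + 1 - x) div 2))"
    proof (rule sum.cong)
      fix x assume "x \<in> {3..a}"
      then have "3 * x \<le> n + 2" unfolding a_def by auto
      then have "L x = (n + 2 - x) div 2" unfolding L_def by simp
      moreover have "x \<le> n" using \<open>3 * x \<le> n + 2\<close> n by linarith
      ultimately show "int (Suc (n - x) - L x) = int ((n + 1 - x) div 2)" by linarith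
    qed simp
    also have "(\<Sum>x\<in>{Suc a..b}. int (Suc (n - x) - L x)) = (\<Sum>x\<in>{Suc a..b}. int n + 1 - 2 * int x)"
    proof (rule sum.cong)
      fix x assume x: "x \<in> {Suc a..b}"
      then have "n + 2 < 3 * x" unfolding a_def by auto
      then have "L x = x" unfolding L_def by simp
      moreover have "2 * x \<le> n" using x ab by auto
      ultimately show "int (Suc (n - x) - L x) = int n + 1 - 2 * int x" by simp
    qed simp
    finally show ?thesis using sum_half[OF ab(1,3)] sum_linear[OF ab(2), of n] by simp
  qed
  ultimately show ?thesis by simp
qed

text \<open>In a fixed residue class the numbers \<open>a\<close>, \<open>b\<close>,
  \<open>n - 2\<close> and \<open>n - a\<close> of \<open>card_Reg\<close> are linear in
  \<open>j\<close> with known parity, so that \<open>square_div_4\<close> removes the divisions. The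
  shift \<open>k = j + 1\<close> avoids subtraction of naturals.\<close>

lemma card_Reg_mod_6:
  defines "N \<equiv> \<lambda>j. int (card (Reg j))"
  shows "N (6 * j + 6) = 6 * (int j + 1)\<^sup>2 - 6 * (int j + 1) + 2"
    "N (6 * j + 7) = 6 * (int j + 1)\<^sup>2 - 4 * (int j + 1) + 3"
    "N (6 * j + 8) = 6 * (int j + 1)\<^sup>2 - 2 * (int j + 1) + 1"
    "N (6 * j + 9) = 6 * (int j + 1)\<^sup>2 + 2"
    "N (6 * j + 10) = 6 * (int j + 1)\<^sup>2 + 2 * (int j + 1) + 1"
    "N (6 * j + 11) = 6 * (int j + 1)\<^sup>2 + 4 * (int j + 1) + 3"
proof -
  have eq: "N n = 2 + (if odd n then 1 else 0) + int (c\<^sup>2 div 4) - int (d\<^sup>2 div 4) + (int b - int a) * (int n - int a - int b)"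
    if "6 \<le> n" "(n + 2) div 3 = a" "(n - 1) div 2 = b" "n - 2 = c" "n - a = d" for n a b c d
    using card_Reg[OF that(1)] that unfolding N_def by simp
  have "N (6 * j + 6) = 2 + (if odd (6 * j + 6) then 1 else 0) + int ((2 * (3 * j + 2))\<^sup>2 div 4) - int ((2 * (2 * j + 2))\<^sup>2 div 4)
      + (int (3 * j + 2) - int (2 * j + 2)) * (int (6 * j + 6) - int (2 * j + 2) - int (3 * j + 2))"
    by (rule eq) auto
  then show "N (6 * j + 6) = 6 * (int j + 1)\<^sup>2 - 6 * (int j + 1) + 2"
    unfolding square_div_4 by (simp add: power2_eq_square algebra_simps)
  have "N (6 * j + 7) = 2 + (if odd (6 * j + 7) then 1 else 0) + int ((2 * (3 * j + 2) + 1)\<^sup>2 div 4) - int ((2 * (2 * j + 2))\<^sup>2 div 4)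
      + (int (3 * j + 3) - int (2 * j + 3)) * (int (6 * j + 7) - int (2 * j + 3) - int (3 * j + 3))"
    by (rule eq) auto
  then show "N (6 * j + 7) = 6 * (int j + 1)\<^sup>2 - 4 * (int j + 1) + 3"
    unfolding square_div_4 by (simp add: power2_eq_square algebra_simps)
  have "N (6 * j + 8) = 2 + (if odd (6 * j + 8) then 1 else 0) + int ((2 * (3 * j + 3))\<^sup>2 div 4) - int ((2 * (2 * j + 2) + 1)\<^sup>2 div 4)
      + (int (3 * j + 3) - int (2 * j + 3)) * (int (6 * j + 8) - int (2 * j + 3) - int (3 * j + 3))"
    by (rule eq) auto
  then show "N (6 * j + 8) = 6 * (int j + 1)\<^sup>2 - 2 * (int j + 1) + 1"
    unfolding square_div_4 by (simp add: power2_eq_square algebra_simps)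
  have "N (6 * j + 9) = 2 + (if odd (6 * j + 9) then 1 else 0) + int ((2 * (3 * j + 3) + 1)\<^sup>2 div 4) - int ((2 * (2 * j + 3))\<^sup>2 div 4)
      + (int (3 * j + 4) - int (2 * j + 3)) * (int (6 * j + 9) - int (2 * j + 3) - int (3 * j + 4))"
    by (rule eq) auto
  then show "N (6 * j + 9) = 6 * (int j + 1)\<^sup>2 + 2"
    unfolding square_div_4 by (simp add: power2_eq_square algebra_simps)
  have "N (6 * j + 10) = 2 + (if odd (6 * j + 10) then 1 else 0) + int ((2 * (3 * j + 4))\<^sup>2 div 4) - int ((2 * (2 * j + 3))\<^sup>2 div 4)
      + (int (3 * j + 4) - int (2 * j + 4)) * (int (6 * j + 10) - int (2 * j + 4) - int (3 * j + 4))"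
    by (rule eq) auto
  then show "N (6 * j + 10) = 6 * (int j + 1)\<^sup>2 + 2 * (int j + 1) + 1"
    unfolding square_div_4 by (simp add: power2_eq_square algebra_simps)
  have "N (6 * j + 11) = 2 + (if odd (6 * j + 11) then 1 else 0) + int ((2 * (3 * j + 4) + 1)\<^sup>2 div 4) - int ((2 * (2 * j + 3) + 1)\<^sup>2 div 4)
      + (int (3 * j + 5) - int (2 * j + 4)) * (int (6 * j + 11) - int (2 * j + 4) - int (3 * j + 5))"
    by (rule eq) auto
  then show "N (6 * j + 11) = 6 * (int j + 1)\<^sup>2 + 4 * (int j + 1) + 3"
    unfolding square_div_4 by (simp add: power2_eq_square algebra_simps)
qed

lemma Reg_small: "n < 5 \<Longrightarrow> Reg n = {}"
  by (auto simp: Reg_def)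

text \<open>The alternatives \<open>y + 3 = n\<close> and \<open>2 * y + 1 = n\<close> coincide
  here, so there is one pair fewer than the formula for \<open>i = 5\<close> would give at
  \<open>k = 0\<close>.\<close>

lemma Reg_5: "Reg 5 = {(2, 2), (2, 3)}"
  by (auto simp: Reg_def)

theorem theorem3p8:
  fixes n :: int
  shows "finite (CW_depth_dim TYPE('k::field) n) \<and>
    (n < 5 \<longrightarrow> card (CW_depth_dim TYPE('k::field) n) = 0) \<and>
    (n = 5 \<longrightarrow> card (CW_depth_dim TYPE('k::field) n) = 2) \<and>
    (n > 5 \<longrightarrow> (\<forall>k i :: int. n = 6 * k + i \<and> 1 \<le> k \<and> 0 \<le> i \<and> i \<le> 5 \<longrightarrow>
       int (card (CW_depth_dim TYPE('k::field) n)) =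
         (if i = 0 then 6 * k^2 - 6 * k + 2
          else if i = 1 then 6 * k^2 - 4 * k + 3
          else if i = 2 then 6 * k^2 - 2 * k + 1
          else if i = 3 then 6 * k^2 + 2
          else if i = 4 then 6 * k^2 + 2 * k + 1
          else 6 * k^2 + 4 * k + 3)))"
proof (cases "n < 0")
  case True
  then have "CW_depth_dim TYPE('k) n = {}" unfolding CW_depth_dim_def by auto
  then show ?thesis using True by simp
next
  case False
  then obtain m where n: "n = int m" using nonneg_int_cases by (metis not_le)
  have CW: "CW_depth_dim TYPE('k) n = map_prod enat enat ` Reg m" unfolding n by (rule CW_depth_dim_eq)
  have "inj_on (map_prod enat enat) (Reg m)" by (auto simp: inj_on_def)
  then have card: "card (CW_depth_dim TYPE('k) n) = card (Reg m)" unfolding CW by (rule card_image)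
  have "int (card (Reg m)) =
         (if i = 0 then 6 * k^2 - 6 * k + 2
          else if i = 1 then 6 * k^2 - 4 * k + 3
          else if i = 2 then 6 * k^2 - 2 * k + 1
          else if i = 3 then 6 * k^2 + 2
          else if i = 4 then 6 * k^2 + 2 * k + 1
          else 6 * k^2 + 4 * k + 3)"
    if ki: "n = 6 * k + i" "1 \<le> k" "0 \<le> i" "i \<le> 5" for k i
  proof -
    define j where "j = nat (k - 1)"
    have k: "k = int j + 1" using ki unfolding j_def by simp
    consider "i = 0" | "i = 1" | "i = 2" | "i = 3" | "i = 4" | "i = 5" using ki by linarith
    then show ?thesis
    proof cases
      case 1
      then have "m = 6 * j + 6" using ki(1) k n by linarith
      then show ?thesis using 1 card_Reg_mod_6(1)[of j] unfolding k by simp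
    next
      case 2
      then have "m = 6 * j + 7" using ki(1) k n by linarith
      then show ?thesis using 2 card_Reg_mod_6(2)[of j] unfolding k by simp
    next
      case 3
      then have "m = 6 * j + 8" using ki(1) k n by linarith
      then show ?thesis using 3 card_Reg_mod_6(3)[of j] unfolding k by simp
    next
      case 4
      then have "m = 6 * j + 9" using ki(1) k n by linarith
      then show ?thesis using 4 card_Reg_mod_6(4)[of j] unfolding k by simp
    next
      case 5
      then have "m = 6 * j + 10" using ki(1) k n by linarith
      then show ?thesis using 5 card_Reg_mod_6(5)[of j] unfolding k by simp
    next
      case 6
      then have "m = 6 * j + 11" using ki(1) k n by linarith
      then show ?thesis using 6 card_Reg_mod_6(6)[of j] unfolding k by simp
    qed
  qed
  moreover have "n < 5 \<Longrightarrow> card (Reg m) = 0" using Reg_small[of m] n by simp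
  moreover have "n = 5 \<Longrightarrow> card (Reg m) = 2" using Reg_5 n by simp
  moreover have "finite (CW_depth_dim TYPE('k) n)" unfolding CW by (simp add: finite_Reg)
  ultimately show ?thesis unfolding card by blast
qed

end
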